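(* For all integers $k\ge r\ge1$, the method HBVM$(k,r)$ is perfectly $A$-stable and has order $2r$. Moreover, it is energy conserving for all polynomial Hamiltonians of degree not larger than $2k/r$: if $H:\mathbb{R}^{2m}\to\mathbb{R}$ is a polynomial of degree $\nu\le 2k/r$ and HBVM$(k,r)$ is applied with stepsize $h>0$ to $y'=J\nabla H(y)$, $y(t_0)=y_0\in\mathbb{R}^{2m}$, then $H(u(t_0+h))=H(y_0)$.
   Context: $\{\hat P_j\}_{j\ge 0}$ are the shifted Legendre polynomials on $[0,1]$, scaled to be orthonormal: $\deg \hat P_j=j$ and $\int_0^1 \hat P_i(x)\hat P_j(x)\,\mathrm{d}x=\delta_{ij}$ for all $i,j\ge 0$. $J=\begin{pmatrix}0&I_m\\-I_m&0\end{pmatrix}$. HBVM$(k,r)$: let $c_1,\dots,c_k$ and $b_1,\dots,b_k$ be the nodes and weights of the $k$-point Gauss(-Legendre) quadrature formula on $[0,1]$. For a problem $y'=f(y)$, $y(t_0)=y_0$ (in particular $f=J\nabla H$) and stepsize $h>0$, the method gives $y_1=u(t_0+h)$, where $u$ is a polynomial of degree at most $r$ satisfying $$u'(t_0+ch)=\sum_{j=0}^{r-1}\hat P_j(c)\sum_{\ell=1}^k b_\ell\hat P_j(c_\ell) f(u(t_0+c_\ell h)),\quad c\in[0,1],\qquad u(t_0)=y_0 .$$ Order: the method has order $p$ if, for every analytic $f$ and every initial value $y_0$ in its domain, $y(t_0+h)-u(t_0+h)=O(h^{p+1})$ as $h\to0^+$, where $y$ is the exact solution and, for $h$ small, $u$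 is the unique solution of the discrete problem staying within a fixed small distance $\delta>0$ of $y_0$ on $[t_0,t_0+h]$. Perfect $A$-stability: applied with stepsize $h$ to the test equation $y'=\lambda y$, $\lambda\in\mathbb{C}$, the method gives $y_1=R(z)y_0$ with $z=h\lambda$, for all $z$ for which $u$ is uniquely determined; the absolute stability region is the set of those $z$ with $|R(z)|<1$. The method is perfectly $A$-stable if this region coincides with $\mathbb{C}^-=\{z\in\mathbb{C}:\Re(z)<0\}$. *)

theory Defs
  imports "HOL-Analysis.Analysis" "HOL-Computational_Algebra.Polynomial" "HOL-Library.Landau_Symbols"
begin

section \<open>Orthonormal shifted Legendre polynomials\<close>

text \<open>Rodrigues' formula on \<open>[0,1]\<close>; the factor \<open>sqrt (2 j + 1)\<close> normalises.  The lemmas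
  \<open>degree_shifted_legendre\<close> and \<open>shifted_legendre_orthonormal\<close> below show that these are the
  orthonormal polynomials of degree \<open>j\<close>.\<close>

definition shifted_legendre :: "nat \<Rightarrow> real poly" where
  "shifted_legendre j =
     smult (sqrt (2 * real j + 1) / fact j) ((pderiv ^^ j) ([:0, -1, 1:] ^ j))"

lemma degree_shifted_legendre: "degree (shifted_legendre j) = j"
  by (simp add: shifted_legendre_def degree_higher_pderiv degree_power_eq add_nonneg_eq_0_iff)

lemma shifted_legendre_nonzero: "shifted_legendre j \<noteq> 0"
proof (cases "j = 0")
  case True
  then show ?thesis by (simp add: shifted_legendre_def)
next
  case False
  then show ?thesis using degree_shifted_legendre[of j] by auto
qed

lemma power_dvd_higher_pderiv:
  fixes w :: "real poly"
  assumes "i \<le> n"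
  shows "w ^ (n - i) dvd (pderiv ^^ i) (w ^ n)"
  using assms
proof (induction i)
  case (Suc i)
  then obtain q where q: "(pderiv ^^ i) (w ^ n) = w ^ (n - i) * q"
    by (auto elim: dvdE)
  have e: "n - i = Suc (n - Suc i)" using Suc by simp
  have "pderiv (w ^ Suc (n - Suc i) * q)
      = w ^ (n - Suc i) * (w * pderiv q + q * smult (of_nat (Suc (n - Suc i))) (pderiv w))"
    by (simp add: pderiv_mult pderiv_power_Suc algebra_simps del: of_nat_Suc power_Suc)
       (simp add: algebra_simps)
  then show ?case using q e by (simp del: power_Suc)
qed simp

lemma higher_pderiv_boundary:
  assumes "i < n" "x = 0 \<or> x = (1::real)"
  shows "poly ((pderiv ^^ i) ([:0, -1, 1:] ^ n)) x = 0"
proof -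
  obtain q where "(pderiv ^^ i) ([:0, -1, 1:] ^ n) = [:0, -1, 1::real:] ^ (n - i) * q"
    using power_dvd_higher_pderiv[of i n "[:0, -1, 1:]"] assms by (auto elim: dvdE)
  then show ?thesis using assms by (auto simp: poly_power zero_power)
qed

lemma poly_integrable: "(poly p) integrable_on {0..1::real}" for p :: "real poly"
  by (intro integrable_continuous_real continuous_intros)

lemma integral_pderiv:
  "integral {0..1} (poly (pderiv p)) = poly p 1 - poly p (0::real)"
  by (intro integral_unique fundamental_theorem_of_calculus)
     (auto intro: has_field_derivative_at_within poly_DERIV
           simp flip: has_real_derivative_iff_has_vector_derivative)

lemma integral_poly_by_parts:
  fixes p q :: "real poly"
  assumes "poly (p * q) 1 = poly (p * q) 0"
  shows "integral {0..1} (poly (p * pderiv q)) = - integral {0..1} (poly (pderiv p * q))"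
proof -
  have "integral {0..1} (poly (pderiv (p * q))) = 0"
    using assms by (simp add: integral_pderiv)
  moreover have "poly (pderiv (p * q)) = (\<lambda>x. poly (p * pderiv q) x + poly (pderiv p * q) x)"
    by (auto simp: pderiv_mult algebra_simps)
  moreover have "integral {0..1} (\<lambda>x. poly (p * pderiv q) x + poly (pderiv p * q) x)
      = integral {0..1} (poly (p * pderiv q)) + integral {0..1} (poly (pderiv p * q))"
    by (intro integral_add poly_integrable)
  ultimately show ?thesis by simp
qed

lemma integral_rodrigues:
  fixes p :: "real poly"
  assumes "i \<le> n"
  shows "integral {0..1} (poly (p * (pderiv ^^ i) ([:0, -1, 1:] ^ n)))
       = (-1) ^ i * integral {0..1} (poly ((pderiv ^^ i) p * [:0, -1, 1:] ^ n))"
  using assms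
proof (induction i arbitrary: p)
  case (Suc i)
  have "integral {0..1} (poly (p * (pderiv ^^ Suc i) ([:0, -1, 1:] ^ n)))
      = - integral {0..1} (poly (pderiv p * (pderiv ^^ i) ([:0, -1, 1:] ^ n)))"
    using Suc.prems integral_poly_by_parts[of p "(pderiv ^^ i) ([:0, -1, 1:] ^ n)"]
    by (simp add: higher_pderiv_boundary)
  also have "\<dots> = - ((-1) ^ i * integral {0..1} (poly ((pderiv ^^ i) (pderiv p) * [:0, -1, 1:] ^ n)))"
    by (subst Suc.IH) (use Suc.prems in auto)
  finally show ?case by (simp add: funpow_swap1 del: poly_mult poly_power)
qed simp

lemma integral_beta_nat:
  "integral {0..1::real} (poly ([:0, 1:] ^ a * [:-1, 1:] ^ b))
     = (-1) ^ b * fact a * fact b / fact (a + b + 1)"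
proof (induction b arbitrary: a)
  case 0
  have "poly (pderiv (smult (1 / real (Suc a)) ([:0, 1:] ^ Suc a))) = poly ([:0, 1:] ^ a)"
    by (simp add: pderiv_smult pderiv_power_Suc pderiv_pCons del: power_Suc of_nat_Suc)
  then have "integral {0..1::real} (poly ([:0, 1:] ^ a)) = 1 / real (Suc a)"
    using integral_pderiv[of "smult (1 / real (Suc a)) ([:0, 1:] ^ Suc a)"]
    by (simp only: poly_smult poly_power) simp
  then show ?case by (simp only: power_0 mult_1_right) simp
next
  case (Suc b)
  let ?X = "[:0, 1:] :: real poly" and ?Y = "[:-1, 1:] :: real poly"
  have "integral {0..1} (poly (?Y ^ Suc b * pderiv (?X ^ Suc a)))
      = - integral {0..1} (poly (pderiv (?Y ^ Suc b) * ?X ^ Suc a))"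
    by (intro integral_poly_by_parts) (simp add: poly_power)
  moreover have "poly (?Y ^ Suc b * pderiv (?X ^ Suc a))
      = (\<lambda>x. real (Suc a) * poly (?X ^ a * ?Y ^ Suc b) x)"
    by (auto simp: pderiv_power_Suc pderiv_pCons simp del: power_Suc of_nat_Suc)
  moreover have "poly (pderiv (?Y ^ Suc b) * ?X ^ Suc a)
      = (\<lambda>x. real (Suc b) * poly (?X ^ Suc a * ?Y ^ b) x)"
    by (auto simp: pderiv_power_Suc pderiv_pCons simp del: power_Suc of_nat_Suc)
  ultimately have "real (Suc a) * integral {0..1} (poly (?X ^ a * ?Y ^ Suc b))
      = - (real (Suc b) * integral {0..1} (poly (?X ^ Suc a * ?Y ^ b)))"
    by (simp only: integral_mult_right)
  also have "\<dots> = - (real (Suc b) * ((-1) ^ b * fact (Suc a) * fact b / fact (Suc a + b + 1)))"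
    by (simp only: Suc.IH)
  also have "\<dots> = real (Suc a) * ((-1) ^ Suc b * fact a * fact (Suc b) / fact (a + Suc b + 1))"
    by simp
  finally show ?case by (simp only: mult_cancel_left of_nat_eq_0_iff nat.distinct simp_thms)
qed

lemma higher_pderiv_degree:
  fixes p :: "real poly"
  shows "(pderiv ^^ degree p) p = [:fact (degree p) * lead_coeff p:]"
proof -
  have "degree ((pderiv ^^ degree p) p) = 0"
    by (simp add: degree_higher_pderiv)
  then obtain c where c: "(pderiv ^^ degree p) p = [:c:]"
    by (rule degree_eq_zeroE)
  have "coeff ((pderiv ^^ degree p) p) 0 = fact (degree p) * lead_coeff p"
    by (simp add: coeff_higher_pderiv pochhammer_fact[symmetric])
  with c show ?thesis by simp
qed

lemma shifted_legendre_orthogonal_lower: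
  assumes "degree p < n"
  shows "integral {0..1} (\<lambda>x. poly p x * poly (shifted_legendre n) x) = 0"
proof -
  have "(pderiv ^^ n) p = (pderiv ^^ (n - degree p)) ((pderiv ^^ degree p) p)"
    using assms fun_cong[OF funpow_add[of "n - degree p" "degree p" pderiv], of p] by simp
  also have "\<dots> = 0"
  proof -
    obtain m where "n - degree p = Suc m" using assms by (metis Suc_diff_Suc)
    then show ?thesis
      by (simp add: higher_pderiv_degree funpow_swap1 pderiv_pCons)
  qed
  finally have z: "(pderiv ^^ n) p = 0" .
  have z0: "integral {0..1} (poly (0 :: real poly)) = 0"
    by (simp cong: integral_cong)
  have "(\<lambda>x. poly p x * poly (shifted_legendre n) x)
      = (\<lambda>x. (sqrt (2 * real n + 1) / fact n) * poly (p * (pderiv ^^ n) ([:0, -1, 1:] ^ n)) x)"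
    by (auto simp: shifted_legendre_def)
  then show ?thesis
    by (simp only: integral_mult_right integral_rodrigues[OF order_refl] z z0 mult_zero_left mult_zero_right)
qed

lemma shifted_legendre_normalised:
  "integral {0..1} (\<lambda>x. poly (shifted_legendre n) x * poly (shifted_legendre n) x) = 1"
proof -
  let ?w = "[:0, -1, 1:] :: real poly" and ?c = "sqrt (2 * real n + 1) / fact n"
  have deg: "degree (?w ^ n) = 2 * n" by (simp add: degree_power_eq)
  have lc: "lead_coeff (?w ^ n) = 1" by (simp add: lead_coeff_power)
  have D: "(pderiv ^^ n) ((pderiv ^^ n) (?w ^ n)) = [:fact (2 * n):]"
    using higher_pderiv_degree[of "?w ^ n"] lc deg
    by (simp add: mult_2 funpow_add)
  have w: "?w = [:0, 1:] * [:-1, 1:]" by simp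
  have "integral {0..1} (poly (?w ^ n)) = (-1) ^ n * fact n * fact n / fact (2 * n + 1)"
    using integral_beta_nat[of n n] by (simp only: w power_mult_distrib mult_2)
  then have I: "integral {0..1} (poly ((pderiv ^^ n) ((pderiv ^^ n) (?w ^ n)) * ?w ^ n))
      = fact (2 * n) * ((-1) ^ n * fact n * fact n / fact (2 * n + 1))"
    by (simp add: D poly_power cong: integral_cong)
  have "(\<lambda>x. poly (shifted_legendre n) x * poly (shifted_legendre n) x)
      = (\<lambda>x. ?c\<^sup>2 * poly ((pderiv ^^ n) (?w ^ n) * (pderiv ^^ n) (?w ^ n)) x)"
    by (auto simp: shifted_legendre_def power2_eq_square)
  then have "integral {0..1} (\<lambda>x. poly (shifted_legendre n) x * poly (shifted_legendre n) x)
      = ?c\<^sup>2 * ((-1) ^ n * (fact (2 * n) * ((-1) ^ n * fact n * fact n / fact (2 * n + 1))))"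
    by (simp only: integral_mult_right integral_rodrigues[OF order_refl] I)
  also have "\<dots> = 1"
  proof -
    have F: "fact (2 * n + 1) = (2 * real n + 1) * fact (2 * n)" by simp
    have s: "((-1::real) ^ n) * ((-1) ^ n) = 1" by (simp flip: power_mult_distrib)
    have c: "?c\<^sup>2 = (2 * real n + 1) / (fact n)\<^sup>2" by (simp add: power_divide)
    have n: "2 * real n + 1 \<noteq> 0" by linarith
    have "c / g\<^sup>2 * (s * (F * (s * g * g / (c * F)))) = s * s"
      if "c \<noteq> 0" "F \<noteq> 0" "g \<noteq> 0" for c g s F :: real
      using that by (simp add: field_simps power2_eq_square)
    from this[OF n fact_nonzero fact_nonzero] show ?thesis
      unfolding F c by (rule trans) (rule s)
  qed
  finally show ?thesis .
qed

lemma shifted_legendre_orthonormal: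
  "integral {0..1} (\<lambda>x. poly (shifted_legendre i) x * poly (shifted_legendre j) x)
     = (if i = j then 1 else 0)"
proof (cases i j rule: linorder_cases)
  case less
  then show ?thesis
    using shifted_legendre_orthogonal_lower[of "shifted_legendre i" j]
    by (simp add: degree_shifted_legendre)
next
  case equal
  then show ?thesis by (simp add: shifted_legendre_normalised)
next
  case greater
  then show ?thesis
    using shifted_legendre_orthogonal_lower[of "shifted_legendre j" i]
    by (simp add: degree_shifted_legendre mult.commute)
qed


section \<open>Gauss-Legendre quadrature on \<open>[0,1]\<close>\<close>

text \<open>The \<open>k\<close> nodes are kept as a set (\<open>card_gauss_nodes\<close>), and each weight is indexed by its
  node; it is the integral of the Lagrange basis polynomial of that node.\<close>

definition gauss_nodes :: "nat \<Rightarrow> real set" where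
  "gauss_nodes k = {x. poly (shifted_legendre k) x = 0}"

definition gauss_weight :: "nat \<Rightarrow> real \<Rightarrow> real" where
  "gauss_weight k x =
     integral {0..1} (\<lambda>s. \<Prod>y\<in>gauss_nodes k - {x}. (s - y) / (x - y))"

lemma pderiv_roots_between:
  fixes p :: "real poly"
  assumes "card S = Suc n" "\<And>x. x \<in> S \<Longrightarrow> poly p x = 0"
  shows "\<exists>T. finite T \<and> card T = n \<and> T \<subseteq> {Min S<..<Max S} \<and> (\<forall>x\<in>T. poly (pderiv p) x = 0)"
  using assms
proof (induction n arbitrary: S)
  case 0
  show ?case by (intro exI[of _ "{}"]) auto
next
  case (Suc n)
  define M where "M = Max S"
  define S' where "S' = S - {M}"
  have fin: "finite S" using Suc.prems(1) card.infinite by force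
  have ne: "S \<noteq> {}" using Suc.prems(1) by auto
  have M: "M \<in> S" unfolding M_def using fin ne by simp
  have c: "card S' = Suc n" using Suc.prems(1) M fin by (simp add: S'_def)
  have fin': "finite S'" and ne': "S' \<noteq> {}" using fin c by (simp add: S'_def, force)
  have sub: "S' \<subseteq> S" by (auto simp: S'_def)
  obtain T where T: "finite T" "card T = n" "T \<subseteq> {Min S'<..<Max S'}"
      "\<forall>x\<in>T. poly (pderiv p) x = 0"
    using Suc.IH[OF c] Suc.prems(2) sub by blast
  have Ms: "Max S' \<in> S'" using fin' ne' by simp
  have lt: "Max S' < M"
    using Ms fin by (metis DiffE M_def Max_ge S'_def insertI1 order_less_le)
  obtain z where z: "Max S' < z" "z < M" "poly (pderiv p) z = 0"
    using poly_MVT[OF lt, of p] Suc.prems(2) M Ms sub lt by auto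
  have "z \<notin> T" using T z by auto
  moreover have "Min S \<le> Min S'" using Min_antimono[OF sub ne' fin] .
  moreover have "Min S' \<le> Max S'" using Ms fin' by simp
  ultimately show ?case
    using T z lt by (intro exI[of _ "insert z T"]) (auto simp: M_def[symmetric])
qed

lemma higher_pderiv_roots:
  assumes "i \<le> n"
  shows "\<exists>T. finite T \<and> card T = i \<and> T \<subseteq> {0<..<1::real} \<and>
             (\<forall>x\<in>T. poly ((pderiv ^^ i) ([:0, -1, 1:] ^ n)) x = 0)"
  using assms
proof (induction i)
  case 0
  show ?case by (intro exI[of _ "{}"]) auto
next
  case (Suc i)
  let ?q = "(pderiv ^^ i) ([:0, -1, 1:] ^ n) :: real poly"
  from Suc obtain T where T: "finite T" "card T = i" "T \<subseteq> {0<..<1::real}" "\<forall>x\<in>T. poly ?q x = 0"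
    by (meson Suc_leD)
  define S where "S = insert 0 (insert 1 T)"
  have "0 \<notin> T" "1 \<notin> T" using T(3) by auto
  then have "card S = Suc (Suc i)" using T(1,2) by (simp add: S_def)
  moreover have "poly ?q x = 0" if "x \<in> S" for x
    using that T(4) higher_pderiv_boundary[of i n x] Suc_le_lessD[OF Suc.prems] unfolding S_def by blast
  ultimately obtain U where U: "finite U" "card U = Suc i" "U \<subseteq> {Min S<..<Max S}"
      "\<forall>x\<in>U. poly (pderiv ?q) x = 0"
    using pderiv_roots_between[of S "Suc i" ?q] by blast
  have S: "finite S" "0 \<in> S" "1 \<in> S" using T(1) by (simp_all add: S_def)
  have "x \<in> {0..1}" if "x \<in> S" for x
    using that T(3) by (auto simp: S_def subset_iff less_imp_le)
  then have "Min S = 0" "Max S = 1"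
    using S by (auto intro!: Min_eqI Max_eqI)
  with U show ?case by (intro exI[of _ U]) (simp only: funpow.simps o_apply simp_thms)
qed

lemma finite_gauss_nodes: "finite (gauss_nodes k)"
  unfolding gauss_nodes_def by (rule poly_roots_finite[OF shifted_legendre_nonzero])

lemma card_gauss_nodes: "card (gauss_nodes k) = k"
  and gauss_nodes_subset: "gauss_nodes k \<subseteq> {0<..<1}"
proof -
  obtain T where T: "finite T" "card T = k" "T \<subseteq> {0<..<1::real}"
      "\<forall>x\<in>T. poly ((pderiv ^^ k) ([:0, -1, 1:] ^ k)) x = 0"
    using higher_pderiv_roots[of k k] by auto
  have sub: "T \<subseteq> gauss_nodes k"
    using T by (auto simp: gauss_nodes_def shifted_legendre_def)
  have "card (gauss_nodes k) \<le> k"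
    unfolding gauss_nodes_def
    using card_poly_roots_bound[OF shifted_legendre_nonzero, of k] by (simp add: degree_shifted_legendre)
  then have "T = gauss_nodes k"
    using sub T finite_gauss_nodes by (metis card_seteq)
  with T show "card (gauss_nodes k) = k" "gauss_nodes k \<subseteq> {0<..<1}" by auto
qed


section \<open>The method HBVM(k,r)\<close>

definition poly_curve :: "nat \<Rightarrow> (real \<Rightarrow> 'a::real_normed_vector) \<Rightarrow> bool" where
  "poly_curve r u \<longleftrightarrow> (\<exists>a. \<forall>t. u t = (\<Sum>i\<le>r. t ^ i *\<^sub>R a i))"

text \<open>\<open>u\<close> solves the discrete problem with stepsize \<open>h\<close> (meaningful for \<open>h > 0\<close>); the numerical
  approximation at \<open>t0 + h\<close> is \<open>u (t0 + h)\<close>.\<close>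

definition hbvm_solution ::
  "nat \<Rightarrow> nat \<Rightarrow> ('a::real_normed_vector \<Rightarrow> 'a) \<Rightarrow> real \<Rightarrow> 'a \<Rightarrow> real \<Rightarrow> (real \<Rightarrow> 'a) \<Rightarrow> bool" where
  "hbvm_solution k r f t0 y0 h u \<longleftrightarrow>
     poly_curve r u \<and> u t0 = y0 \<and>
     (\<forall>c\<in>{0..1}. (u has_vector_derivative
        (\<Sum>j<r. poly (shifted_legendre j) c *\<^sub>R
          (\<Sum>x\<in>gauss_nodes k. (gauss_weight k x * poly (shifted_legendre j) x) *\<^sub>R f (u (t0 + x * h)))))
        (at (t0 + c * h)))"


section \<open>Order\<close>

definition real_analytic_on :: "(real^'n::finite \<Rightarrow> real^'l::finite) \<Rightarrow> (real^'n) set \<Rightarrow> bool" where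
  "real_analytic_on f \<Omega> \<longleftrightarrow>
     (\<forall>a\<in>\<Omega>. \<exists>e>0. \<exists>C :: ('n \<Rightarrow> nat) \<Rightarrow> real^'l.
        \<forall>y\<in>ball a e. ((\<lambda>\<alpha>. (\<Prod>i\<in>UNIV. (y $ i - a $ i) ^ \<alpha> i) *\<^sub>R C \<alpha>) has_sum f y) UNIV)"

definition ode_solution ::
  "('a::real_normed_vector \<Rightarrow> 'a) \<Rightarrow> 'a set \<Rightarrow> real \<Rightarrow> 'a \<Rightarrow> real \<Rightarrow> (real \<Rightarrow> 'a) \<Rightarrow> bool" where
  "ode_solution f \<Omega> t0 y0 T y \<longleftrightarrow>
     y t0 = y0 \<and>
     (\<forall>t\<in>{t0..t0 + T}. y t \<in> \<Omega> \<and> (y has_vector_derivative f (y t)) (at t within {t0..t0 + T}))"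

text \<open>A solution of the discrete problem staying within distance \<open>\<delta>\<close> of \<open>y0\<close> on \<open>[t0, t0 + h]\<close>.\<close>

definition hbvm_local_solution ::
  "nat \<Rightarrow> nat \<Rightarrow> ('a::real_normed_vector \<Rightarrow> 'a) \<Rightarrow> real \<Rightarrow> 'a \<Rightarrow> real \<Rightarrow> real \<Rightarrow> (real \<Rightarrow> 'a) \<Rightarrow> bool" where
  "hbvm_local_solution k r f t0 y0 \<delta> h u \<longleftrightarrow>
     hbvm_solution k r f t0 y0 h u \<and> (\<forall>t\<in>{t0..t0 + h}. dist y0 (u t) \<le> \<delta>)"

text \<open>The first argument only carries the dimension \<open>CARD('n)\<close> of the problems.  That, for every
  small \<open>\<delta>\<close>, the discrete solution exists and is unique for small \<open>h\<close> is part of the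
  definition, so that the description of \<open>u\<close> in the error is proper.\<close>

definition hbvm_has_order :: "'n::finite itself \<Rightarrow> nat \<Rightarrow> nat \<Rightarrow> nat \<Rightarrow> bool" where
  "hbvm_has_order N k r p \<longleftrightarrow>
     (\<forall>(f :: real^'n \<Rightarrow> real^'n) \<Omega> t0. \<forall>y0\<in>\<Omega>. open \<Omega> \<longrightarrow> real_analytic_on f \<Omega> \<longrightarrow>
        (\<exists>\<delta>0>0. cball y0 \<delta>0 \<subseteq> \<Omega> \<and> (\<forall>\<delta>. 0 < \<delta> \<and> \<delta> \<le> \<delta>0 \<longrightarrow>
           (\<forall>\<^sub>F h in at_right 0. \<exists>!u. hbvm_local_solution k r f t0 y0 \<delta> h u) \<and>
           (\<forall>T>0. \<forall>y. ode_solution f \<Omega> t0 y0 T y \<longrightarrow>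
              (\<lambda>h. norm (y (t0 + h) - (THE u. hbvm_local_solution k r f t0 y0 \<delta> h u) (t0 + h)))
                \<in> O[at_right 0](\<lambda>h. h ^ (p + 1))))))"


section \<open>Linear stability\<close>

definition hbvm_determined :: "nat \<Rightarrow> nat \<Rightarrow> complex \<Rightarrow> bool" where
  "hbvm_determined k r z \<longleftrightarrow>
     (\<forall>h \<mu> t0 y0. h > 0 \<longrightarrow> of_real h * \<mu> = z \<longrightarrow>
        (\<exists>!u. hbvm_solution k r (\<lambda>y. \<mu> * y) t0 y0 h u))"

text \<open>The values of \<open>R\<close> outside the set \<open>{z. hbvm_determined k r z}\<close> are irrelevant.\<close>

definition hbvm_stability_function :: "nat \<Rightarrow> nat \<Rightarrow> (complex \<Rightarrow> complex) \<Rightarrow> bool" where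
  "hbvm_stability_function k r R \<longleftrightarrow>
     (\<forall>h \<mu> t0 y0 u. h > 0 \<longrightarrow> hbvm_determined k r (of_real h * \<mu>) \<longrightarrow>
        hbvm_solution k r (\<lambda>y. \<mu> * y) t0 y0 h u \<longrightarrow> u (t0 + h) = R (of_real h * \<mu>) * y0)"

definition hbvm_perfectly_A_stable :: "nat \<Rightarrow> nat \<Rightarrow> bool" where
  "hbvm_perfectly_A_stable k r \<longleftrightarrow>
     (\<exists>R. hbvm_stability_function k r R \<and>
        {z. hbvm_determined k r z \<and> norm (R z) < 1} = {z. Re z < 0})"


section \<open>Polynomial Hamiltonian problems\<close>

text \<open>Polynomial functions of total degree at most \<open>d\<close>; \<open>\<alpha>\<close> ranges over multi-indices.\<close>

definition poly_fun_of_degree_le :: "nat \<Rightarrow> (real^'n::finite \<Rightarrow> real) \<Rightarrow> bool" where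
  "poly_fun_of_degree_le d H \<longleftrightarrow>
     (\<exists>S (C :: ('n \<Rightarrow> nat) \<Rightarrow> real). finite S \<and> (\<forall>\<alpha>\<in>S. (\<Sum>i\<in>UNIV. \<alpha> i) \<le> d) \<and>
        (\<forall>y. H y = (\<Sum>\<alpha>\<in>S. C \<alpha> * (\<Prod>i\<in>UNIV. (y $ i) ^ \<alpha> i))))"

definition gradient :: "(real^'n::finite \<Rightarrow> real) \<Rightarrow> real^'n \<Rightarrow> real^'n" where
  "gradient H y = (THE g. GDERIV H y :> g)"

text \<open>The coordinates of \<open>\<real>\<^sup>2\<^sup>m\<close>, \<open>m = CARD('m)\<close>, are indexed by \<open>'m + 'm\<close>.\<close>

definition symplectic_J :: "real^('m::finite + 'm)^('m + 'm)" where
  "symplectic_J = (\<chi> i j. case (i, j) of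
       (Inl a, Inr b) \<Rightarrow> (if a = b then 1 else 0)
     | (Inr a, Inl b) \<Rightarrow> (if a = b then -1 else 0)
     | _ \<Rightarrow> 0)"

definition hamiltonian_field ::
  "(real^('m::finite + 'm) \<Rightarrow> real) \<Rightarrow> real^('m + 'm) \<Rightarrow> real^('m + 'm)" where
  "hamiltonian_field H y = symplectic_J *v gradient H y"

end

theory Submission
  imports Defs
begin

text \<open>Let \<open>Q\<close> map a function on \<open>[0,1]\<close> to the polynomial of degree below \<open>r\<close> whose Legendre
  coefficients are computed by the \<open>k\<close>-point Gauss formula (\<open>gauss_projection\<close>).  In the scaled
  time \<open>c\<close> the method is \<open>u' = h Q (f \<circ> u)\<close>, \<open>u 0 = y0\<close>.  The formula integrates polynomials of
  degree below \<open>2 k\<close> exactly, and \<open>k \<ge> r\<close>, so \<open>Q\<close> fixes polynomials of degree below \<open>r\<close>, and a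
  polynomial \<open>p\<close> and \<open>Q p\<close> have the same inner product with every test polynomial \<open>v\<close> of degree
  below \<open>r\<close> with \<open>degree v + degree p < 2 k\<close>.  All three claims rest on this
  (\<open>gauss_projection_id\<close>, \<open>unit_integral_mult_gauss_projection\<close>).

  Stability.  On the test equation \<open>u' = z Q u\<close>, and as \<open>u'\<close> has degree below \<open>r\<close>, the integral of
  \<open>2 Re (cnj u u')\<close> is \<open>2 Re z\<close> times the squared norm of \<open>Q u\<close>, which is nonzero unless \<open>u = 0\<close>.
  So for \<open>u \<noteq> 0\<close>, \<open>\<bar>u 1\<bar>\<close> is smaller than \<open>\<bar>u 0\<bar>\<close> exactly for \<open>Re z < 0\<close> (\<open>hbvm_linear_growth\<close>).  In that half
  plane this also gives uniqueness, and a solution can be written down (\<open>hbvm_linear_explicit\<close>).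

  Energy.  \<open>H (u 1) - H (u 0)\<close> is the integral of the gradient at \<open>u\<close> times \<open>h Q (J \<nabla>H(u))\<close>.  For
  \<open>\<nu> r \<le> 2 k\<close> the degrees allow replacing the gradient by its projection, and then skew-symmetry of
  \<open>J\<close> makes the integral vanish.

  Order.  Up to powers of \<open>h\<close> higher than those of interest, everything is a polynomial in \<open>c\<close>
  whose coefficient of \<open>c ^ i\<close> is \<open>O(h ^ i)\<close>, because it is a polynomial in \<open>c h\<close> with bounded
  coefficients (\<open>graded\<close>); the field may be replaced by a Taylor polynomial at \<open>y0\<close>.  The error \<open>e\<close>
  satisfies a linear equation with \<open>h\<close> times the defect \<open>p - Q p\<close> of a graded \<open>p\<close> as inhomogeneity,
  up to negligible terms.  The defect is only \<open>O(h ^ r)\<close>, hence \<open>e = O(h ^ (r + 1))\<close>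
  inside the step, but its integral against any graded weight is \<open>O(h ^ (2 r))\<close>
  (\<open>defect_moment\<close>).  The error at the end of the step is, by duality, \<open>h\<close> times such an integral
  with an approximate adjoint solution as the weight (\<open>adjoint_weights\<close>, \<open>superconvergence\<close>).
  Existence and uniqueness of the discrete solution is a contraction argument in its node values.\<close>

section \<open>Integration of polynomials over the unit interval and Gauss quadrature\<close>

definition unit_integral :: "real poly \<Rightarrow> real" where
  "unit_integral p = integral {0..1} (poly p)"

lemma unit_integral_0 [simp]: "unit_integral 0 = 0"
proof -
  have "poly (0::real poly) = (\<lambda>x. 0)" by auto
  then show ?thesis by (simp add: unit_integral_def)
qed

lemma unit_integral_add: "unit_integral (p + q) = unit_integral p + unit_integral q"
proof -
  have "poly (p + q) = (\<lambda>x. poly p x + poly q x)" by auto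
  then show ?thesis
    using integral_add[OF poly_integrable[of p] poly_integrable[of q]] by (simp add: unit_integral_def)
qed

lemma unit_integral_smult: "unit_integral (smult a p) = a * unit_integral p"
proof -
  have "poly (smult a p) = (\<lambda>x. a * poly p x)" by auto
  then show ?thesis by (simp add: unit_integral_def)
qed

lemma unit_integral_diff: "unit_integral (p - q) = unit_integral p - unit_integral q"
  using unit_integral_add[of p "smult (-1) q"] unit_integral_smult[of "-1" q] by simp

lemma unit_integral_sum: "unit_integral (sum f A) = (\<Sum>i\<in>A. unit_integral (f i))"
  by (induction A rule: infinite_finite_induct) (auto simp: unit_integral_add)

lemma unit_integral_nonneg: "(\<And>x. poly p x \<ge> 0) \<Longrightarrow> unit_integral p \<ge> 0"
  unfolding unit_integral_def by (intro integral_nonneg poly_integrable) auto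

lemma unit_integral_pderiv: "unit_integral (pderiv p) = poly p 1 - poly p 0"
  by (simp add: unit_integral_def integral_pderiv)

lemma unit_integral_square_eq_0:
  assumes "unit_integral (p * p) = 0"
  shows "p = 0"
proof (rule ccontr)
  assume "p \<noteq> 0"
  have "poly (p * p) x = 0" if x: "x \<in> {0..1}" for x
  proof (rule has_integral_0_cbox_imp_0[of 0 1 "poly (p * p)" x])
    show "continuous_on (cbox 0 1) (poly (p * p))" by (intro continuous_intros)
    show "(poly (p * p) has_integral 0) (cbox 0 1)"
      using assms poly_integrable[of "p * p"] unfolding unit_integral_def
      by (metis box_real(2) integrable_integral)
  qed (use x in auto)
  then have "{0..1} \<subseteq> {x. poly p x = 0}" by auto
  moreover have "infinite {0..1::real}" by (simp add: infinite_Icc)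
  ultimately show False using poly_roots_finite[OF \<open>p \<noteq> 0\<close>] finite_subset by blast
qed

lemma legendre_orthogonal:
  "unit_integral (shifted_legendre i * shifted_legendre j) = (if i = j then 1 else 0)"
proof -
  have "poly (shifted_legendre i * shifted_legendre j) =
    (\<lambda>x. poly (shifted_legendre i) x * poly (shifted_legendre j) x)" by auto
  then show ?thesis by (simp add: unit_integral_def shifted_legendre_orthonormal)
qed

lemma legendre_orthogonal_lower:
  assumes "degree p < n"
  shows "unit_integral (p * shifted_legendre n) = 0"
proof -
  have "poly (p * shifted_legendre n) = (\<lambda>x. poly p x * poly (shifted_legendre n) x)" by auto
  then show ?thesis using shifted_legendre_orthogonal_lower[OF assms] by (simp add: unit_integral_def)
qed

lemma legendre_span:
  assumes "degree p < n"
  shows "\<exists>a. p = (\<Sum>j<n. smult (a j) (shifted_legendre j))"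
  using assms
proof (induction n arbitrary: p)
  case (Suc n)
  let ?L = "shifted_legendre n"
  define c where "c = coeff p n / lead_coeff ?L"
  define q where "q = p - smult c ?L"
  have cn: "coeff q n = 0"
    using shifted_legendre_nonzero[of n] degree_shifted_legendre[of n]
    by (simp add: q_def c_def) (metis leading_coeff_0_iff)
  have dq: "degree q \<le> n"
    unfolding q_def using Suc.prems degree_shifted_legendre[of n]
    by (intro degree_diff_le) (auto intro: order_trans[OF degree_smult_le])
  have ex: "\<exists>a. q = (\<Sum>j<n. smult (a j) (shifted_legendre j))"
  proof (cases "n = 0")
    case True
    then have "q = 0" using cn dq by (metis le_zero_eq leading_coeff_0_iff)
    then show ?thesis using True by simp
  next
    case False
    have "degree q < n" using cn dq False
      by (metis degree_0 leading_coeff_0_iff linorder_not_less order_le_less zero_less_iff_neq_zero)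
    then show ?thesis by (rule Suc.IH)
  qed
  then obtain a where a: "q = (\<Sum>j<n. smult (a j) (shifted_legendre j))" by blast
  have "p = (\<Sum>j<Suc n. smult ((a(n := c)) j) (shifted_legendre j))"
    using a by (simp add: q_def algebra_simps)
  then show ?case by (rule exI[where x = "a(n := c)"])
qed simp

lemma legendre_expansion:
  assumes "degree p < n"
  shows "p = (\<Sum>j<n. smult (unit_integral (shifted_legendre j * p)) (shifted_legendre j))"
proof -
  obtain a where a: "p = (\<Sum>j<n. smult (a j) (shifted_legendre j))"
    using legendre_span[OF assms] by blast
  have "unit_integral (shifted_legendre i * p) = a i" if "i < n" for i
  proof -
    have "unit_integral (shifted_legendre i * p) =
        (\<Sum>j<n. a j * unit_integral (shifted_legendre i * shifted_legendre j))"
      by (subst a) (simp add: sum_distrib_left unit_integral_sum unit_integral_smult)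
    also have "\<dots> = (\<Sum>j<n. if j = i then a j else 0)"
      by (intro sum.cong) (auto simp: legendre_orthogonal)
    also have "\<dots> = a i" using that by simp
    finally show ?thesis .
  qed
  then show ?thesis by (subst a) simp
qed

lemma lagrange_interpolation:
  fixes p :: "real poly"
  assumes "finite S" "degree p < card S"
  shows "poly p t = (\<Sum>x\<in>S. poly p x * (\<Prod>y\<in>S - {x}. (t - y) / (x - y)))"
proof -
  define L where "L x = (\<Prod>y\<in>S - {x}. smult (1 / (x - y)) [:-y, 1:])" for x
  define q where "q = (\<Sum>x\<in>S. smult (poly p x) (L x))"
  have L: "poly (L x) t = (\<Prod>y\<in>S - {x}. (t - y) / (x - y))" for x t
    unfolding L_def poly_prod by (intro prod.cong) (auto simp: diff_divide_distrib)
  have dL: "degree (L x) < card S" if "x \<in> S" for x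
  proof -
    have "degree (L x) \<le> (\<Sum>y\<in>S - {x}. (degree \<circ> (\<lambda>y. smult (1 / (x - y)) [:-y, 1:])) y)"
      unfolding L_def using assms(1) by (intro degree_prod_sum_le) auto
    also have "\<dots> \<le> (\<Sum>y\<in>S - {x}. 1)" by (intro sum_mono) auto
    also have "\<dots> = card S - 1" using that by (simp add: assms(1))
    also have "\<dots> < card S"
    proof -
      have "card S > 0" using that assms(1) card_gt_0_iff by blast
      then show ?thesis by simp
    qed
    finally show ?thesis .
  qed
  have "degree q < card S"
    unfolding q_def using assms dL
    by (intro degree_sum_less) (auto intro: le_less_trans[OF degree_smult_le])
  moreover have "poly q z = poly p z" if "z \<in> S" for z
  proof -
    have "poly q z = (\<Sum>x\<in>S. poly p x * poly (L x) z)" by (simp add: q_def poly_sum)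
    also have "\<dots> = (\<Sum>x\<in>S. if x = z then poly p x else 0)"
    proof (intro sum.cong refl)
      fix x assume "x \<in> S"
      show "poly p x * poly (L x) z = (if x = z then poly p x else 0)"
      proof (cases "x = z")
        case True
        then show ?thesis by (auto simp: L intro!: prod.neutral)
      next
        case False
        then have "poly (L x) z = 0" unfolding L
          using assms(1) that by (intro prod_zero) auto
        then show ?thesis using False by simp
      qed
    qed
    also have "\<dots> = poly p z" using that assms(1) by simp
    finally show ?thesis .
  qed
  ultimately have "p = q" using assms by (intro poly_eqI_degree[of S]) auto
  then have "poly p t = poly q t" by simp
  also have "\<dots> = (\<Sum>x\<in>S. poly p x * (\<Prod>y\<in>S - {x}. (t - y) / (x - y)))"
    by (simp add: q_def poly_sum L)
  finally show ?thesis .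
qed

text \<open>Divide by the Legendre polynomial of degree \<open>k\<close>.  The multiple of it is invisible to both
  sides: its integral vanishes by orthogonality, its values at the nodes are zero.  The remainder
  is reproduced by interpolation.\<close>

theorem gauss_quadrature_exact:
  assumes "degree p < 2 * k"
  shows "(\<Sum>x\<in>gauss_nodes k. gauss_weight k x * poly p x) = unit_integral p"
proof -
  let ?P = "shifted_legendre k" and ?S = "gauss_nodes k"
  have k: "k > 0" using assms by simp
  define q s where "q = p div ?P" and "s = p mod ?P"
  have p: "p = q * ?P + s" by (simp add: q_def s_def)
  have ds: "degree s < k"
    using degree_mod_less[OF shifted_legendre_nonzero[of k], of p] k
    by (auto simp: s_def degree_shifted_legendre)
  have dq: "degree q < k"
  proof (cases "q = 0")
    case False
    have "degree (q * ?P) = degree q + k"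
      using False by (simp add: degree_mult_eq shifted_legendre_nonzero degree_shifted_legendre)
    moreover have "degree (q * ?P) \<le> max (degree p) (degree s)"
      using degree_diff_le_max[of p s] p by (metis add_diff_cancel_right')
    ultimately show ?thesis using assms ds by linarith
  qed (use k in simp)
  have "unit_integral p = unit_integral s"
    unfolding p unit_integral_add using legendre_orthogonal_lower[OF dq] by simp
  also have "\<dots> = integral {0..1}
      (\<lambda>t. \<Sum>x\<in>?S. poly s x * (\<Prod>y\<in>?S - {x}. (t - y) / (x - y)))"
    unfolding unit_integral_def
    by (intro arg_cong2[of _ _ _ _ integral] refl ext lagrange_interpolation)
       (use ds in \<open>auto simp: finite_gauss_nodes card_gauss_nodes\<close>)
  also have "\<dots> = (\<Sum>x\<in>?S. integral {0..1} (\<lambda>t. poly s x * (\<Prod>y\<in>?S - {x}. (t - y) / (x - y))))"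
    by (intro integral_sum finite_gauss_nodes integrable_continuous_real)
       (auto intro!: continuous_intros)
  also have "\<dots> = (\<Sum>x\<in>?S. gauss_weight k x * poly s x)"
    by (simp add: gauss_weight_def mult.commute)
  also have "\<dots> = (\<Sum>x\<in>?S. gauss_weight k x * poly p x)"
    by (intro sum.cong) (auto simp: p gauss_nodes_def)
  finally show ?thesis by simp
qed

section \<open>The discrete Legendre projection\<close>

definition gauss_projection :: "nat \<Rightarrow> nat \<Rightarrow> (real \<Rightarrow> real) \<Rightarrow> real poly" where
  "gauss_projection k r g = (\<Sum>j<r.
     smult (\<Sum>x\<in>gauss_nodes k. gauss_weight k x * poly (shifted_legendre j) x * g x)
       (shifted_legendre j))"

lemma gauss_projection_cong:
  "(\<And>x. x \<in> gauss_nodes k \<Longrightarrow> g x = g' x) \<Longrightarrow> gauss_projection k r g = gauss_projection k r g'"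
  by (simp add: gauss_projection_def)

lemma gauss_projection_add:
  "gauss_projection k r (\<lambda>x. f x + g x) = gauss_projection k r f + gauss_projection k r g"
  by (simp add: gauss_projection_def sum.distrib ring_distribs smult_add_left)

lemma smult_sum_right: "smult a (sum f A) = (\<Sum>i\<in>A. smult a (f i))"
  by (induction A rule: infinite_finite_induct) (auto simp: smult_add_right)

lemma gauss_projection_cmult:
  "gauss_projection k r (\<lambda>x. a * g x) = smult a (gauss_projection k r g)"
proof -
  have "(\<Sum>x\<in>A. w x * q x * (a * g x)) = a * (\<Sum>x\<in>A. w x * q x * g x)" for w q A
    by (simp add: sum_distrib_left mult.left_commute)
  then show ?thesis by (simp add: gauss_projection_def smult_sum_right)
qed

lemma gauss_projection_diff:
  "gauss_projection k r (\<lambda>x. f x - g x) = gauss_projection k r f - gauss_projection k r g"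
  using gauss_projection_add[of k r f "\<lambda>x. -1 * g x"] gauss_projection_cmult[of k r "-1" g]
  by simp

lemma gauss_projection_sum:
  "gauss_projection k r (\<lambda>x. \<Sum>i\<in>A. g i x) = (\<Sum>i\<in>A. gauss_projection k r (g i))"
proof (induction A rule: infinite_finite_induct)
  case (infinite A)
  then show ?case using gauss_projection_cmult[of k r 0 "\<lambda>x. 0"] by simp
next
  case empty
  then show ?case using gauss_projection_cmult[of k r 0 "\<lambda>x. 0"] by simp
qed (simp add: gauss_projection_add)

lemma degree_gauss_projection: "r \<ge> 1 \<Longrightarrow> degree (gauss_projection k r g) < r"
  unfolding gauss_projection_def
  by (intro degree_sum_less) (auto simp: degree_shifted_legendre intro: le_less_trans[OF degree_smult_le])

text \<open>The coefficients of the projection are quadrature sums against the orthonormal basis, so by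
  expanding \<open>v\<close> in that basis the inner product with \<open>v\<close> becomes a quadrature sum against \<open>v\<close>.\<close>

lemma unit_integral_gauss_projection:
  assumes "degree v < r"
  shows "unit_integral (v * gauss_projection k r g) =
    (\<Sum>x\<in>gauss_nodes k. gauss_weight k x * poly v x * g x)"
proof -
  let ?P = shifted_legendre
  have "unit_integral (v * gauss_projection k r g) =
     (\<Sum>j<r. \<Sum>x\<in>gauss_nodes k. gauss_weight k x * g x * (unit_integral (?P j * v) * poly (?P j) x))"
    unfolding gauss_projection_def sum_distrib_left mult_smult_right unit_integral_sum unit_integral_smult
      sum_distrib_right
    by (intro sum.cong refl) (simp add: mult_ac)
  also have "\<dots> = (\<Sum>x\<in>gauss_nodes k. gauss_weight k x * g x *
      (\<Sum>j<r. unit_integral (?P j * v) * poly (?P j) x))"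
    by (subst sum.swap) (simp add: sum_distrib_left)
  also have "\<dots> = (\<Sum>x\<in>gauss_nodes k. gauss_weight k x * g x * poly v x)"
  proof -
    have "(\<Sum>j<r. unit_integral (?P j * v) * poly (?P j) x) = poly v x" for x
      by (subst (2) legendre_expansion[OF assms]) (simp add: poly_sum)
    then show ?thesis by simp
  qed
  finally show ?thesis by (simp add: mult_ac)
qed

lemma unit_integral_mult_gauss_projection:
  assumes "degree v < r" "degree v + degree p < 2 * k"
  shows "unit_integral (v * gauss_projection k r (poly p)) = unit_integral (v * p)"
proof -
  have "degree (v * p) < 2 * k" using degree_mult_le[of v p] assms(2) by linarith
  from gauss_quadrature_exact[OF this] show ?thesis
    by (simp add: unit_integral_gauss_projection[OF assms(1)] mult.assoc)
qed

lemma gauss_projection_poly: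
  assumes "degree p + r \<le> 2 * k" "k > 0"
  shows "gauss_projection k r (poly p) =
    (\<Sum>j<r. smult (unit_integral (shifted_legendre j * p)) (shifted_legendre j))"
  unfolding gauss_projection_def
proof (intro sum.cong refl arg_cong2[of _ _ _ _ smult])
  fix j assume "j \<in> {..<r}"
  then have "degree (shifted_legendre j * p) < 2 * k"
    using degree_mult_le[of "shifted_legendre j" p] assms by (simp add: degree_shifted_legendre)
  from gauss_quadrature_exact[OF this]
  show "(\<Sum>x\<in>gauss_nodes k. gauss_weight k x * poly (shifted_legendre j) x * poly p x) =
      unit_integral (shifted_legendre j * p)"
    by (simp add: mult.assoc)
qed

lemma gauss_projection_id:
  assumes "degree p < r" "r \<le> k"
  shows "gauss_projection k r (poly p) = p"
  using assms legendre_expansion[OF assms(1)] by (subst gauss_projection_poly) auto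

lemma gauss_projection_legendre:
  assumes "1 \<le> r" "r \<le> k"
  shows "gauss_projection k r (poly (shifted_legendre r)) = 0"
  using assms by (subst gauss_projection_poly) (auto simp: legendre_orthogonal degree_shifted_legendre)

text \<open>The primitive that vanishes at \<open>0\<close>.\<close>

definition poly_primitive :: "real poly \<Rightarrow> real poly" where
  "poly_primitive p = (\<Sum>i\<le>degree p. monom (coeff p i / real (Suc i)) (Suc i))"

lemma coeff_poly_primitive:
  "coeff (poly_primitive p) n = (case n of 0 \<Rightarrow> 0 | Suc i \<Rightarrow> coeff p i / real (Suc i))"
proof (cases n)
  case (Suc i)
  have "(\<Sum>x\<le>degree p. if x = i then coeff p x / (1 + real x) else 0) = coeff p i / (1 + real i)"
    using coeff_eq_0[of p i] by (simp add: not_le)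
  then show ?thesis using Suc by (simp add: poly_primitive_def coeff_sum)
qed (simp add: poly_primitive_def coeff_sum)

lemma pderiv_poly_primitive [simp]: "pderiv (poly_primitive p) = p"
  by (rule poly_eqI) (simp add: coeff_pderiv coeff_poly_primitive del: of_nat_Suc)

lemma poly_poly_primitive_0 [simp]: "poly (poly_primitive p) 0 = 0"
  by (simp add: poly_0_coeff_0 coeff_poly_primitive)

lemma degree_poly_primitive_le: "degree (poly_primitive p) \<le> Suc (degree p)"
  unfolding poly_primitive_def
  by (intro degree_sum_le) (auto intro: order_trans[OF degree_monom_le])

lemma poly_poly_primitive_1: "poly (poly_primitive p) 1 = unit_integral p"
  using unit_integral_pderiv[of "poly_primitive p"] by simp

lemma poly_primitive_unique:
  assumes "pderiv p = q"
  shows "p = [:poly p 0:] + poly_primitive q"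
proof -
  have "pderiv (p - poly_primitive q) = 0" using assms by (simp add: pderiv_diff)
  then obtain a where a: "p - poly_primitive q = [:a:]" by (auto simp: pderiv_eq_0_iff elim: degree_eq_zeroE)
  have "a = poly (p - poly_primitive q) 0" by (simp add: a)
  then show ?thesis using a by (simp add: algebra_simps)
qed

lemma poly_primitive_add: "poly_primitive (p + q) = poly_primitive p + poly_primitive q"
  by (intro poly_eqI) (simp add: coeff_poly_primitive add_divide_distrib split: nat.split)

lemma poly_primitive_smult: "poly_primitive (smult a p) = smult a (poly_primitive p)"
  by (intro poly_eqI) (simp add: coeff_poly_primitive split: nat.split)

lemma poly_primitive_sum: "poly_primitive (sum f A) = (\<Sum>i\<in>A. poly_primitive (f i))"
proof (induction A rule: infinite_finite_induct)
  case (insert x F)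
  then show ?case by (simp add: poly_primitive_add)
qed (auto simp: poly_primitive_def)

section \<open>Discrete solutions in coordinates\<close>

lemma poly_eq_on_unit_interval:
  fixes p q :: "real poly"
  assumes "\<And>c. c \<in> {0..1} \<Longrightarrow> poly p c = poly q c"
  shows "p = q"
proof (rule ccontr)
  assume "p \<noteq> q"
  then have "finite {x. poly (p - q) x = 0}" by (intro poly_roots_finite) simp
  moreover have "{0..1} \<subseteq> {x. poly (p - q) x = 0}" using assms by auto
  moreover have "infinite {0..1::real}" by (simp add: infinite_Icc)
  ultimately show False using finite_subset by blast
qed

lemma poly_curve_poly:
  assumes "degree p \<le> r"
  shows "poly_curve r (\<lambda>t. poly p t *\<^sub>R a)"
  unfolding poly_curve_def
proof (intro exI allI)
  fix t
  have "poly p t = (\<Sum>i\<le>r. coeff p i * t ^ i)"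
    unfolding poly_altdef using assms
    by (intro sum.mono_neutral_left) (auto simp: coeff_eq_0)
  then show "poly p t *\<^sub>R a = (\<Sum>i\<le>r. t ^ i *\<^sub>R (coeff p i *\<^sub>R a))"
    by (simp add: scaleR_sum_left mult.commute)
qed

lemma poly_curve_const: "poly_curve r (\<lambda>t. a)"
  using poly_curve_poly[of "[:1:]" r a] by simp

lemma poly_curve_add:
  assumes "poly_curve r u" "poly_curve r v"
  shows "poly_curve r (\<lambda>t. u t + v t)"
proof -
  from assms obtain a b where "\<And>t. u t = (\<Sum>i\<le>r. t ^ i *\<^sub>R a i)" "\<And>t. v t = (\<Sum>i\<le>r. t ^ i *\<^sub>R b i)"
    unfolding poly_curve_def by blast
  then have "u t + v t = (\<Sum>i\<le>r. t ^ i *\<^sub>R (a i + b i))" for t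
    by (simp add: sum.distrib scaleR_add_right)
  then show ?thesis unfolding poly_curve_def by (intro exI[of _ "\<lambda>i. a i + b i"]) blast
qed

lemma poly_curve_sum:
  "(\<And>j. j \<in> A \<Longrightarrow> poly_curve r (u j)) \<Longrightarrow> poly_curve r (\<lambda>t. \<Sum>j\<in>A. u j t)"
  by (induction A rule: infinite_finite_induct) (auto intro: poly_curve_const poly_curve_add)

lemma poly_curve_linear_image:
  assumes "bounded_linear L" "poly_curve r u"
  shows "poly_curve r (\<lambda>t. L (u t))"
proof -
  interpret bounded_linear L by fact
  from assms obtain a where "\<And>t. u t = (\<Sum>i\<le>r. t ^ i *\<^sub>R a i)" unfolding poly_curve_def by blast
  then have "L (u t) = (\<Sum>i\<le>r. t ^ i *\<^sub>R L (a i))" for t by (simp add: sum scaleR)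
  then show ?thesis unfolding poly_curve_def by (intro exI[of _ "\<lambda>i. L (a i)"]) blast
qed

lemma poly_curve_coordinate:
  fixes u :: "real \<Rightarrow> 'a::euclidean_space"
  assumes "poly_curve r u"
  shows "\<exists>p. degree p \<le> r \<and> (\<forall>c. u (t0 + c * h) \<bullet> b = poly p c)"
proof -
  from assms obtain a where a: "\<And>t. u t = (\<Sum>i\<le>r. t ^ i *\<^sub>R a i)" unfolding poly_curve_def by blast
  define p where "p = (\<Sum>i\<le>r. smult (a i \<bullet> b) ([:t0, h:] ^ i))"
  have "degree ([:t0, h:] ^ i) \<le> i" for i
    using degree_power_le[of "[:t0, h:]" i] by (cases "h = 0") auto
  then have "degree p \<le> r"
    unfolding p_def by (intro degree_sum_le) (auto intro!: order_trans[OF degree_smult_le] intro: order_trans)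
  moreover have "u (t0 + c * h) \<bullet> b = poly p c" for c
    by (simp add: a p_def inner_sum_left poly_sum poly_power mult_ac)
  ultimately show ?thesis by blast
qed

lemma poly_curve_affine:
  fixes u :: "real \<Rightarrow> 'a::euclidean_space"
  assumes "poly_curve r u"
  shows "poly_curve r (\<lambda>c. u (t0 + c * h))"
proof -
  from poly_curve_coordinate[OF assms, of t0 h] obtain p
    where p: "\<And>b. degree (p b) \<le> r" "\<And>b c. u (t0 + c * h) \<bullet> b = poly (p b) c" by metis
  have "u (t0 + c * h) = (\<Sum>b\<in>Basis. poly (p b) c *\<^sub>R b)" for c
    unfolding p(2)[symmetric] by (rule euclidean_representation[symmetric])
  then have "(\<lambda>c. u (t0 + c * h)) = (\<lambda>c. \<Sum>b\<in>Basis. poly (p b) c *\<^sub>R b)" by auto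
  then show ?thesis using p(1) by (auto intro!: poly_curve_sum poly_curve_poly)
qed

text \<open>The right-hand side of the method, with the composition of field and solution abstracted to
  an arbitrary function \<open>g\<close>, in which it is linear.\<close>

definition hbvm_field :: "nat \<Rightarrow> nat \<Rightarrow> (real \<Rightarrow> 'a::real_vector) \<Rightarrow> real \<Rightarrow> 'a" where
  "hbvm_field k r g c = (\<Sum>j<r. poly (shifted_legendre j) c *\<^sub>R
     (\<Sum>x\<in>gauss_nodes k. (gauss_weight k x * poly (shifted_legendre j) x) *\<^sub>R g x))"

lemma hbvm_field_inner:
  "hbvm_field k r g c \<bullet> b = poly (gauss_projection k r (\<lambda>x. g x \<bullet> b)) c"
  by (simp add: hbvm_field_def gauss_projection_def inner_sum_left poly_sum sum_distrib_left
      sum_distrib_right mult_ac)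

lemma hbvm_field_linear_image:
  assumes "bounded_linear L"
  shows "hbvm_field k r (\<lambda>x. L (g x)) c = L (hbvm_field k r g c)"
proof -
  interpret bounded_linear L by fact
  show ?thesis by (simp add: hbvm_field_def sum scaleR)
qed

lemma hbvm_field_add:
  "hbvm_field k r (\<lambda>x. f x + g x) c = hbvm_field k r f c + hbvm_field k r g c"
  by (simp add: hbvm_field_def sum.distrib scaleR_add_right)

lemma hbvm_field_sum:
  "hbvm_field k r (\<lambda>x. \<Sum>i\<in>A. g i x) c = (\<Sum>i\<in>A. hbvm_field k r (g i) c)"
  by (induction A rule: infinite_finite_induct) (auto simp: hbvm_field_add hbvm_field_def[of _ _ "\<lambda>x. 0"])

lemma hbvm_field_poly:
  "hbvm_field k r (\<lambda>x. poly p x *\<^sub>R a) c = poly (gauss_projection k r (poly p)) c *\<^sub>R a"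
  by (simp add: hbvm_field_def gauss_projection_def poly_sum scaleR_sum_left scaleR_sum_right
      sum_distrib_left sum_distrib_right mult_ac)

lemma hbvm_solution_iff:
  "hbvm_solution k r f t0 y0 h u \<longleftrightarrow> poly_curve r u \<and> u t0 = y0 \<and>
     (\<forall>c\<in>{0..1}. (u has_vector_derivative hbvm_field k r (\<lambda>x. f (u (t0 + x * h))) c)
        (at (t0 + c * h)))"
  by (simp add: hbvm_solution_def hbvm_field_def)

text \<open>The method prescribes the derivative on \<open>[0,1]\<close> only; both sides being polynomials, the
  equation becomes an identity of real polynomials, in each coordinate.\<close>

lemma hbvm_solution_coordinate:
  fixes f :: "'a::euclidean_space \<Rightarrow> 'a"
  assumes "hbvm_solution k r f t0 y0 h u"
  shows "\<exists>p. degree p \<le> r \<and> (\<forall>c. u (t0 + c * h) \<bullet> b = poly p c) \<and> poly p 0 = y0 \<bullet> b \<and>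
     pderiv p = smult h (gauss_projection k r (\<lambda>x. f (u (t0 + x * h)) \<bullet> b))"
proof -
  note sol = assms[unfolded hbvm_solution_iff]
  obtain p where p: "degree p \<le> r" "\<And>c. u (t0 + c * h) \<bullet> b = poly p c"
    using poly_curve_coordinate sol by blast
  let ?Q = "gauss_projection k r (\<lambda>x. f (u (t0 + x * h)) \<bullet> b)"
  have "poly (pderiv p) c = poly (smult h ?Q) c" if c: "c \<in> {0..1}" for c
  proof -
    let ?D = "hbvm_field k r (\<lambda>x. f (u (t0 + x * h))) c"
    have "((\<lambda>s. t0 + s * h) has_vector_derivative h) (at c)"
      by (auto intro!: derivative_eq_intros simp flip: has_real_derivative_iff_has_vector_derivative)
    from vector_diff_chain_at[OF this, of u ?D]
    have "(u \<circ> (\<lambda>s. t0 + s * h) has_vector_derivative h *\<^sub>R ?D) (at c)" using sol c by blast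
    then have "((\<lambda>s. u (t0 + s * h) \<bullet> b) has_vector_derivative (h *\<^sub>R ?D) \<bullet> b) (at c)"
      using bounded_linear.has_vector_derivative[OF bounded_linear_inner_left] by (force simp: o_def)
    then have "(poly p has_real_derivative h * poly ?Q c) (at c)"
      by (simp add: p(2) hbvm_field_inner flip: has_real_derivative_iff_has_vector_derivative)
    from DERIV_unique[OF this poly_DERIV] show ?thesis by simp
  qed
  then have "pderiv p = smult h ?Q" by (rule poly_eq_on_unit_interval)
  moreover have "poly p 0 = y0 \<bullet> b" using p(2)[of 0] sol by simp
  ultimately show ?thesis using p by blast
qed

section \<open>Perfect A-stability\<close>

lemma hbvm_solution_linear_diff:
  fixes \<mu> :: complex
  assumes "hbvm_solution k r (\<lambda>y. \<mu> * y) t0 y0 h u" "hbvm_solution k r (\<lambda>y. \<mu> * y) t0 y1 h v"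
  shows "hbvm_solution k r (\<lambda>y. \<mu> * y) t0 (y0 - y1) h (\<lambda>t. u t - v t)"
  unfolding hbvm_solution_iff
proof (intro conjI ballI)
  note s = assms[unfolded hbvm_solution_iff]
  have m: "bounded_linear (\<lambda>x::complex. - x)" by (rule bounded_linear_minus[OF bounded_linear_ident])
  show "poly_curve r (\<lambda>t. u t - v t)"
    using poly_curve_add[of r u "\<lambda>t. - v t"] poly_curve_linear_image[OF m, of r v] s by simp
  show "u t0 - v t0 = y0 - y1" using s by simp
  fix c :: real assume c: "c \<in> {0..1}"
  have "hbvm_field k r (\<lambda>x. \<mu> * (u (t0 + x * h) - v (t0 + x * h))) c =
     hbvm_field k r (\<lambda>x. \<mu> * u (t0 + x * h) + - (\<mu> * v (t0 + x * h))) c" by (simp add: algebra_simps)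
  also have "\<dots> = hbvm_field k r (\<lambda>x. \<mu> * u (t0 + x * h)) c - hbvm_field k r (\<lambda>x. \<mu> * v (t0 + x * h)) c"
    by (simp only: hbvm_field_add hbvm_field_linear_image[OF m]) simp
  finally show "((\<lambda>t. u t - v t) has_vector_derivative
      hbvm_field k r (\<lambda>x. \<mu> * (u (t0 + x * h) - v (t0 + x * h))) c) (at (t0 + c * h))"
    using s c has_vector_derivative_diff by fastforce
qed

text \<open>All test problems with the same \<open>z = h \<mu>\<close> are reparametrisations of a single one.\<close>

lemma hbvm_solution_linear_rescale:
  fixes z :: complex
  assumes "hbvm_solution k r (\<lambda>y. z * y) 0 w 1 U" "h > 0" "of_real h * \<mu> = z" "a * w = y0"
  shows "hbvm_solution k r (\<lambda>y. \<mu> * y) t0 y0 h (\<lambda>t. a * U ((t - t0) / h))"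
  unfolding hbvm_solution_iff
proof (intro conjI ballI)
  note s = assms(1)[unfolded hbvm_solution_iff]
  have "poly_curve r (\<lambda>t. U (- t0 / h + t * (1 / h)))" by (rule poly_curve_affine) (use s in blast)
  then have "poly_curve r (\<lambda>t. U ((t - t0) / h))" by (simp add: diff_divide_distrib)
  then show "poly_curve r (\<lambda>t. a * U ((t - t0) / h))"
    by (intro poly_curve_linear_image[OF bounded_linear_mult_right])
  show "a * U ((t0 - t0) / h) = y0" using s assms(4) by simp
  fix c :: real assume c: "c \<in> {0..1}"
  let ?D = "hbvm_field k r (\<lambda>x. z * U x) c"
  have "(U has_vector_derivative ?D) (at c)" using s c by simp
  then have U: "(U has_vector_derivative ?D) (at ((t0 + c * h - t0) / h))" using assms(2) by simp
  have "((\<lambda>t. (t - t0) / h) has_vector_derivative 1 / h) (at (t0 + c * h))"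
    using assms(2)
    by (auto intro!: derivative_eq_intros simp flip: has_real_derivative_iff_has_vector_derivative)
  from vector_diff_chain_at[OF this U]
  have "((\<lambda>t. U ((t - t0) / h)) has_vector_derivative (1 / h) *\<^sub>R ?D) (at (t0 + c * h))"
    by (simp add: o_def)
  then have d: "((\<lambda>t. a * U ((t - t0) / h)) has_vector_derivative a * ((1 / h) *\<^sub>R ?D)) (at (t0 + c * h))"
    by (rule bounded_linear.has_vector_derivative[OF bounded_linear_mult_right])
  have "hbvm_field k r (\<lambda>x. \<mu> * (a * U ((t0 + x * h - t0) / h))) c =
      hbvm_field k r (\<lambda>x. (a / of_real h) * (z * U x)) c"
    using assms(2,3) by (auto simp: field_simps)
  also have "\<dots> = (a / of_real h) * ?D"
    by (rule hbvm_field_linear_image[OF bounded_linear_mult_right])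
  also have "\<dots> = a * ((1 / h) *\<^sub>R ?D)" by (simp add: scaleR_conv_of_real field_simps)
  finally show "((\<lambda>t. a * U ((t - t0) / h)) has_vector_derivative
      hbvm_field k r (\<lambda>x. \<mu> * (a * U ((t0 + x * h - t0) / h))) c) (at (t0 + c * h))"
    using d by simp
qed

text \<open>Testing the discrete equation with the projection of the solution: since the derivative has
  degree below \<open>r\<close>, it does not see the difference between the solution and its projection, and the
  two cross terms cancel.\<close>

lemma energy_identity:
  assumes r: "1 \<le> r" "r \<le> k" and deg: "degree X \<le> r" "degree Y \<le> r"
    and X: "pderiv X = smult a (gauss_projection k r (poly X)) - smult b (gauss_projection k r (poly Y))"
    and Y: "pderiv Y = smult a (gauss_projection k r (poly Y)) + smult b (gauss_projection k r (poly X))"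
  shows "(poly X 1)\<^sup>2 + (poly Y 1)\<^sup>2 - ((poly X 0)\<^sup>2 + (poly Y 0)\<^sup>2) =
    2 * a * (unit_integral (gauss_projection k r (poly X) * gauss_projection k r (poly X)) +
             unit_integral (gauss_projection k r (poly Y) * gauss_projection k r (poly Y)))"
proof -
  let ?X = "gauss_projection k r (poly X)" and ?Y = "gauss_projection k r (poly Y)"
  have t: "unit_integral (pderiv Z * Z) = unit_integral (pderiv Z * gauss_projection k r (poly Z))"
    if "degree Z \<le> r" for Z
    using that r by (intro unit_integral_mult_gauss_projection[symmetric]) (auto simp: degree_pderiv)
  have sq: "(poly Z 1)\<^sup>2 - (poly Z 0)\<^sup>2 = 2 * unit_integral (pderiv Z * Z)" for Z
  proof -
    have "pderiv (Z * Z) = pderiv Z * Z + pderiv Z * Z" by (simp add: pderiv_mult mult.commute)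
    then show ?thesis
      using unit_integral_pderiv[of "Z * Z"] by (simp only: unit_integral_add) (simp add: power2_eq_square)
  qed
  have "unit_integral (pderiv X * ?X) = a * unit_integral (?X * ?X) - b * unit_integral (?Y * ?X)"
    by (subst X) (simp add: algebra_simps unit_integral_diff unit_integral_smult)
  moreover have "unit_integral (pderiv Y * ?Y) = a * unit_integral (?Y * ?Y) + b * unit_integral (?Y * ?X)"
    by (subst Y) (simp add: algebra_simps unit_integral_add unit_integral_smult)
  ultimately show ?thesis using sq[of X] sq[of Y] t[OF deg(1)] t[OF deg(2)] by (simp add: algebra_simps)
qed

text \<open>\<open>N\<close> is the squared \<open>L\<^sup>2\<close> norm of the projected solution.  If it vanishes, so does the
  derivative, and a constant is its own projection.\<close>

lemma hbvm_linear_growth: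
  fixes \<mu> :: complex
  assumes r: "1 \<le> r" "r \<le> k" and h: "h > 0" and sol: "hbvm_solution k r (\<lambda>y. \<mu> * y) t0 y0 h u"
  shows "\<exists>N\<ge>0. (norm (u (t0 + h)))\<^sup>2 - (norm y0)\<^sup>2 = 2 * (h * Re \<mu>) * N \<and> (N = 0 \<longrightarrow> (\<forall>t. u t = 0))"
proof -
  define a b where "a = h * Re \<mu>" and "b = h * Im \<mu>"
  obtain X where X: "degree X \<le> r" "\<And>c. Re (u (t0 + c * h)) = poly X c" "poly X 0 = Re y0"
    "pderiv X = smult h (gauss_projection k r (\<lambda>x. Re (\<mu> * u (t0 + x * h))))"
    using hbvm_solution_coordinate[OF sol, of 1] by (auto simp: complex_inner_1_right)
  obtain Y where Y: "degree Y \<le> r" "\<And>c. Im (u (t0 + c * h)) = poly Y c" "poly Y 0 = Im y0"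
    "pderiv Y = smult h (gauss_projection k r (\<lambda>x. Im (\<mu> * u (t0 + x * h))))"
    using hbvm_solution_coordinate[OF sol, of "\<i>"] by (auto simp: complex_inner_i_right)
  let ?X = "gauss_projection k r (poly X)" and ?Y = "gauss_projection k r (poly Y)"
  have X': "pderiv X = smult a ?X - smult b ?Y"
    unfolding X(4) a_def b_def
    by (simp add: X(2) Y(2) gauss_projection_diff gauss_projection_cmult smult_diff_right)
  have Y': "pderiv Y = smult a ?Y + smult b ?X"
    unfolding Y(4) a_def b_def
    by (simp add: X(2) Y(2) gauss_projection_add gauss_projection_cmult smult_add_right)
  define N where "N = unit_integral (?X * ?X) + unit_integral (?Y * ?Y)"
  have nn: "unit_integral (?X * ?X) \<ge> 0" "unit_integral (?Y * ?Y) \<ge> 0"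
    by (auto intro!: unit_integral_nonneg)
  have "(norm (u (t0 + h)))\<^sup>2 - (norm y0)\<^sup>2 = 2 * a * N"
    using energy_identity[OF r X(1) Y(1) X' Y'] X(2)[of 1] Y(2)[of 1] X(3) Y(3)
    by (simp add: cmod_power2 N_def)
  moreover have "u t = 0" if "N = 0" for t
  proof -
    have z: "?X = 0" "?Y = 0" 
      using that nn unfolding N_def
      by (intro unit_integral_square_eq_0, linarith)+
    then have d: "degree X = 0" "degree Y = 0" using X' Y' by (simp_all add: pderiv_eq_0_iff)
    then have "X = 0" "Y = 0" 
      using z gauss_projection_id[of X r k] gauss_projection_id[of Y r k] r by simp_all
    then have "u (t0 + (t - t0) / h * h) = 0" by (intro complex_eqI) (simp_all only: X(2) Y(2), simp_all)
    then show ?thesis using h by simp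
  qed
  moreover have "N \<ge> 0" using nn by (simp add: N_def)
  ultimately show ?thesis unfolding a_def by blast
qed

text \<open>A polynomial of degree \<open>r\<close> differs from its projection by a multiple of the Legendre
  polynomial \<open>P\<^sub>r\<close>.  Scaled so that the multiple is \<open>1\<close>, the test equation is \<open>W' = z (W - P\<^sub>r)\<close>,
  solved by the finite Neumann series of \<open>P\<^sub>r\<close> in \<open>(1 / z) d/dc\<close>.\<close>

lemma hbvm_linear_explicit:
  fixes z :: complex
  assumes r: "1 \<le> r" "r \<le> k" and z: "z \<noteq> 0"
  shows "\<exists>W. hbvm_solution k r (\<lambda>y. z * y) 0 (W 0) 1 W \<and> (\<exists>t. W t \<noteq> 0)"
proof -
  define D where "D i = (pderiv ^^ i) (shifted_legendre r)" for i
  have degD: "degree (D i) = r - i" for i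
    by (simp add: D_def degree_higher_pderiv degree_shifted_legendre)
  have D': "pderiv (D i) = D (Suc i)" for i by (simp add: D_def)
  have D_last: "D (Suc r) = 0" using degD[of r] by (simp flip: D' add: pderiv_eq_0_iff)
  define W where "W c = (\<Sum>i\<le>r. poly (D i) c *\<^sub>R (1 / z) ^ i)" for c
  have shift: "(\<Sum>i\<le>r. poly (D (Suc i)) c *\<^sub>R (1 / z) ^ i) = z * W c - z * of_real (poly (D 0) c)" for c
  proof -
    have "z * W c = (\<Sum>i\<le>Suc r. z * (poly (D i) c *\<^sub>R (1 / z) ^ i))"
      by (simp add: W_def sum_distrib_left D_last)
    also have "\<dots> = z * of_real (poly (D 0) c) + (\<Sum>i\<le>r. z * (poly (D (Suc i)) c *\<^sub>R (1 / z) ^ Suc i))"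
      by (subst sum.atMost_Suc_shift) (simp add: scaleR_conv_of_real)
    also have "(\<Sum>i\<le>r. z * (poly (D (Suc i)) c *\<^sub>R (1 / z) ^ Suc i)) =
       (\<Sum>i\<le>r. poly (D (Suc i)) c *\<^sub>R (1 / z) ^ i)"
      using z by (intro sum.cong) (auto simp: scaleR_conv_of_real)
    finally show ?thesis by simp
  qed
  have der: "(W has_vector_derivative (z * W c - z * of_real (poly (D 0) c))) (at c)" for c
  proof -
    have "((\<lambda>c. poly (D i) c *\<^sub>R (1 / z) ^ i) has_vector_derivative
        poly (D (Suc i)) c *\<^sub>R (1 / z) ^ i) (at c)" for i
      using poly_DERIV[of "D i" c] unfolding D' has_real_derivative_iff_has_vector_derivative
      by (rule bounded_linear.has_vector_derivative[OF bounded_linear_scaleR_left])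
    then have "(W has_vector_derivative (\<Sum>i\<le>r. poly (D (Suc i)) c *\<^sub>R (1 / z) ^ i)) (at c)"
      unfolding W_def by (intro has_vector_derivative_sum)
    then show ?thesis by (simp only: shift)
  qed
  have Q: "gauss_projection k r (poly (D i)) = (if i = 0 then 0 else D i)" for i
    using r gauss_projection_legendre[OF r] gauss_projection_id[of "D i" r k]
    by (cases "i = 0") (simp_all add: degD, simp add: D_def)
  have "hbvm_field k r (\<lambda>x. z * W x) c = z * W c - z * of_real (poly (D 0) c)" for c
  proof -
    have "hbvm_field k r (\<lambda>x. z * W x) c = z * hbvm_field k r W c"
      by (rule hbvm_field_linear_image[OF bounded_linear_mult_right])
    also have "hbvm_field k r W c = (\<Sum>i\<le>r. poly (if i = 0 then 0 else D i) c *\<^sub>R (1 / z) ^ i)"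
      unfolding W_def by (simp only: hbvm_field_sum hbvm_field_poly Q)
    also have "\<dots> = W c - of_real (poly (D 0) c)"
      unfolding W_def by (subst (1 2) sum.atMost_shift) (simp add: scaleR_conv_of_real)
    finally show ?thesis by (simp add: algebra_simps)
  qed
  moreover have "poly_curve r W"
    unfolding W_def by (intro poly_curve_sum poly_curve_poly) (simp add: degD)
  ultimately have sol: "hbvm_solution k r (\<lambda>y. z * y) 0 (W 0) 1 W"
    unfolding hbvm_solution_iff using der by simp
  have "\<exists>t. W t \<noteq> 0"
  proof (rule ccontr)
    assume "\<not> (\<exists>t. W t \<noteq> 0)"
    then have W0: "W = (\<lambda>t. 0)" by auto
    have "z * of_real (poly (D 0) c) = 0" for c
      using vector_derivative_unique_at[OF der[of c, unfolded W0] has_vector_derivative_const] by simp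
    then have "poly (shifted_legendre r) c = 0" for c using z by (simp add: D_def)
    then have "shifted_legendre r = 0" using poly_all_0_iff_0 by blast
    then show False using shifted_legendre_nonzero by simp
  qed
  with sol show ?thesis by blast
qed

text \<open>Two solutions differ by one with initial value \<open>0\<close>, which cannot grow and hence is zero.
  Therefore the explicit solution has a nonzero initial value and can be scaled to any other.\<close>

lemma hbvm_determined_left_half_plane:
  fixes z :: complex
  assumes r: "1 \<le> r" "r \<le> k" and z: "Re z < 0"
  shows "hbvm_determined k r z"
  unfolding hbvm_determined_def
proof (intro allI impI)
  fix h t0 :: real and \<mu> y0 :: complex
  assume h: "h > 0" and hm: "of_real h * \<mu> = z"
  have re: "h * Re \<mu> < 0" using z hm by auto
  have trivial: "u t = 0" if sol: "hbvm_solution k r (\<lambda>y. \<mu> * y) t0 0 h u" for u t t0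
  proof -
    obtain N where N: "N \<ge> 0" "(norm (u (t0 + h)))\<^sup>2 = 2 * (h * Re \<mu>) * N" "N = 0 \<longrightarrow> (\<forall>t. u t = 0)"
      using hbvm_linear_growth[OF r h sol] by auto
    have "2 * (h * Re \<mu>) * N \<ge> 0" unfolding N(2)[symmetric] by simp
    then have "N = 0" using mult_neg_pos[OF re, of N] N(1) by (cases "N = 0") (auto simp: mult.commute)
    then show ?thesis using N(3) by simp
  qed
  obtain W t1 where W: "hbvm_solution k r (\<lambda>y. z * y) 0 (W 0) 1 W" "W t1 \<noteq> 0"
  proof -
    have "z \<noteq> 0" using z by auto
    from hbvm_linear_explicit[OF r this] show thesis using that by blast
  qed
  have W0: "W 0 \<noteq> 0"
  proof
    assume "W 0 = 0"
    then have "hbvm_solution k r (\<lambda>y. \<mu> * y) t0 0 h (\<lambda>t. 1 * W ((t - t0) / h))"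
      using hbvm_solution_linear_rescale[OF W(1) h hm, of 1 0 t0] by simp
    from trivial[OF this, of "t0 + t1 * h"] show False using W(2) h by simp
  qed
  show "\<exists>!u. hbvm_solution k r (\<lambda>y. \<mu> * y) t0 y0 h u"
  proof (rule ex_ex1I)
    show "\<exists>u. hbvm_solution k r (\<lambda>y. \<mu> * y) t0 y0 h u"
      using hbvm_solution_linear_rescale[OF W(1) h hm, of "y0 / W 0" y0 t0] W0 by auto
  next
    fix u v
    assume "hbvm_solution k r (\<lambda>y. \<mu> * y) t0 y0 h u" "hbvm_solution k r (\<lambda>y. \<mu> * y) t0 y0 h v"
    from hbvm_solution_linear_diff[OF this] have "u t - v t = 0" for t
      using trivial[of t0 "\<lambda>t. u t - v t" t] by simp
    then show "u = v" by (simp add: fun_eq_iff)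
  qed
qed

theorem hbvm_perfectly_A_stable:
  assumes r: "1 \<le> r" "r \<le> k"
  shows "hbvm_perfectly_A_stable k r"
proof -
  define S where "S z = (THE u. hbvm_solution k r (\<lambda>y. z * y) 0 1 1 u)" for z :: complex
  define R where "R z = S z 1" for z
  have S: "hbvm_solution k r (\<lambda>y. z * y) 0 1 1 (S z)" if "hbvm_determined k r z" for z
  proof -
    have "\<exists>!u. hbvm_solution k r (\<lambda>y. z * y) 0 1 1 u"
      using that[unfolded hbvm_determined_def, rule_format, of 1 z 0 1] by simp
    then show ?thesis unfolding S_def by (rule theI')
  qed
  have growth: "\<exists>N\<ge>0. (norm (R z))\<^sup>2 - 1 = 2 * Re z * N \<and> N \<noteq> 0" if det: "hbvm_determined k r z" for z
  proof -
    obtain N where N: "N \<ge> 0" "(norm (S z (0 + 1)))\<^sup>2 - (norm (1::complex))\<^sup>2 = 2 * (1 * Re z) * N"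
      "N = 0 \<longrightarrow> (\<forall>t. S z t = 0)"
      using hbvm_linear_growth[OF r zero_less_one S[OF det]] by blast
    have "S z 0 = 1" using S[OF det] unfolding hbvm_solution_iff by blast
    then have "N \<noteq> 0" using N(3) by auto
    with N show ?thesis unfolding R_def by auto
  qed
  have "hbvm_stability_function k r R"
    unfolding hbvm_stability_function_def
  proof (intro allI impI)
    fix h t0 :: real and \<mu> y0 :: complex and u
    assume h: "h > 0" and det: "hbvm_determined k r (of_real h * \<mu>)"
      and u: "hbvm_solution k r (\<lambda>y. \<mu> * y) t0 y0 h u"
    let ?v = "\<lambda>t. y0 * S (of_real h * \<mu>) ((t - t0) / h)"
    have v: "hbvm_solution k r (\<lambda>y. \<mu> * y) t0 y0 h ?v"
      by (rule hbvm_solution_linear_rescale[OF S[OF det] h]) auto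
    have "\<exists>!u. hbvm_solution k r (\<lambda>y. \<mu> * y) t0 y0 h u"
      using det h unfolding hbvm_determined_def by blast
    then have "u = ?v" using u v by blast
    then show "u (t0 + h) = R (of_real h * \<mu>) * y0" using h by (simp add: R_def)
  qed
  moreover have "hbvm_determined k r z \<and> norm (R z) < 1 \<longleftrightarrow> Re z < 0" for z
  proof
    assume a: "hbvm_determined k r z \<and> norm (R z) < 1"
    then obtain N where N: "N \<ge> 0" "(norm (R z))\<^sup>2 - 1 = 2 * Re z * N" using growth by blast
    have "(norm (R z))\<^sup>2 < 1" using a by (simp add: power_less_one_iff)
    then have "Re z * N < 0" using N(2) by linarith
    then show "Re z < 0" using N(1) by (simp add: mult_less_0_iff)
  next
    assume z: "Re z < 0"
    then have det: "hbvm_determined k r z" by (rule hbvm_determined_left_half_plane[OF r])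
    then obtain N where N: "N \<ge> 0" "N \<noteq> 0" "(norm (R z))\<^sup>2 - 1 = 2 * Re z * N" using growth by blast
    have "Re z * N < 0" using z N by (simp add: mult_less_0_iff)
    then have "(norm (R z))\<^sup>2 < 1\<^sup>2" using N(3) by simp
    then have "norm (R z) < 1" by (rule power_less_imp_less_base) simp
    with det show "hbvm_determined k r z \<and> norm (R z) < 1" by blast
  qed
  ultimately show ?thesis unfolding hbvm_perfectly_A_stable_def by blast
qed

section \<open>Energy conservation for polynomial Hamiltonians\<close>

lemma GDERIV_unique:
  assumes "GDERIV f x :> D" "GDERIV f x :> D'"
  shows "D = D'"
proof -
  have "(\<lambda>h. h \<bullet> D) = (\<lambda>h. h \<bullet> D')" using assms unfolding gderiv_def by (rule has_derivative_unique)
  then have "h \<bullet> D = h \<bullet> D'" for h by (rule fun_cong)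
  then show ?thesis by (metis vector_eq_ldot)
qed

lemma gradient_eqI: "GDERIV f x :> D \<Longrightarrow> gradient f x = D"
  unfolding gradient_def using GDERIV_unique by blast

text \<open>The partial derivative of a monomial without its numerical factor \<open>\<alpha> j\<close>; where the exponent
  \<open>\<alpha> j - 1\<close> is truncated, that factor is zero.  The type is general because the entries \<open>x i\<close> are
  real numbers as well as polynomials.\<close>

definition monomial_partial :: "('n::finite \<Rightarrow> nat) \<Rightarrow> 'n \<Rightarrow> ('n \<Rightarrow> 'a::comm_semiring_1) \<Rightarrow> 'a" where
  "monomial_partial \<alpha> j x = x j ^ (\<alpha> j - 1) * (\<Prod>i\<in>UNIV - {j}. x i ^ \<alpha> i)"

lemma gradient_poly_fun:
  fixes C :: "('n::finite \<Rightarrow> nat) \<Rightarrow> real"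
  assumes H: "\<And>y. H y = (\<Sum>\<alpha>\<in>S. C \<alpha> * (\<Prod>i\<in>UNIV. (y $ i) ^ \<alpha> i))"
  shows "gradient H y = (\<chi> j. \<Sum>\<alpha>\<in>S. C \<alpha> * real (\<alpha> j) * monomial_partial \<alpha> j (\<lambda>i. y $ i))"
proof (rule gradient_eqI)
  have "((\<lambda>y. \<Sum>\<alpha>\<in>S. C \<alpha> * (\<Prod>i\<in>UNIV. (y $ i) ^ \<alpha> i)) has_derivative
    (\<lambda>v. \<Sum>\<alpha>\<in>S. C \<alpha> * (\<Sum>j\<in>UNIV. of_nat (\<alpha> j) * v $ j * (y $ j) ^ (\<alpha> j - 1) *
        (\<Prod>i\<in>UNIV - {j}. (y $ i) ^ \<alpha> i)))) (at y)"
    by (intro has_derivative_sum has_derivative_mult_right has_derivative_prod has_derivative_power)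
       (rule bounded_linear_imp_has_derivative[OF bounded_linear_vec_nth])
  moreover have "(\<Sum>\<alpha>\<in>S. C \<alpha> * (\<Sum>j\<in>UNIV. of_nat (\<alpha> j) * v $ j * (y $ j) ^ (\<alpha> j - 1) *
        (\<Prod>i\<in>UNIV - {j}. (y $ i) ^ \<alpha> i))) =
      v \<bullet> (\<chi> j. \<Sum>\<alpha>\<in>S. C \<alpha> * real (\<alpha> j) * monomial_partial \<alpha> j (\<lambda>i. y $ i))" for v :: "real^'n"
  proof -
    have "v \<bullet> (\<chi> j. \<Sum>\<alpha>\<in>S. C \<alpha> * real (\<alpha> j) * monomial_partial \<alpha> j (\<lambda>i. y $ i)) =
        (\<Sum>j\<in>UNIV. \<Sum>\<alpha>\<in>S. v $ j * (C \<alpha> * real (\<alpha> j) * monomial_partial \<alpha> j (\<lambda>i. y $ i)))"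
      by (simp add: inner_vec_def sum_distrib_left)
    also have "\<dots> = (\<Sum>\<alpha>\<in>S. \<Sum>j\<in>UNIV. v $ j * (C \<alpha> * real (\<alpha> j) * monomial_partial \<alpha> j (\<lambda>i. y $ i)))"
      by (rule sum.swap)
    finally show ?thesis by (simp add: sum_distrib_left monomial_partial_def mult_ac)
  qed
  ultimately show "GDERIV H y :> (\<chi> j. \<Sum>\<alpha>\<in>S. C \<alpha> * real (\<alpha> j) * monomial_partial \<alpha> j (\<lambda>i. y $ i))"
    unfolding gderiv_def H[abs_def] by simp
qed

lemma pderiv_sum: "pderiv (sum f A) = (\<Sum>i\<in>A. pderiv (f i))"
  using higher_pderiv_sum[of 1 f A] by simp

lemma poly_monomial_partial:
  "poly (monomial_partial \<alpha> j p) c = monomial_partial \<alpha> j (\<lambda>i. poly (p i) c)"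
  by (simp add: monomial_partial_def poly_prod)

lemma pderiv_monomial:
  fixes p :: "'n::finite \<Rightarrow> real poly"
  shows "pderiv (\<Prod>i\<in>UNIV. p i ^ \<alpha> i) =
    (\<Sum>j\<in>UNIV. smult (real (\<alpha> j)) (monomial_partial \<alpha> j p) * pderiv (p j))"
  by (simp add: pderiv_prod pderiv_power monomial_partial_def mult_ac)

lemma degree_monomial_partial:
  fixes p :: "'n::finite \<Rightarrow> real poly"
  assumes deg: "\<And>i. degree (p i) \<le> r" and "\<alpha> j > 0" "sum \<alpha> UNIV \<le> d"
  shows "degree (monomial_partial \<alpha> j p) \<le> r * (d - 1)"
proof -
  have pw: "degree (p i ^ n) \<le> r * n" for i n
    using order_trans[OF degree_power_le mult_le_mono1[OF deg]] .
  have "degree (monomial_partial \<alpha> j p) \<le>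
     degree (p j ^ (\<alpha> j - 1)) + degree (\<Prod>i\<in>UNIV - {j}. p i ^ \<alpha> i)"
    unfolding monomial_partial_def by (rule degree_mult_le)
  also have "degree (\<Prod>i\<in>UNIV - {j}. p i ^ \<alpha> i) \<le> (\<Sum>i\<in>UNIV - {j}. degree (p i ^ \<alpha> i))"
    using degree_prod_sum_le[of "UNIV - {j}" "\<lambda>i. p i ^ \<alpha> i"] by (simp add: o_def)
  also have "\<dots> \<le> (\<Sum>i\<in>UNIV - {j}. r * \<alpha> i)" by (intro sum_mono pw)
  also have "degree (p j ^ (\<alpha> j - 1)) \<le> r * (\<alpha> j - 1)" by (rule pw)
  finally have "degree (monomial_partial \<alpha> j p) \<le> r * (\<alpha> j - 1 + sum \<alpha> (UNIV - {j}))"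
    by (simp add: sum_distrib_left algebra_simps)
  also have "\<alpha> j - 1 + sum \<alpha> (UNIV - {j}) = sum \<alpha> UNIV - 1"
    using assms(2) sum.remove[of UNIV j \<alpha>] by simp
  also have "r * (sum \<alpha> UNIV - 1) \<le> r * (d - 1)" by (intro mult_le_mono2 diff_le_mono assms(3))
  finally show ?thesis .
qed

lemma symplectic_J_skew: "symplectic_J $ i $ j = - symplectic_J $ j $ i"
  by (auto simp: symplectic_J_def split: sum.splits)

text \<open>The increment of \<open>H\<close> is a sum over \<open>i, j\<close> of \<open>J\<^sub>j\<^sub>i\<close> times the symmetric matrix of inner
  products of the projected gradient components; quadrature is exact on all products involved.\<close>

theorem hbvm_energy_conservation:
  fixes H :: "real^('m::finite + 'm) \<Rightarrow> real"
  assumes r: "1 \<le> r" "r \<le> k" and H: "poly_fun_of_degree_le \<nu> H" and \<nu>: "real \<nu> \<le> 2 * real k / real r"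
    and sol: "hbvm_solution k r (hamiltonian_field H) t0 y0 h u"
  shows "H (u (t0 + h)) = H y0"
proof -
  obtain S C where S: "\<And>\<alpha>. \<alpha> \<in> S \<Longrightarrow> sum \<alpha> UNIV \<le> \<nu>" "finite S"
    and Hy: "\<And>y. H y = (\<Sum>\<alpha>\<in>S. C \<alpha> * (\<Prod>i\<in>UNIV. (y $ i) ^ \<alpha> i))"
    using H unfolding poly_fun_of_degree_le_def by blast
  have "\<exists>p. degree p \<le> r \<and> (\<forall>c. u (t0 + c * h) $ i = poly p c) \<and> poly p 0 = y0 $ i \<and>
     pderiv p = smult h (gauss_projection k r (\<lambda>x. hamiltonian_field H (u (t0 + x * h)) $ i))" for i
    using hbvm_solution_coordinate[OF sol, of "axis i 1"] by (simp add: inner_axis)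
  then obtain p where p: "\<And>i. degree (p i) \<le> r" "\<And>i c. u (t0 + c * h) $ i = poly (p i) c"
      "\<And>i. poly (p i) 0 = y0 $ i"
    and p': "\<And>i. pderiv (p i) =
       smult h (gauss_projection k r (\<lambda>x. hamiltonian_field H (u (t0 + x * h)) $ i))" by metis
  define g where "g j = (\<Sum>\<alpha>\<in>S. smult (C \<alpha> * real (\<alpha> j)) (monomial_partial \<alpha> j p))" for j
  let ?Q = "\<lambda>i. gauss_projection k r (poly (g i))"
  have grad: "gradient H (u (t0 + c * h)) $ j = poly (g j) c" for j c
    by (simp add: gradient_poly_fun[OF Hy] g_def poly_sum poly_monomial_partial p(2))
  have Q: "pderiv (p j) = (\<Sum>i\<in>UNIV. smult (h * symplectic_J $ j $ i) (?Q i))" for j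
  proof -
    have "(\<lambda>x. hamiltonian_field H (u (t0 + x * h)) $ j) =
        (\<lambda>x. \<Sum>i\<in>UNIV. symplectic_J $ j $ i * poly (g i) x)"
      by (simp add: hamiltonian_field_def matrix_vector_mult_def grad)
    then have "pderiv (p j) = smult h (\<Sum>i\<in>UNIV. smult (symplectic_J $ j $ i) (?Q i))"
      unfolding p' by (simp add: gauss_projection_sum gauss_projection_cmult)
    then show ?thesis by (intro poly_eqI) (simp add: coeff_sum sum_distrib_left mult.assoc)
  qed
  have dg: "degree (g j) \<le> r * (\<nu> - 1)" for j
    unfolding g_def
  proof (intro degree_sum_le S(2))
    fix \<alpha> assume "\<alpha> \<in> S"
    show "degree (smult (C \<alpha> * real (\<alpha> j)) (monomial_partial \<alpha> j p)) \<le> r * (\<nu> - 1)"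
    proof (cases "\<alpha> j = 0")
      case False
      then show ?thesis
        using degree_monomial_partial[of p r \<alpha> j \<nu>] p(1) S(1)[OF \<open>\<alpha> \<in> S\<close>]
        by (intro order_trans[OF degree_smult_le]) auto
    qed simp
  qed
  have "r + r * (\<nu> - 1) \<le> 2 * k"
  proof (cases \<nu>)
    case 0
    then show ?thesis using r by simp
  next
    case (Suc n)
    have "real \<nu> * real r \<le> 2 * real k" using \<nu> r by (simp add: field_simps)
    then have "real (\<nu> * r) \<le> real (2 * k)" by simp
    then have "\<nu> * r \<le> 2 * k" by (simp only: of_nat_le_iff)
    then show ?thesis using Suc by (simp add: mult.commute)
  qed
  then have deg: "degree (g j) + r \<le> 2 * k" for j using dg[of j] by linarith
  define M where "M i j = unit_integral (?Q i * ?Q j)" for i j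
  have M: "unit_integral (g j * ?Q i) = M i j" for i j
  proof -
    have d: "degree (?Q i) < r" by (rule degree_gauss_projection[OF r(1)])
    then have "degree (?Q i) + degree (g j) < 2 * k" using deg[of j] by linarith
    from unit_integral_mult_gauss_projection[OF d this] show ?thesis by (simp add: M_def mult.commute)
  qed
  define P where "P = (\<Sum>\<alpha>\<in>S. smult (C \<alpha>) (\<Prod>i\<in>UNIV. p i ^ \<alpha> i))"
  have Pc: "poly P c = H (u (t0 + c * h))" for c
    by (simp add: P_def Hy poly_sum poly_prod p(2))
  have "pderiv P = (\<Sum>\<alpha>\<in>S. \<Sum>j\<in>UNIV. smult (C \<alpha> * real (\<alpha> j)) (monomial_partial \<alpha> j p) * pderiv (p j))"
    by (simp add: P_def pderiv_sum pderiv_smult pderiv_monomial smult_sum_right)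
  also have "\<dots> = (\<Sum>j\<in>UNIV. g j * pderiv (p j))"
    unfolding g_def sum_distrib_right by (rule sum.swap)
  also have "unit_integral \<dots> = (\<Sum>j\<in>UNIV. \<Sum>i\<in>UNIV. h * symplectic_J $ j $ i * M i j)"
    unfolding Q sum_distrib_left mult_smult_right unit_integral_sum unit_integral_smult M ..
  finally have I: "unit_integral (pderiv P) = (\<Sum>j\<in>UNIV. \<Sum>i\<in>UNIV. h * symplectic_J $ j $ i * M i j)" .
  also have "\<dots> = (\<Sum>i\<in>UNIV. \<Sum>j\<in>UNIV. h * symplectic_J $ j $ i * M i j)" by (rule sum.swap)
  also have "\<dots> = (\<Sum>i\<in>UNIV. \<Sum>j\<in>UNIV. - (h * symplectic_J $ i $ j * M j i))"
    by (intro sum.cong refl) (subst symplectic_J_skew, simp add: M_def mult.commute)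
  also have "\<dots> = - unit_integral (pderiv P)" by (simp add: I sum_negf)
  finally have "unit_integral (pderiv P) = 0" by simp
  then have "poly P 1 = poly P 0" by (simp add: unit_integral_pderiv)
  moreover have "u t0 = y0" using sol unfolding hbvm_solution_iff by blast
  ultimately show ?thesis using Pc[of 1] Pc[of 0] by simp
qed

section \<open>Families of polynomials graded by the stepsize\<close>

abbreviation O_pow :: "nat \<Rightarrow> (real \<Rightarrow> real) set" where
  "O_pow n \<equiv> O[at_right 0](\<lambda>h. h ^ n)"

lemma O_pow_mono:
  assumes "f \<in> O_pow n" "m \<le> n"
  shows "f \<in> O_pow m"
proof (rule landau_o.big_trans[OF assms(1)], rule bigoI[of _ 1])
  show "\<forall>\<^sub>F h in at_right 0. norm (h ^ n) \<le> 1 * norm (h ^ m :: real)"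
    by (rule eventually_at_rightI[of 0 1]) (auto intro!: power_decreasing assms(2))
qed

lemma O_pow_mult:
  assumes "f \<in> O_pow m" "g \<in> O_pow n" "l \<le> m + n"
  shows "(\<lambda>h. f h * g h) \<in> O_pow l"
  using O_pow_mono[OF _ assms(3)] landau_o.big.mult[OF assms(1,2)] by (simp add: power_add)

lemma O_pow_const: "(\<lambda>h. c) \<in> O_pow 0"
  by simp

lemma O_pow_cmult: "f \<in> O_pow n \<Longrightarrow> (\<lambda>h. c * f h) \<in> O_pow n"
  using O_pow_mult[OF O_pow_const, of f n n c] by simp

lemma O_pow_stepsize: "f \<in> O_pow n \<Longrightarrow> (\<lambda>h. h * f h) \<in> O_pow (Suc n)"
  using O_pow_mult[of "\<lambda>h. h" 1 f n "Suc n"] by simp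

text \<open>A family \<open>p h\<close> of polynomials in \<open>c\<close> is graded when it is, up to \<open>h ^ n\<close>, a polynomial with
  bounded coefficients in the unscaled time \<open>c h\<close>.\<close>

definition graded :: "nat \<Rightarrow> (real \<Rightarrow> real poly) \<Rightarrow> bool" where
  "graded n p \<longleftrightarrow> (\<exists>D. \<forall>\<^sub>F h in at_right 0. degree (p h) \<le> D) \<and>
     (\<forall>i. (\<lambda>h. coeff (p h) i) \<in> O_pow (min i n))"

definition coeffs_O :: "nat \<Rightarrow> (real \<Rightarrow> real poly) \<Rightarrow> bool" where
  "coeffs_O n p \<longleftrightarrow> (\<exists>D. \<forall>\<^sub>F h in at_right 0. degree (p h) \<le> D) \<and>
     (\<forall>i. (\<lambda>h. coeff (p h) i) \<in> O_pow n)"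

lemma graded_coeff: "graded n p \<Longrightarrow> (\<lambda>h. coeff (p h) i) \<in> O_pow (min i n)"
  by (simp add: graded_def)

lemma graded_degree: "graded n p \<Longrightarrow> \<exists>D. \<forall>\<^sub>F h in at_right 0. degree (p h) \<le> D"
  by (simp add: graded_def)

lemma graded_mono:
  assumes "graded n p" "m \<le> n"
  shows "graded m p"
proof -
  have "(\<lambda>h. coeff (p h) i) \<in> O_pow (min i m)" for i
    by (rule O_pow_mono[OF graded_coeff[OF assms(1), of i]]) (use assms(2) in auto)
  then show ?thesis using graded_degree[OF assms(1)] unfolding graded_def by blast
qed

lemma coeffs_O_imp_graded: "coeffs_O n p \<Longrightarrow> graded n p"
  unfolding graded_def coeffs_O_def using O_pow_mono by (meson min.cobounded2)

lemma graded_imp_coeffs_O: "graded n p \<Longrightarrow> coeffs_O 0 p"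
  unfolding graded_def coeffs_O_def using O_pow_mono by (meson le0)

lemma graded_cong:
  assumes "\<forall>\<^sub>F h in at_right 0. p h = q h" "graded n q"
  shows "graded n p"
  unfolding graded_def
proof (intro conjI allI)
  from assms(2) obtain D where "\<forall>\<^sub>F h in at_right 0. degree (q h) \<le> D" unfolding graded_def by blast
  with assms(1) have "\<forall>\<^sub>F h in at_right 0. degree (p h) \<le> D" by eventually_elim simp
  then show "\<exists>D. \<forall>\<^sub>F h in at_right 0. degree (p h) \<le> D" by blast
  fix i
  have "\<forall>\<^sub>F h in at_right 0. coeff (p h) i = coeff (q h) i" using assms(1) by eventually_elim simp
  then show "(\<lambda>h. coeff (p h) i) \<in> O_pow (min i n)"
    using graded_coeff[OF assms(2), of i] by (subst landau_o.big.in_cong) auto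
qed

lemma coeffs_O_cong:
  assumes "\<forall>\<^sub>F h in at_right 0. p h = q h" "coeffs_O n q"
  shows "coeffs_O n p"
  unfolding coeffs_O_def
proof (intro conjI allI)
  from assms(2) obtain D where "\<forall>\<^sub>F h in at_right 0. degree (q h) \<le> D" unfolding coeffs_O_def by blast
  with assms(1) have "\<forall>\<^sub>F h in at_right 0. degree (p h) \<le> D" by eventually_elim simp
  then show "\<exists>D. \<forall>\<^sub>F h in at_right 0. degree (p h) \<le> D" by blast
  fix i
  have "\<forall>\<^sub>F h in at_right 0. coeff (p h) i = coeff (q h) i" using assms(1) by eventually_elim simp
  then show "(\<lambda>h. coeff (p h) i) \<in> O_pow n"
    using assms(2) unfolding coeffs_O_def by (subst landau_o.big.in_cong) auto
qed

lemma graded_const: "graded n (\<lambda>h. [:a:])"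
  unfolding graded_def
proof (intro conjI allI)
  show "\<exists>D. \<forall>\<^sub>F h in at_right (0::real). degree [:a:] \<le> D" by (intro exI[of _ 0]) simp
  fix i show "(\<lambda>h. coeff [:a:] i) \<in> O_pow (min i n)"
    by (cases i) (auto simp: O_pow_const)
qed

lemma graded_0 [simp]: "graded n (\<lambda>h. 0)"
  using graded_const[of n 0] by simp

lemma eventually_degree_mult:
  assumes "\<forall>\<^sub>F h in F. degree (p h :: real poly) \<le> D" "\<forall>\<^sub>F h in F. degree (q h) \<le> E"
  shows "\<forall>\<^sub>F h in F. degree (p h * q h) \<le> D + E"
  using assms by eventually_elim (meson add_mono degree_mult_le order_trans)

lemma eventually_degree_add:
  assumes "\<forall>\<^sub>F h in F. degree (p h :: real poly) \<le> D" "\<forall>\<^sub>F h in F. degree (q h) \<le> E"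
  shows "\<forall>\<^sub>F h in F. degree (p h + q h) \<le> max D E"
  using assms by eventually_elim (meson degree_add_le max.cobounded1 max.cobounded2 order_trans)

lemma graded_add:
  assumes "graded n p" "graded n q"
  shows "graded n (\<lambda>h. p h + q h)"
  unfolding graded_def
proof (intro conjI allI)
  show "\<exists>D. \<forall>\<^sub>F h in at_right 0. degree (p h + q h) \<le> D"
    using graded_degree[OF assms(1)] graded_degree[OF assms(2)] eventually_degree_add by blast
  fix i show "(\<lambda>h. coeff (p h + q h) i) \<in> O_pow (min i n)"
    using graded_coeff[OF assms(1)] graded_coeff[OF assms(2)] by (simp add: sum_in_bigo)
qed

lemma coeffs_O_add:
  assumes "coeffs_O n p" "coeffs_O n q"
  shows "coeffs_O n (\<lambda>h. p h + q h)"
  using assms unfolding coeffs_O_def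
  by (auto intro: eventually_degree_add sum_in_bigo)

lemma graded_mult:
  assumes "graded n p" "graded n q"
  shows "graded n (\<lambda>h. p h * q h)"
  unfolding graded_def
proof (intro conjI allI)
  show "\<exists>D. \<forall>\<^sub>F h in at_right 0. degree (p h * q h) \<le> D"
    using graded_degree[OF assms(1)] graded_degree[OF assms(2)] eventually_degree_mult by blast
  fix m
  have "(\<lambda>h. \<Sum>i\<le>m. coeff (p h) i * coeff (q h) (m - i)) \<in> O_pow (min m n)"
    by (intro big_sum_in_bigo O_pow_mult[OF graded_coeff[OF assms(1)] graded_coeff[OF assms(2)]]) auto
  then show "(\<lambda>h. coeff (p h * q h) m) \<in> O_pow (min m n)" by (simp add: coeff_mult)
qed

lemma coeffs_O_mult:
  assumes "coeffs_O m p" "coeffs_O n q"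
  shows "coeffs_O (m + n) (\<lambda>h. p h * q h)"
  unfolding coeffs_O_def
proof (intro conjI allI)
  show "\<exists>D. \<forall>\<^sub>F h in at_right 0. degree (p h * q h) \<le> D"
    using assms eventually_degree_mult unfolding coeffs_O_def by blast
  fix i
  have "(\<lambda>h. \<Sum>j\<le>i. coeff (p h) j * coeff (q h) (i - j)) \<in> O_pow (m + n)"
    using assms unfolding coeffs_O_def by (intro big_sum_in_bigo O_pow_mult) auto
  then show "(\<lambda>h. coeff (p h * q h) i) \<in> O_pow (m + n)" by (simp add: coeff_mult)
qed

lemma graded_smult: "graded n p \<Longrightarrow> graded n (\<lambda>h. smult a (p h))"
  using graded_mult[OF graded_const[of n a], of p] by simp

lemma graded_uminus: "graded n p \<Longrightarrow> graded n (\<lambda>h. - p h)"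
  using graded_smult[of n p "-1"] by simp

lemma graded_diff: "graded n p \<Longrightarrow> graded n q \<Longrightarrow> graded n (\<lambda>h. p h - q h)"
  using graded_add[OF _ graded_uminus, of n p q] by simp

lemma graded_sum: "(\<And>i. i \<in> A \<Longrightarrow> graded n (p i)) \<Longrightarrow> graded n (\<lambda>h. \<Sum>i\<in>A. p i h)"
  by (induction A rule: infinite_finite_induct) (auto intro: graded_add)

lemma coeffs_O_0 [simp]: "coeffs_O n (\<lambda>h. 0)"
  by (simp add: coeffs_O_def)

lemma coeffs_O_sum: "(\<And>i. i \<in> A \<Longrightarrow> coeffs_O n (p i)) \<Longrightarrow> coeffs_O n (\<lambda>h. \<Sum>i\<in>A. p i h)"
  by (induction A rule: infinite_finite_induct) (auto intro: coeffs_O_add)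

lemma coeffs_O_stepsize:
  assumes "coeffs_O n p"
  shows "coeffs_O (Suc n) (\<lambda>h. smult h (p h))"
proof -
  from assms obtain D where "\<forall>\<^sub>F h in at_right 0. degree (p h) \<le> D" unfolding coeffs_O_def by blast
  then have "\<forall>\<^sub>F h in at_right 0. degree (smult h (p h)) \<le> D"
    by eventually_elim (meson degree_smult_le order_trans)
  then have "\<exists>D. \<forall>\<^sub>F h in at_right 0. degree (smult h (p h)) \<le> D" by blast
  then show ?thesis
    using assms O_pow_stepsize unfolding coeffs_O_def coeff_smult by blast
qed

lemma graded_poly_primitive:
  assumes deg: "\<exists>D. \<forall>\<^sub>F h in at_right 0. degree (p h) \<le> D"
    and coeff: "\<And>i. (\<lambda>h. coeff (p h) i) \<in> O_pow (min (Suc i) n)"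
  shows "graded n (\<lambda>h. poly_primitive (p h))"
  unfolding graded_def
proof (intro conjI allI)
  from deg obtain D where "\<forall>\<^sub>F h in at_right 0. degree (p h) \<le> D" by blast
  then have "\<forall>\<^sub>F h in at_right 0. degree (poly_primitive (p h)) \<le> Suc D"
    by eventually_elim (meson Suc_le_mono degree_poly_primitive_le order_trans)
  then show "\<exists>D. \<forall>\<^sub>F h in at_right 0. degree (poly_primitive (p h)) \<le> D" by blast
  fix i show "(\<lambda>h. coeff (poly_primitive (p h)) i) \<in> O_pow (min i n)"
  proof (cases i)
    case (Suc j)
    show ?thesis using O_pow_cmult[OF coeff[of j], of "1 / real (Suc j)"] Suc
      by (simp add: coeff_poly_primitive)
  qed (simp add: coeff_poly_primitive)
qed

lemma coeffs_O_poly_primitive: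
  assumes "coeffs_O n p"
  shows "coeffs_O n (\<lambda>h. poly_primitive (p h))"
  unfolding coeffs_O_def
proof (intro conjI allI)
  from assms obtain D where "\<forall>\<^sub>F h in at_right 0. degree (p h) \<le> D" unfolding coeffs_O_def by blast
  then have "\<forall>\<^sub>F h in at_right 0. degree (poly_primitive (p h)) \<le> Suc D"
    by eventually_elim (meson Suc_le_mono degree_poly_primitive_le order_trans)
  then show "\<exists>D. \<forall>\<^sub>F h in at_right 0. degree (poly_primitive (p h)) \<le> D" by blast
  fix i show "(\<lambda>h. coeff (poly_primitive (p h)) i) \<in> O_pow n"
  proof (cases i)
    case (Suc j)
    have "(\<lambda>h. coeff (p h) j) \<in> O_pow n" using assms by (simp add: coeffs_O_def)
    from O_pow_cmult[OF this, of "1 / real (Suc j)"] show ?thesis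
      using Suc by (simp add: coeff_poly_primitive)
  qed (simp add: coeff_poly_primitive)
qed

text \<open>Integration raises the degree by one, and the factor \<open>h\<close> pays for it.\<close>

lemma graded_integrate:
  assumes "graded n p"
  shows "graded (Suc n) (\<lambda>h. smult h (poly_primitive (p h)))"
proof -
  have "(\<lambda>h. coeff (smult h (p h)) i) \<in> O_pow (min (Suc i) (Suc n))" for i
    using O_pow_stepsize[OF graded_coeff[OF assms, of i]] by simp
  moreover obtain D where "\<forall>\<^sub>F h in at_right 0. degree (p h) \<le> D" using graded_degree[OF assms] by blast
  then have "\<forall>\<^sub>F h in at_right 0. degree (smult h (p h)) \<le> D"
    by eventually_elim (meson degree_smult_le order_trans)
  ultimately have "graded (Suc n) (\<lambda>h. poly_primitive (smult h (p h)))"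
    by (intro graded_poly_primitive) blast+
  then show ?thesis by (simp add: poly_primitive_smult)
qed

subsection \<open>The projection preserves the grading\<close>

lemma poly_monom_sum:
  fixes p :: "'a::comm_ring_1 poly"
  assumes "degree p \<le> D"
  shows "p = (\<Sum>i\<le>D. smult (coeff p i) (monom 1 i))"
  using poly_as_sum_of_monoms'[OF assms] by (simp add: smult_monom)

lemma gauss_projection_monom_sum:
  assumes "degree p \<le> D"
  shows "gauss_projection k r (poly p) =
    (\<Sum>i\<le>D. smult (coeff p i) (gauss_projection k r (poly (monom 1 i))))"
proof -
  have "poly p = (\<lambda>x. \<Sum>i\<le>D. coeff p i * poly (monom 1 i) x)"
    by (subst poly_monom_sum[OF assms]) (auto simp: poly_sum poly_monom)
  then show ?thesis by (simp only: gauss_projection_sum gauss_projection_cmult)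
qed

text \<open>The projection fixes low degrees and sends high degrees to low ones, so it never raises a
  degree; this is why it respects the grading.\<close>

lemma gauss_projection_monom_triangular:
  assumes "1 \<le> r" "r \<le> k" "i < m"
  shows "coeff (gauss_projection k r (poly (monom 1 i))) m = 0"
proof (cases "i < r")
  case True
  then have "gauss_projection k r (poly (monom 1 i)) = monom 1 i"
    using assms by (intro gauss_projection_id) (auto simp: degree_monom_eq)
  then show ?thesis using assms(3) by simp
next
  case False
  then show ?thesis using degree_gauss_projection[OF assms(1), of k "poly (monom 1 i)"] assms(3)
    by (intro coeff_eq_0) simp
qed

lemma graded_gauss_projection:
  assumes r: "1 \<le> r" "r \<le> k" and p: "graded n p"
  shows "graded n (\<lambda>h. gauss_projection k r (poly (p h)))"
proof -
  let ?Q = "\<lambda>i. gauss_projection k r (poly (monom 1 i))"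
  obtain D where D: "\<forall>\<^sub>F h in at_right 0. degree (p h) \<le> D" using graded_degree[OF p] by blast
  have e: "\<forall>\<^sub>F h in at_right 0.
     gauss_projection k r (poly (p h)) = (\<Sum>i\<le>D. smult (coeff (p h) i) (?Q i))"
    using D by eventually_elim (rule gauss_projection_monom_sum)
  have "graded n (\<lambda>h. smult (coeff (p h) i) (?Q i))" for i
    unfolding graded_def
  proof (intro conjI allI)
    show "\<exists>D. \<forall>\<^sub>F h in at_right 0. degree (smult (coeff (p h) i) (?Q i)) \<le> D"
      by (intro exI[of _ "degree (?Q i)"]) simp
    fix m show "(\<lambda>h. coeff (smult (coeff (p h) i) (?Q i)) m) \<in> O_pow (min m n)"
    proof (cases "i < m")
      case True
      then show ?thesis using gauss_projection_monom_triangular[OF r] by simp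
    next
      case False
      then show ?thesis
        using O_pow_mult[OF graded_coeff[OF p, of i] O_pow_const, of "min m n"] by simp
    qed
  qed
  then have "graded n (\<lambda>h. \<Sum>i\<le>D. smult (coeff (p h) i) (?Q i))" by (intro graded_sum)
  then show ?thesis by (rule graded_cong[OF e])
qed

lemma projection_defect_monom:
  assumes "r \<le> k" "i < r"
  shows "monom 1 i - gauss_projection k r (poly (monom 1 i)) = 0"
  using assms gauss_projection_id[of "monom 1 i" r k] by (simp add: degree_monom_eq)

lemma coeffs_O_projection_defect:
  assumes r: "1 \<le> r" "r \<le> k" and p: "graded n p" and "r \<le> n"
  shows "coeffs_O r (\<lambda>h. p h - gauss_projection k r (poly (p h)))"
proof -
  let ?E = "\<lambda>i. monom 1 i - gauss_projection k r (poly (monom 1 i))"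
  obtain D where D: "\<forall>\<^sub>F h in at_right 0. degree (p h) \<le> D" using graded_degree[OF p] by blast
  have e: "\<forall>\<^sub>F h in at_right 0.
     p h - gauss_projection k r (poly (p h)) = (\<Sum>i\<le>D. smult (coeff (p h) i) (?E i))"
    using D
  proof eventually_elim
    case (elim h)
    then show ?case
      by (subst (1) poly_monom_sum[OF elim])
         (simp add: gauss_projection_monom_sum[OF elim] smult_diff_right sum_subtractf)
  qed
  have "coeffs_O r (\<lambda>h. smult (coeff (p h) i) (?E i))" for i
    unfolding coeffs_O_def
  proof (intro conjI allI)
    show "\<exists>D. \<forall>\<^sub>F h in at_right 0. degree (smult (coeff (p h) i) (?E i)) \<le> D"
      by (intro exI[of _ "degree (?E i)"]) simp
    fix m show "(\<lambda>h. coeff (smult (coeff (p h) i) (?E i)) m) \<in> O_pow r"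
    proof (cases "i < r")
      case True
      then show ?thesis using projection_defect_monom[OF r(2)] by (simp del: coeff_diff)
    next
      case False
      then show ?thesis unfolding coeff_smult using assms(4)
        by (intro O_pow_mult[OF graded_coeff[OF p] O_pow_const]) simp
    qed
  qed
  then have "coeffs_O r (\<lambda>h. \<Sum>i\<le>D. smult (coeff (p h) i) (?E i))" by (intro coeffs_O_sum)
  then show ?thesis by (rule coeffs_O_cong[OF e])
qed

text \<open>The source of superconvergence.  The moment of \<open>c ^ j\<close> against the defect of \<open>c ^ i\<close> carries
  the factor \<open>h ^ (i + j)\<close>; when \<open>i + j < 2 r\<close>, one of the degrees is below \<open>r\<close>: either the
  defect itself is zero, or it is orthogonal to \<open>c ^ j\<close>.\<close>

lemma defect_moment_monom:
  assumes "r \<le> k" "i + j < 2 * r"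
  shows "unit_integral (monom 1 j * (monom 1 i - gauss_projection k r (poly (monom 1 i)))) = 0"
proof (cases "i < r")
  case True
  then show ?thesis using projection_defect_monom[OF assms(1), of i] by simp
next
  case False
  then have "j < r" "i + j < 2 * k" using assms by auto
  then show ?thesis
    using unit_integral_mult_gauss_projection[of "monom 1 j" r "monom 1 i" k]
    by (simp add: right_diff_distrib unit_integral_diff degree_monom_eq)
qed

lemma defect_moment:
  assumes r: "1 \<le> r" "r \<le> k" and w: "graded (2 * r) w" and p: "graded (2 * r) p"
  shows "(\<lambda>h. unit_integral (w h * (p h - gauss_projection k r (poly (p h))))) \<in> O_pow (2 * r)"
proof -
  let ?E = "\<lambda>i. monom 1 i - gauss_projection k r (poly (monom 1 i))"
  let ?I = "\<lambda>j i. unit_integral (monom 1 j * ?E i)"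
  obtain D where D: "\<forall>\<^sub>F h in at_right 0. degree (p h) \<le> D" using graded_degree[OF p] by blast
  obtain D' where D': "\<forall>\<^sub>F h in at_right 0. degree (w h) \<le> D'" using graded_degree[OF w] by blast
  have e: "\<forall>\<^sub>F h in at_right 0. unit_integral (w h * (p h - gauss_projection k r (poly (p h)))) =
      (\<Sum>j\<le>D'. \<Sum>i\<le>D. coeff (p h) i * coeff (w h) j * ?I j i)"
    using D D'
  proof eventually_elim
    case (elim h)
    have "p h - gauss_projection k r (poly (p h)) = (\<Sum>i\<le>D. smult (coeff (p h) i) (?E i))"
      by (subst (1) poly_monom_sum[OF elim(1)])
         (simp add: gauss_projection_monom_sum[OF elim(1)] smult_diff_right sum_subtractf)
    moreover have "w h = (\<Sum>j\<le>D'. smult (coeff (w h) j) (monom 1 j))"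
      by (rule poly_monom_sum[OF elim(2)])
    ultimately have "w h * (p h - gauss_projection k r (poly (p h))) =
       (\<Sum>j\<le>D'. smult (coeff (w h) j) (monom 1 j)) * (\<Sum>i\<le>D. smult (coeff (p h) i) (?E i))"
      by (simp only:)
    also have "\<dots> = (\<Sum>j\<le>D'. \<Sum>i\<le>D. smult (coeff (p h) i * coeff (w h) j) (monom 1 j * ?E i))"
      by (simp only: sum_product mult_smult_left mult_smult_right smult_smult)
    finally show ?case by (simp only: unit_integral_sum unit_integral_smult)
  qed
  have "(\<lambda>h. coeff (p h) i * coeff (w h) j * ?I j i) \<in> O_pow (2 * r)" for i j
  proof (cases "i + j < 2 * r")
    case True
    then show ?thesis using defect_moment_monom[OF r(2)] by simp
  next
    case False
    then have "2 * r \<le> min i (2 * r) + min j (2 * r)" by linarith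
    from O_pow_mult[OF graded_coeff[OF p] graded_coeff[OF w] this]
    show ?thesis by (rule O_pow_mult[OF _ O_pow_const]) simp
  qed
  then have "(\<lambda>h. \<Sum>j\<le>D'. \<Sum>i\<le>D. coeff (p h) i * coeff (w h) j * ?I j i) \<in> O_pow (2 * r)"
    by (intro big_sum_in_bigo)
  then show ?thesis by (subst landau_o.big.in_cong[OF e])
qed

section \<open>Superconvergence at the end of the step\<close>

definition unif_O :: "nat \<Rightarrow> (real \<Rightarrow> real \<Rightarrow> 'a::real_normed_vector) \<Rightarrow> bool" where
  "unif_O n g \<longleftrightarrow> (\<exists>C. \<forall>\<^sub>F h in at_right 0. \<forall>c\<in>{0..1}. norm (g h c) \<le> C * h ^ n)"

lemma eventually_small: "a > 0 \<Longrightarrow> \<forall>\<^sub>F h in at_right (0::real). h \<in> {0<..<a}"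
  by (rule eventually_at_rightI[of 0 a]) auto

lemma unif_OE:
  assumes "unif_O n g"
  obtains C where "C \<ge> 0" "\<forall>\<^sub>F h in at_right 0. \<forall>c\<in>{0..1}. norm (g h c) \<le> C * h ^ n"
proof -
  obtain C where C: "\<forall>\<^sub>F h in at_right 0. \<forall>c\<in>{0..1}. norm (g h c) \<le> C * h ^ n"
    using assms unfolding unif_O_def by blast
  have "\<forall>\<^sub>F h in at_right 0. \<forall>c\<in>{0..1}. norm (g h c) \<le> \<bar>C\<bar> * h ^ n"
    using C eventually_small[OF zero_less_one]
  proof eventually_elim
    case (elim h)
    then have "C * h ^ n \<le> \<bar>C\<bar> * h ^ n" by (intro mult_right_mono) auto
    then show ?case using elim(1) by (meson order_trans)
  qed
  then show thesis using that[of "\<bar>C\<bar>"] by simp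
qed

lemma unif_O_mono:
  assumes "unif_O n g" "m \<le> n"
  shows "unif_O m g"
proof -
  obtain C where C: "C \<ge> 0" "\<forall>\<^sub>F h in at_right 0. \<forall>c\<in>{0..1}. norm (g h c) \<le> C * h ^ n"
    using assms(1) by (rule unif_OE)
  have "\<forall>\<^sub>F h in at_right 0. \<forall>c\<in>{0..1}. norm (g h c) \<le> C * h ^ m"
    using C(2) eventually_small[OF zero_less_one]
  proof eventually_elim
    case (elim h)
    then have "C * h ^ n \<le> C * h ^ m" using C(1) assms(2)
      by (intro mult_left_mono power_decreasing) auto
    then show ?case using elim(1) by (meson order_trans)
  qed
  then show ?thesis unfolding unif_O_def by blast
qed

lemma unif_O_add:
  assumes "unif_O n f" "unif_O n g"
  shows "unif_O n (\<lambda>h c. f h c + g h c)"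
proof -
  obtain C D where "\<forall>\<^sub>F h in at_right 0. \<forall>c\<in>{0..1}. norm (f h c) \<le> C * h ^ n"
    "\<forall>\<^sub>F h in at_right 0. \<forall>c\<in>{0..1}. norm (g h c) \<le> D * h ^ n"
    using assms unfolding unif_O_def by blast
  then have "\<forall>\<^sub>F h in at_right 0. \<forall>c\<in>{0..1}. norm (f h c + g h c) \<le> (C + D) * h ^ n"
    by eventually_elim (auto simp: distrib_right intro!: order_trans[OF norm_triangle_ineq] add_mono)
  then show ?thesis unfolding unif_O_def by blast
qed

lemma unif_O_0 [simp]: "unif_O n (\<lambda>h c. 0)"
  unfolding unif_O_def by (intro exI[of _ 0]) simp

lemma unif_O_sum: "(\<And>i. i \<in> A \<Longrightarrow> unif_O n (f i)) \<Longrightarrow> unif_O n (\<lambda>h c. \<Sum>i\<in>A. f i h c)"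
  by (induction A rule: infinite_finite_induct) (auto intro: unif_O_add)

lemma unif_O_mult:
  fixes f g :: "real \<Rightarrow> real \<Rightarrow> real"
  assumes "unif_O m f" "unif_O n g"
  shows "unif_O (m + n) (\<lambda>h c. f h c * g h c)"
proof -
  obtain C where C: "C \<ge> 0" "\<forall>\<^sub>F h in at_right 0. \<forall>c\<in>{0..1}. norm (f h c) \<le> C * h ^ m"
    using assms(1) by (rule unif_OE)
  obtain D where D: "D \<ge> 0" "\<forall>\<^sub>F h in at_right 0. \<forall>c\<in>{0..1}. norm (g h c) \<le> D * h ^ n"
    using assms(2) by (rule unif_OE)
  have "\<forall>\<^sub>F h in at_right 0. \<forall>c\<in>{0..1}. norm (f h c * g h c) \<le> (C * D) * h ^ (m + n)"
    using C(2) D(2) eventually_small[OF zero_less_one]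
  proof eventually_elim
    case (elim h)
    have "norm (f h c * g h c) \<le> (C * D) * h ^ (m + n)" if "c \<in> {0..1}" for c
    proof -
      have "norm (f h c) * norm (g h c) \<le> (C * h ^ m) * (D * h ^ n)"
        using elim that C(1) by (intro mult_mono) auto
      then show ?thesis by (simp add: abs_mult power_add mult_ac)
    qed
    then show ?case by blast
  qed
  then show ?thesis unfolding unif_O_def by blast
qed

lemma unif_O_stepsize:
  fixes f :: "real \<Rightarrow> real \<Rightarrow> real"
  assumes "unif_O n f"
  shows "unif_O (Suc n) (\<lambda>h c. h * f h c)"
proof -
  have "unif_O 1 (\<lambda>h c. h)"
    unfolding unif_O_def using eventually_small[OF zero_less_one]
    by (intro exI[of _ 1]) (auto elim: eventually_mono)
  from unif_O_mult[OF this assms] show ?thesis by simp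
qed

lemma O_pow_imp_unif_O:
  assumes "f \<in> O_pow n"
  shows "unif_O n (\<lambda>h c. f h)"
proof -
  obtain C where "\<forall>\<^sub>F h in at_right 0. norm (f h) \<le> C * norm (h ^ n)"
    using assms by (elim landau_o.bigE) blast
  then have "\<forall>\<^sub>F h in at_right 0. \<forall>c\<in>{0..1::real}. norm (f h) \<le> C * h ^ n"
    using eventually_small[OF zero_less_one] by eventually_elim simp
  then show ?thesis unfolding unif_O_def by blast
qed

lemma unif_O_imp_O_pow:
  assumes "unif_O n f" "c \<in> {0..1}"
  shows "(\<lambda>h. f h c) \<in> O_pow n"
proof -
  obtain C where "\<forall>\<^sub>F h in at_right 0. \<forall>c\<in>{0..1}. norm (f h c) \<le> C * h ^ n"
    using assms(1) unfolding unif_O_def by blast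
  then have "\<forall>\<^sub>F h in at_right 0. norm (f h c) \<le> C * norm (h ^ n)"
    using eventually_small[OF zero_less_one] by eventually_elim (use assms(2) in simp)
  then show ?thesis by (rule bigoI)
qed

lemma unif_O_poly:
  assumes "coeffs_O n p"
  shows "unif_O n (\<lambda>h c. poly (p h) c)"
proof -
  obtain D where D: "\<forall>\<^sub>F h in at_right 0. degree (p h) \<le> D"
    and c: "\<And>i. (\<lambda>h. coeff (p h) i) \<in> O_pow n" using assms unfolding coeffs_O_def by blast
  have "unif_O 0 (\<lambda>h c. c ^ i)" for i :: nat
    unfolding unif_O_def by (intro exI[of _ 1] always_eventually) (auto intro: power_le_one)
  then have "unif_O n (\<lambda>h x. coeff (p h) i * x ^ i)" for i
    using unif_O_mult[OF O_pow_imp_unif_O[OF c[of i]], of 0 "\<lambda>h c. c ^ i"] by simp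
  then have "unif_O n (\<lambda>h x. \<Sum>i\<le>D. coeff (p h) i * x ^ i)" by (rule unif_O_sum)
  then obtain C where "\<forall>\<^sub>F h in at_right 0. \<forall>x\<in>{0..1}. norm (\<Sum>i\<le>D. coeff (p h) i * x ^ i) \<le> C * h ^ n"
    unfolding unif_O_def by blast
  with D have "\<forall>\<^sub>F h in at_right 0. \<forall>x\<in>{0..1}. norm (poly (p h) x) \<le> C * h ^ n"
  proof eventually_elim
    case (elim h)
    have "poly (p h) x = (\<Sum>i\<le>D. coeff (p h) i * x ^ i)" for x
      unfolding poly_altdef using elim(1) by (intro sum.mono_neutral_left) (auto simp: coeff_eq_0)
    then show ?case using elim(2) by simp
  qed
  then show ?thesis unfolding unif_O_def by blast
qed

lemma O_pow_poly: "coeffs_O n p \<Longrightarrow> c \<in> {0..1} \<Longrightarrow> (\<lambda>h. poly (p h) c) \<in> O_pow n"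
  by (rule unif_O_imp_O_pow[OF unif_O_poly])

lemma coeffs_O_constant:
  assumes "f \<in> O_pow n"
  shows "coeffs_O n (\<lambda>h. [:f h:])"
proof -
  have "(\<lambda>h. coeff [:f h:] i) \<in> O_pow n" for i by (cases i) (use assms in simp_all)
  then show ?thesis unfolding coeffs_O_def by auto
qed

lemma graded_constant:
  assumes "f \<in> O_pow 0"
  shows "graded n (\<lambda>h. [:f h:])"
proof -
  have "(\<lambda>h. coeff [:f h:] i) \<in> O_pow (min i n)" for i by (cases i) (use assms in simp_all)
  then show ?thesis unfolding graded_def by auto
qed

lemma coeffs_O_uminus: "coeffs_O n p \<Longrightarrow> coeffs_O n (\<lambda>h. - p h)"
  unfolding coeffs_O_def by simp

lemma coeffs_O_diff: "coeffs_O n p \<Longrightarrow> coeffs_O n q \<Longrightarrow> coeffs_O n (\<lambda>h. p h - q h)"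
  using coeffs_O_add[of n p "\<lambda>h. - q h"] coeffs_O_uminus[of n q] by simp

text \<open>Approximate solutions \<open>\<psi>\<close> of the adjoint linear system \<open>\<psi>\<^sub>j' = - h \<Sum>\<^sub>i \<psi>\<^sub>i A\<^sub>i\<^sub>j\<close> with a unit vector as
  final value, to any power of \<open>h\<close>.  Each step of the induction subtracts the primitive of the
  residual, which leaves a residual with one more factor \<open>h\<close>.\<close>

lemma adjoint_weights:
  fixes A :: "'n::finite \<Rightarrow> 'n \<Rightarrow> real \<Rightarrow> real poly"
  assumes A: "\<And>i j. graded n (A i j)"
  shows "\<exists>\<psi>. (\<forall>j. graded n (\<psi> j)) \<and> (\<forall>j h. poly (\<psi> j h) 1 = (if j = l then 1 else 0)) \<and>
     (\<forall>j. coeffs_O M (\<lambda>h. pderiv (\<psi> j h) + smult h (\<Sum>i\<in>UNIV. \<psi> i h * A i j h)))"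
proof (induction M)
  case 0
  let ?\<psi> = "\<lambda>j (h::real). [:if j = l then 1 else 0:] :: real poly"
  have g: "graded n (?\<psi> j)" for j by (rule graded_const)
  have "coeffs_O (Suc 0) (\<lambda>h. smult h (\<Sum>i\<in>UNIV. ?\<psi> i h * A i j h))" for j
    by (intro coeffs_O_stepsize graded_imp_coeffs_O[of n, OF graded_sum] graded_mult g A)
  then have "coeffs_O 0 (\<lambda>h. smult h (\<Sum>i\<in>UNIV. ?\<psi> i h * A i j h))" for j
    unfolding coeffs_O_def using O_pow_mono by (meson le0)
  then show ?case using g by (intro exI[of _ ?\<psi>]) (auto simp: pderiv_pCons)
next
  case (Suc M)
  then obtain \<psi> where g: "\<And>j. graded n (\<psi> j)"
    and one: "\<And>j h. poly (\<psi> j h) 1 = (if j = l then 1 else 0)"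
    and res0: "\<And>j. coeffs_O M (\<lambda>h. pderiv (\<psi> j h) + smult h (\<Sum>i\<in>UNIV. \<psi> i h * A i j h))" by blast
  define res where "res j h = pderiv (\<psi> j h) + smult h (\<Sum>i\<in>UNIV. \<psi> i h * A i j h)" for j h
  have res: "coeffs_O M (res j)" for j using res0[of j] by (simp add: res_def[abs_def])
  define R where "R j h = poly_primitive (res j h) - [:poly (poly_primitive (res j h)) 1:]" for j h
  have prim: "coeffs_O M (\<lambda>h. poly_primitive (res j h))" for j
    by (rule coeffs_O_poly_primitive[OF res])
  have RO: "coeffs_O M (R j)" for j
    unfolding R_def[abs_def]
    by (intro coeffs_O_diff prim coeffs_O_constant O_pow_poly[OF prim]) simp
  have Rg: "graded n (R j)" for j
  proof -
    have "(\<lambda>h. coeff (res j h) i) \<in> O_pow (min (Suc i) n)" for i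
    proof -
      have "(\<lambda>h. real (Suc i) * coeff (\<psi> j h) (Suc i)) \<in> O_pow (min (Suc i) n)"
        by (rule O_pow_cmult[OF graded_coeff[OF g]])
      moreover have "graded n (\<lambda>h. \<Sum>i\<in>UNIV. \<psi> i h * A i j h)"
        by (intro graded_sum graded_mult g A)
      from O_pow_stepsize[OF graded_coeff[OF this, of i]]
      have "(\<lambda>h. h * coeff (\<Sum>i\<in>UNIV. \<psi> i h * A i j h) i) \<in> O_pow (min (Suc i) n)"
        by (rule O_pow_mono) simp
      ultimately show ?thesis
        unfolding res_def coeff_add coeff_smult coeff_pderiv by (rule sum_in_bigo(1))
    qed
    then have "graded n (\<lambda>h. poly_primitive (res j h))"
      using res[of j] unfolding coeffs_O_def by (intro graded_poly_primitive) auto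
    moreover from this have "graded n (\<lambda>h. [:poly (poly_primitive (res j h)) 1:])"
      by (intro graded_constant O_pow_poly graded_imp_coeffs_O) auto
    ultimately show ?thesis unfolding R_def[abs_def] by (rule graded_diff)
  qed
  have R': "pderiv (R j h) = res j h" for j h
    by (simp add: R_def pderiv_diff pderiv_pCons)
  let ?\<psi> = "\<lambda>j h. \<psi> j h - R j h"
  have "pderiv (?\<psi> j h) + smult h (\<Sum>i\<in>UNIV. ?\<psi> i h * A i j h) =
     smult h (\<Sum>i\<in>UNIV. - (R i h * A i j h))" for j h
    unfolding pderiv_diff R'
    by (simp add: res_def left_diff_distrib sum_subtractf sum_negf smult_diff_right)
  moreover have "coeffs_O (Suc M) (\<lambda>h. smult h (\<Sum>i\<in>UNIV. - (R i h * A i j h)))" for j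
  proof -
    have "coeffs_O M (\<lambda>h. R i h * A i j h)" for i
      using coeffs_O_mult[OF RO graded_imp_coeffs_O[OF A], of i i j] by simp
    then show ?thesis by (intro coeffs_O_stepsize coeffs_O_sum coeffs_O_uminus)
  qed
  ultimately have "coeffs_O (Suc M) (\<lambda>h. pderiv (?\<psi> j h) + smult h (\<Sum>i\<in>UNIV. ?\<psi> i h * A i j h))" for j
    by simp
  moreover have "poly (?\<psi> j h) 1 = (if j = l then 1 else 0)" for j h
    by (simp add: one R_def)
  ultimately show ?case using graded_diff[OF g Rg] by (intro exI[of _ ?\<psi>]) blast
qed

lemma O_pow_increment:
  assumes "\<forall>\<^sub>F h in at_right 0. \<forall>c\<in>{0..1}. (G h has_real_derivative g h c) (at c within {0..1})"
    and "unif_O n g"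
  shows "(\<lambda>h. G h 1 - G h 0) \<in> O_pow n"
proof -
  obtain C where "\<forall>\<^sub>F h in at_right 0. \<forall>c\<in>{0..1}. norm (g h c) \<le> C * h ^ n"
    using assms(2) unfolding unif_O_def by blast
  then have "\<forall>\<^sub>F h in at_right 0. norm (G h 1 - G h 0) \<le> C * norm (h ^ n)"
    using assms(1) eventually_small[OF zero_less_one]
  proof eventually_elim
    case (elim h)
    have "norm (G h 1 - G h 0) \<le> (C * h ^ n) * norm (1 - 0 :: real)"
      by (rule field_differentiable_bound[of "{0..1}" "G h" "g h"]) (use elim in auto)
    then show ?case using elim(3) by simp
  qed
  then show ?thesis by (rule bigoI)
qed

text \<open>Testing the error equation with the weights: the error enters only through their residual,
  and the defect only through its moments, each of which is smaller than its size suggests.\<close>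

theorem superconvergence:
  fixes A :: "'n::finite \<Rightarrow> 'n \<Rightarrow> real \<Rightarrow> real poly" and e s :: "'n \<Rightarrow> real \<Rightarrow> real \<Rightarrow> real"
  assumes r: "1 \<le> r" "r \<le> k"
    and A: "\<And>i j. graded (2 * r) (A i j)" and q: "\<And>i. graded (2 * r) (q i)"
    and der: "\<forall>\<^sub>F h in at_right 0. \<forall>c\<in>{0..1}. \<forall>i. (e i h has_real_derivative
        h * ((\<Sum>j\<in>UNIV. poly (A i j h) c * e j h c) +
          poly (q i h - gauss_projection k r (poly (q i h))) c + s i h c)) (at c within {0..1})"
    and e0: "\<forall>\<^sub>F h in at_right 0. \<forall>i. e i h 0 = 0"
    and e: "\<And>i. unif_O (Suc r) (e i)" and s: "\<And>i. unif_O (2 * r) (s i)"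
  shows "(\<lambda>h. e l h 1) \<in> O_pow (2 * r + 1)"
proof -
  define d where "d i h = q i h - gauss_projection k r (poly (q i h))" for i h
  obtain \<psi> where \<psi>: "\<And>j. graded (2 * r) (\<psi> j)" "\<And>j h. poly (\<psi> j h) 1 = (if j = l then 1 else 0)"
    and res: "\<And>j. coeffs_O r (\<lambda>h. pderiv (\<psi> j h) + smult h (\<Sum>i\<in>UNIV. \<psi> i h * A i j h))"
    using adjoint_weights[of "2 * r" A l r] A by blast
  define res where "res j h = pderiv (\<psi> j h) + smult h (\<Sum>i\<in>UNIV. \<psi> i h * A i j h)" for j h
  define W where "W h = (\<Sum>i\<in>UNIV. \<psi> i h * d i h)" for h
  define G where "G h c = (\<Sum>i\<in>UNIV. poly (\<psi> i h) c * e i h c) - h * poly (poly_primitive (W h)) c" for h c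
  define g where "g h c = (\<Sum>j\<in>UNIV. poly (res j h) c * e j h c) + h * (\<Sum>i\<in>UNIV. poly (\<psi> i h) c * s i h c)"
    for h c
  have "\<forall>\<^sub>F h in at_right 0. \<forall>c\<in>{0..1}. (G h has_real_derivative g h c) (at c within {0..1})"
    using der
  proof eventually_elim
    case (elim h)
    have "(G h has_real_derivative g h c) (at c within {0..1})" if c: "c \<in> {0..1}" for c
    proof -
      let ?e' = "\<lambda>i. h * ((\<Sum>j\<in>UNIV. poly (A i j h) c * e j h c) + poly (d i h) c + s i h c)"
      have P: "(poly p has_real_derivative poly (pderiv p) c) (at c within {0..1})" for p :: "real poly"
        by (rule has_field_derivative_at_within[OF poly_DERIV])
      have E: "(e i h has_real_derivative ?e' i) (at c within {0..1})" for i
        using elim c unfolding d_def by blast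
      have "(G h has_real_derivative
         (\<Sum>i\<in>UNIV. poly (pderiv (\<psi> i h)) c * e i h c + ?e' i * poly (\<psi> i h) c)
           - h * poly (pderiv (poly_primitive (W h))) c) (at c within {0..1})"
        unfolding G_def by (intro DERIV_diff DERIV_sum DERIV_mult DERIV_cmult P E)
      moreover have "(\<Sum>i\<in>UNIV. poly (pderiv (\<psi> i h)) c * e i h c + ?e' i * poly (\<psi> i h) c)
           - h * poly (pderiv (poly_primitive (W h))) c = g h c"
      proof -
        have sw: "(\<Sum>i\<in>UNIV. \<Sum>j\<in>UNIV. poly (\<psi> i h) c * (poly (A i j h) c * e j h c)) =
          (\<Sum>j\<in>UNIV. \<Sum>i\<in>UNIV. poly (\<psi> i h) c * (poly (A i j h) c * e j h c))" by (rule sum.swap)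
        have "(\<Sum>i\<in>UNIV. poly (pderiv (\<psi> i h)) c * e i h c + ?e' i * poly (\<psi> i h) c) =
          (\<Sum>i\<in>UNIV. poly (pderiv (\<psi> i h)) c * e i h c) +
          h * (\<Sum>i\<in>UNIV. \<Sum>j\<in>UNIV. poly (\<psi> i h) c * (poly (A i j h) c * e j h c)) +
          h * (\<Sum>i\<in>UNIV. poly (\<psi> i h) c * poly (d i h) c) +
          h * (\<Sum>i\<in>UNIV. poly (\<psi> i h) c * s i h c)"
          unfolding sum_distrib_left sum.distrib[symmetric]
          by (intro sum.cong refl) (simp add: sum_distrib_left algebra_simps)
        moreover have "(\<Sum>j\<in>UNIV. poly (res j h) c * e j h c) =
          (\<Sum>i\<in>UNIV. poly (pderiv (\<psi> i h)) c * e i h c) +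
          h * (\<Sum>j\<in>UNIV. \<Sum>i\<in>UNIV. poly (\<psi> i h) c * (poly (A i j h) c * e j h c))"
          unfolding res_def sum_distrib_left sum.distrib[symmetric]
          by (intro sum.cong refl)
             (simp add: poly_sum distrib_right sum_distrib_right sum_distrib_left mult.assoc)
        ultimately show ?thesis
          unfolding g_def W_def pderiv_poly_primitive sw by (simp add: poly_sum)
      qed
      ultimately show ?thesis by simp
    qed
    then show ?case by blast
  qed
  moreover have "unif_O (2 * r + 1) g"
    unfolding g_def
  proof (intro unif_O_add unif_O_sum)
    fix j
    have "coeffs_O r (res j)" using res[of j] by (simp add: res_def[abs_def])
    from unif_O_mult[OF unif_O_poly[OF this] e[of j]]
    show "unif_O (2 * r + 1) (\<lambda>h c. poly (res j h) c * e j h c)" by (simp add: mult_2)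
  next
    have "unif_O (2 * r) (\<lambda>h c. poly (\<psi> i h) c * s i h c)" for i
      using unif_O_mult[OF unif_O_poly[OF graded_imp_coeffs_O[OF \<psi>(1)]] s[of i], of i] by simp
    then have "unif_O (2 * r) (\<lambda>h c. \<Sum>i\<in>UNIV. poly (\<psi> i h) c * s i h c)" by (intro unif_O_sum)
    from unif_O_stepsize[OF this]
    show "unif_O (2 * r + 1) (\<lambda>h c. h * (\<Sum>i\<in>UNIV. poly (\<psi> i h) c * s i h c))" by simp
  qed
  ultimately have G: "(\<lambda>h. G h 1 - G h 0) \<in> O_pow (2 * r + 1)" by (rule O_pow_increment)
  have "(\<lambda>h. unit_integral (\<psi> i h * d i h)) \<in> O_pow (2 * r)" for i
    unfolding d_def by (rule defect_moment[OF r \<psi>(1) q])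
  then have "(\<lambda>h. \<Sum>i\<in>UNIV. unit_integral (\<psi> i h * d i h)) \<in> O_pow (2 * r)" by (intro big_sum_in_bigo)
  from O_pow_stepsize[OF this] have "(\<lambda>h. h * unit_integral (W h)) \<in> O_pow (2 * r + 1)"
    by (simp add: W_def unit_integral_sum)
  from sum_in_bigo(1)[OF G this]
  have "(\<lambda>h. G h 1 - G h 0 + h * unit_integral (W h)) \<in> O_pow (2 * r + 1)" .
  moreover have "\<forall>\<^sub>F h in at_right 0. e l h 1 = G h 1 - G h 0 + h * unit_integral (W h)"
    using e0
  proof eventually_elim
    case (elim h)
    then have "G h 0 = 0" by (simp add: G_def)
    moreover have "G h 1 = e l h 1 - h * unit_integral (W h)"
      by (simp add: G_def \<psi>(2) poly_poly_primitive_1 if_distrib[of "\<lambda>x. x * _"] cong: if_cong)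
    ultimately show ?case by simp
  qed
  ultimately show ?thesis by (subst landau_o.big.in_cong)
qed

section \<open>Local estimates for polynomial and analytic functions\<close>

lemma linear_functional_cart:
  fixes F :: "real^'n::finite \<Rightarrow> real"
  assumes "bounded_linear F"
  shows "F v = (\<Sum>i\<in>UNIV. F (axis i 1) * v $ i)"
proof -
  interpret bounded_linear F by fact
  have "v = (\<Sum>i\<in>UNIV. v $ i *\<^sub>R axis i 1)"
    using basis_expansion[of v] by (simp add: scalar_mult_eq_scaleR)
  then have "F v = F (\<Sum>i\<in>UNIV. v $ i *\<^sub>R axis i 1)" by (rule arg_cong)
  then show ?thesis by (simp add: sum scaleR mult.commute)
qed

lemma graded_polynomial_function:
  fixes F :: "real^'n::finite \<Rightarrow> real"
  assumes "real_polynomial_function F" and U: "\<And>i. graded n (U i)"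
  shows "\<exists>q. graded n q \<and> (\<forall>h c. poly (q h) c = F (\<chi> i. poly (U i h) c))"
  using assms(1)
proof induction
  case (linear F)
  have "\<forall>h c. poly (\<Sum>i\<in>UNIV. smult (F (axis i 1)) (U i h)) c = F (\<chi> i. poly (U i h) c)"
    by (subst linear_functional_cart[OF linear]) (simp add: poly_sum)
  moreover have "graded n (\<lambda>h. \<Sum>i\<in>UNIV. smult (F (axis i 1)) (U i h))"
    by (intro graded_sum graded_smult U)
  ultimately show ?case by (intro exI[of _ "\<lambda>h. \<Sum>i\<in>UNIV. smult (F (axis i 1)) (U i h)"]) blast
next
  case (const c)
  then show ?case using graded_const by (intro exI[of _ "\<lambda>h. [:c:]"]) auto
next
  case (add F G)
  then obtain p q where "graded n p" "\<forall>h c. poly (p h) c = F (\<chi> i. poly (U i h) c)"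
    "graded n q" "\<forall>h c. poly (q h) c = G (\<chi> i. poly (U i h) c)" by blast
  then show ?case by (intro exI[of _ "\<lambda>h. p h + q h"]) (auto intro: graded_add)
next
  case (mult F G)
  then obtain p q where "graded n p" "\<forall>h c. poly (p h) c = F (\<chi> i. poly (U i h) c)"
    "graded n q" "\<forall>h c. poly (q h) c = G (\<chi> i. poly (U i h) c)" by blast
  then show ?case by (intro exI[of _ "\<lambda>h. p h * q h"]) (auto intro: graded_mult)
qed

lemma bounded_if_lipschitz_on_ball:
  fixes F :: "'a::real_normed_vector \<Rightarrow> real"
  assumes "L \<ge> 0" "\<And>x y. x \<in> cball 0 B \<Longrightarrow> y \<in> cball 0 B \<Longrightarrow> \<bar>F y - F x\<bar> \<le> L * norm (y - x)"
  shows "\<exists>M\<ge>0. \<forall>x\<in>cball 0 B. \<bar>F x\<bar> \<le> M"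
proof -
  have "\<bar>F x\<bar> \<le> \<bar>F 0\<bar> + L * \<bar>B\<bar>" if x: "x \<in> cball 0 B" for x
  proof -
    have "0 \<in> cball (0::'a) B" using x order_trans[OF norm_ge_zero[of x]] by simp
    from assms(2)[OF this x] have "\<bar>F x - F 0\<bar> \<le> L * norm x" by simp
    moreover have "L * norm x \<le> L * \<bar>B\<bar>" using x assms(1) by (intro mult_left_mono) auto
    ultimately show ?thesis by linarith
  qed
  then show ?thesis using assms(1) by (intro exI[of _ "\<bar>F 0\<bar> + L * \<bar>B\<bar>"]) auto
qed

lemma polynomial_function_lipschitz:
  fixes F :: "real^'n::finite \<Rightarrow> real"
  assumes "real_polynomial_function F"
  shows "\<exists>L\<ge>0. \<forall>x\<in>cball 0 B. \<forall>y\<in>cball 0 B. \<bar>F y - F x\<bar> \<le> L * norm (y - x)"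
  using assms
proof induction
  case (linear F)
  interpret bounded_linear F by fact
  obtain K where "\<And>x. norm (F x) \<le> norm x * K" "K > 0" using pos_bounded by blast
  then show ?case by (intro exI[of _ K]) (auto simp: mult.commute simp flip: diff)
next
  case (const c)
  then show ?case by (intro exI[of _ 0]) auto
next
  case (add F G)
  then obtain K L where *: "K \<ge> 0" "L \<ge> 0" "\<And>x y. x \<in> cball 0 B \<Longrightarrow> y \<in> cball 0 B \<Longrightarrow> \<bar>F y - F x\<bar> \<le> K * norm (y - x)"
    "\<And>x y. x \<in> cball 0 B \<Longrightarrow> y \<in> cball 0 B \<Longrightarrow> \<bar>G y - G x\<bar> \<le> L * norm (y - x)" by blast
  have "\<bar>F y + G y - (F x + G x)\<bar> \<le> (K + L) * norm (y - x)" if "x \<in> cball 0 B" "y \<in> cball 0 B" for x y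
    using *(3,4)[OF that] by (simp add: distrib_right)
  then show ?case using * by (intro exI[of _ "K + L"]) auto
next
  case (mult F G)
  then obtain K L where *: "K \<ge> 0" "L \<ge> 0" "\<And>x y. x \<in> cball 0 B \<Longrightarrow> y \<in> cball 0 B \<Longrightarrow> \<bar>F y - F x\<bar> \<le> K * norm (y - x)"
    "\<And>x y. x \<in> cball 0 B \<Longrightarrow> y \<in> cball 0 B \<Longrightarrow> \<bar>G y - G x\<bar> \<le> L * norm (y - x)" by blast
  obtain MF where M1: "\<And>x. x \<in> cball 0 B \<Longrightarrow> \<bar>F x\<bar> \<le> MF"
    using bounded_if_lipschitz_on_ball[OF *(1), of B F] *(3) by blast
  obtain MG where M2: "\<And>x. x \<in> cball 0 B \<Longrightarrow> \<bar>G x\<bar> \<le> MG"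
    using bounded_if_lipschitz_on_ball[OF *(2), of B G] *(4) by blast
  have "\<bar>F y * G y - F x * G x\<bar> \<le> (\<bar>MF\<bar> * L + \<bar>MG\<bar> * K) * norm (y - x)"
    if "x \<in> cball 0 B" "y \<in> cball 0 B" for x y
  proof -
    have "F y * G y - F x * G x = F y * (G y - G x) + G x * (F y - F x)" by (simp add: algebra_simps)
    also have "\<bar>\<dots>\<bar> \<le> \<bar>F y\<bar> * \<bar>G y - G x\<bar> + \<bar>G x\<bar> * \<bar>F y - F x\<bar>"
      by (rule order_trans[OF abs_triangle_ineq]) (simp add: abs_mult)
    also have "\<dots> \<le> \<bar>MF\<bar> * (L * norm (y - x)) + \<bar>MG\<bar> * (K * norm (y - x))"
      using *(3,4)[OF that] M1[OF that(2)] M2[OF that(1)] by (intro add_mono mult_mono) auto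
    finally show ?thesis by (simp add: algebra_simps)
  qed
  then show ?case using *(1,2) by (intro exI[of _ "\<bar>MF\<bar> * L + \<bar>MG\<bar> * K"]) auto
qed

lemma polynomial_function_bounded:
  fixes F :: "real^'n::finite \<Rightarrow> real"
  assumes "real_polynomial_function F"
  shows "\<exists>M\<ge>0. \<forall>x\<in>cball 0 B. \<bar>F x\<bar> \<le> M"
  using polynomial_function_lipschitz[OF assms, of B] bounded_if_lipschitz_on_ball[of _ B F] by blast

lemma has_sum_diff:
  fixes f g :: "'a \<Rightarrow> real"
  assumes "(f has_sum a) A" "(g has_sum b) A"
  shows "((\<lambda>x. f x - g x) has_sum (a - b)) A"
  using has_sum_add[OF assms(1), of "\<lambda>x. - g x" "- b"] assms(2) by (simp add: has_sum_uminus)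

text \<open>The first-order expansion with quadratic remainder, by the product rule along the
  construction of the function; the \<open>F'\<close> are its partial derivatives and again polynomial.\<close>

lemma polynomial_function_taylor2:
  fixes F :: "real^'n::finite \<Rightarrow> real"
  assumes "real_polynomial_function F"
  shows "\<exists>F'. (\<forall>i. real_polynomial_function (F' i)) \<and> (\<exists>C. \<forall>x\<in>cball 0 B. \<forall>y\<in>cball 0 B.
     \<bar>F y - F x - (\<Sum>i\<in>UNIV. F' i x * (y - x) $ i)\<bar> \<le> C * (norm (y - x))\<^sup>2)"
  using assms
proof induction
  case (linear F)
  interpret bounded_linear F by fact
  have "F y - F x = (\<Sum>i\<in>UNIV. F (axis i 1) * (y - x) $ i)" for x y
    unfolding diff[symmetric] by (rule linear_functional_cart) fact
  then have a: "\<bar>F y - F x - (\<Sum>i\<in>UNIV. F (axis i 1) * (y - x) $ i)\<bar> \<le> 0 * (norm (y - x))\<^sup>2" for x y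
    by (simp only: diff_self abs_zero mult_zero_left)
  have b: "real_polynomial_function (\<lambda>x::real^'n. F (axis i 1))" for i
    by (rule real_polynomial_function.intros(2))
  show ?case by (intro exI[of _ "\<lambda>i x. F (axis i 1)"] conjI exI[of _ 0] allI ballI a b)
next
  case (const c)
  then show ?case by (intro exI[of _ "\<lambda>i x. 0"] conjI exI[of _ 0]) auto
next
  case (add F G)
  from add.IH(1) obtain F' C where F': "\<And>i. real_polynomial_function (F' i)"
    "\<And>x y. x \<in> cball 0 B \<Longrightarrow> y \<in> cball 0 B \<Longrightarrow>
      \<bar>F y - F x - (\<Sum>i\<in>UNIV. F' i x * (y - x) $ i)\<bar> \<le> C * (norm (y - x))\<^sup>2" by blast
  from add.IH(2) obtain G' D where G': "\<And>i. real_polynomial_function (G' i)"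
    "\<And>x y. x \<in> cball 0 B \<Longrightarrow> y \<in> cball 0 B \<Longrightarrow>
      \<bar>G y - G x - (\<Sum>i\<in>UNIV. G' i x * (y - x) $ i)\<bar> \<le> D * (norm (y - x))\<^sup>2" by blast
  note * = F'(1) G'(1) F'(2) G'(2)
  have a: "\<bar>F y + G y - (F x + G x) - (\<Sum>i\<in>UNIV. (F' i x + G' i x) * (y - x) $ i)\<bar> \<le> (C + D) * (norm (y - x))\<^sup>2"
    if "x \<in> cball 0 B" "y \<in> cball 0 B" for x y
  proof -
    have e1: "(\<Sum>i\<in>UNIV. (F' i x + G' i x) * (y - x) $ i) =
       (\<Sum>i\<in>UNIV. F' i x * (y - x) $ i) + (\<Sum>i\<in>UNIV. G' i x * (y - x) $ i)"
      by (simp only: distrib_right sum.distrib)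
    have e2: "F y + G y - (F x + G x) - (S + T) = (F y - F x - S) + (G y - G x - T)" for S T by simp
    have "\<bar>F y + G y - (F x + G x) - (\<Sum>i\<in>UNIV. (F' i x + G' i x) * (y - x) $ i)\<bar> \<le>
      \<bar>F y - F x - (\<Sum>i\<in>UNIV. F' i x * (y - x) $ i)\<bar> + \<bar>G y - G x - (\<Sum>i\<in>UNIV. G' i x * (y - x) $ i)\<bar>"
      unfolding e1 e2 by (rule abs_triangle_ineq)
    also have "\<dots> \<le> C * (norm (y - x))\<^sup>2 + D * (norm (y - x))\<^sup>2" by (intro add_mono *(3,4) that)
    finally show ?thesis by (simp only: distrib_right)
  qed
  have b: "real_polynomial_function (\<lambda>x. F' i x + G' i x)" for i
    by (intro real_polynomial_function.intros(3) *(1,2))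
  show ?case by (intro exI[of _ "\<lambda>i x. F' i x + G' i x"] conjI exI[of _ "C + D"] allI ballI a b)
next
  case (mult F G)
  from mult.IH(1) obtain F' C where F': "\<And>i. real_polynomial_function (F' i)"
    "\<And>x y. x \<in> cball 0 B \<Longrightarrow> y \<in> cball 0 B \<Longrightarrow>
      \<bar>F y - F x - (\<Sum>i\<in>UNIV. F' i x * (y - x) $ i)\<bar> \<le> C * (norm (y - x))\<^sup>2" by blast
  from mult.IH(2) obtain G' D where G': "\<And>i. real_polynomial_function (G' i)"
    "\<And>x y. x \<in> cball 0 B \<Longrightarrow> y \<in> cball 0 B \<Longrightarrow>
      \<bar>G y - G x - (\<Sum>i\<in>UNIV. G' i x * (y - x) $ i)\<bar> \<le> D * (norm (y - x))\<^sup>2" by blast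
  note * = F'(1) G'(1) F'(2) G'(2)
  obtain K where K: "K \<ge> 0" "\<And>x y. x \<in> cball 0 B \<Longrightarrow> y \<in> cball 0 B \<Longrightarrow> \<bar>F y - F x\<bar> \<le> K * norm (y - x)"
    using polynomial_function_lipschitz[OF mult(1)] by blast
  obtain L where L: "L \<ge> 0" "\<And>x y. x \<in> cball 0 B \<Longrightarrow> y \<in> cball 0 B \<Longrightarrow> \<bar>G y - G x\<bar> \<le> L * norm (y - x)"
    using polynomial_function_lipschitz[OF mult(2)] by blast
  obtain MF where MF: "MF \<ge> 0" "\<And>x. x \<in> cball 0 B \<Longrightarrow> \<bar>F x\<bar> \<le> MF"
    using polynomial_function_bounded[OF mult(1)] by blast
  obtain MG where MG: "MG \<ge> 0" "\<And>x. x \<in> cball 0 B \<Longrightarrow> \<bar>G x\<bar> \<le> MG"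
    using polynomial_function_bounded[OF mult(2)] by blast
  have a: "\<bar>F y * G y - F x * G x - (\<Sum>i\<in>UNIV. (F x * G' i x + G x * F' i x) * (y - x) $ i)\<bar>
      \<le> (MF * D + MG * C + K * L) * (norm (y - x))\<^sup>2"
    if xy: "x \<in> cball 0 B" "y \<in> cball 0 B" for x y
  proof -
    let ?F = "F y - F x - (\<Sum>i\<in>UNIV. F' i x * (y - x) $ i)" and ?G = "G y - G x - (\<Sum>i\<in>UNIV. G' i x * (y - x) $ i)"
    have e1: "(\<Sum>i\<in>UNIV. (F x * G' i x + G x * F' i x) * (y - x) $ i) =
       F x * (\<Sum>i\<in>UNIV. G' i x * (y - x) $ i) + G x * (\<Sum>i\<in>UNIV. F' i x * (y - x) $ i)"
      by (simp only: distrib_right sum.distrib sum_distrib_left mult.assoc)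
    have e2: "F y * G y - F x * G x - (F x * S + G x * T) =
       F x * (G y - G x - S) + G x * (F y - F x - T) + (F y - F x) * (G y - G x)" for S T
      by (simp add: algebra_simps)
    have "\<bar>F y * G y - F x * G x - (\<Sum>i\<in>UNIV. (F x * G' i x + G x * F' i x) * (y - x) $ i)\<bar> \<le> \<bar>F x\<bar> * \<bar>?G\<bar> + \<bar>G x\<bar> * \<bar>?F\<bar> + \<bar>F y - F x\<bar> * \<bar>G y - G x\<bar>"
      unfolding e1 e2 abs_mult[symmetric]
      by (rule order_trans[OF abs_triangle_ineq add_right_mono[OF abs_triangle_ineq]])
    also have "\<dots> \<le> MF * (D * (norm (y - x))\<^sup>2) + MG * (C * (norm (y - x))\<^sup>2) +
        (K * norm (y - x)) * (L * norm (y - x))"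
      by (intro add_mono mult_mono *(3,4)[OF xy] K(2)[OF xy] L(2)[OF xy] MF(2)[OF xy(1)] MG(2)[OF xy(1)]
          mult_nonneg_nonneg abs_ge_zero norm_ge_zero K(1) MF(1) MG(1))
    also have "\<dots> = (MF * D + MG * C + K * L) * (norm (y - x))\<^sup>2"
      by (simp add: algebra_simps power2_eq_square)
    finally show ?thesis .
  qed
  have b: "real_polynomial_function (\<lambda>x. F x * G' i x + G x * F' i x)" for i
    by (intro real_polynomial_function.intros(3) real_polynomial_function.intros(4) *(1,2) mult(1,2))
  show ?case
    by (intro exI[of _ "\<lambda>i x. F x * G' i x + G x * F' i x"] conjI exI[of _ "MF * D + MG * C + K * L"] allI ballI a b)
qed

lemma abs_monomial_le:
  fixes x :: "real^'n::finite"
  assumes "norm x \<le> s"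
  shows "\<bar>\<Prod>i\<in>UNIV. x $ i ^ \<alpha> i\<bar> \<le> s ^ sum \<alpha> UNIV"
proof -
  have "\<bar>\<Prod>i\<in>UNIV. x $ i ^ \<alpha> i\<bar> = (\<Prod>i\<in>UNIV. \<bar>x $ i\<bar> ^ \<alpha> i)" by (simp add: abs_prod power_abs)
  also have "\<dots> \<le> (\<Prod>i\<in>UNIV. s ^ \<alpha> i)"
    by (intro prod_mono conjI power_mono order_trans[OF component_le_norm_cart assms]) auto
  finally show ?thesis by (simp add: power_sum)
qed

text \<open>On the unit cube the Lipschitz constant of a monomial is its degree, which is at most \<open>2\<close> to
  the power of the degree; after scaling, the radius \<open>\<rho>\<close> doubles.  In this form the bound can be
  summed over a series that converges at radius \<open>2 \<rho>\<close>.\<close>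

lemma monomial_lipschitz:
  fixes x y :: "real^'n::finite"
  assumes "\<rho> > 0" "norm x \<le> \<rho>" "norm y \<le> \<rho>"
  shows "\<bar>(\<Prod>i\<in>UNIV. x $ i ^ \<alpha> i) - (\<Prod>i\<in>UNIV. y $ i ^ \<alpha> i)\<bar> \<le>
    (2 * \<rho>) ^ sum \<alpha> UNIV * (norm (x - y) / \<rho>)"
proof -
  have le1: "\<bar>z $ i / \<rho>\<bar> \<le> 1" if "norm z \<le> \<rho>" for z :: "real^'n" and i
    using component_le_norm_cart[of z i] that assms(1) by simp
  have pw: "\<bar>(z $ i / \<rho>) ^ \<alpha> i\<bar> \<le> 1" if "norm z \<le> \<rho>" for z :: "real^'n" and i
    unfolding power_abs by (rule power_le_one[OF abs_ge_zero le1[OF that]])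
  have scale: "(\<Prod>i\<in>UNIV. z $ i ^ \<alpha> i) = \<rho> ^ sum \<alpha> UNIV * (\<Prod>i\<in>UNIV. (z $ i / \<rho>) ^ \<alpha> i)" for z :: "real^'n"
  proof -
    have "(\<Prod>i\<in>UNIV. z $ i ^ \<alpha> i) = (\<Prod>i\<in>UNIV. \<rho> ^ \<alpha> i * (z $ i / \<rho>) ^ \<alpha> i)"
      using assms(1) by (intro prod.cong refl) (simp add: power_divide)
    then show ?thesis by (simp only: prod.distrib power_sum)
  qed
  have "\<bar>(\<Prod>i\<in>UNIV. (x $ i / \<rho>) ^ \<alpha> i) - (\<Prod>i\<in>UNIV. (y $ i / \<rho>) ^ \<alpha> i)\<bar> \<le>
     (\<Sum>i\<in>UNIV. \<bar>(x $ i / \<rho>) ^ \<alpha> i - (y $ i / \<rho>) ^ \<alpha> i\<bar>)"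
    using norm_prod_diff[of UNIV "\<lambda>i. (x $ i / \<rho>) ^ \<alpha> i" "\<lambda>i. (y $ i / \<rho>) ^ \<alpha> i"] pw[OF assms(2)] pw[OF assms(3)]
    unfolding real_norm_def by blast
  also have "\<dots> \<le> (\<Sum>i\<in>UNIV. real (\<alpha> i) * (norm (x - y) / \<rho>))"
  proof (intro sum_mono)
    fix i
    have "\<bar>(x $ i / \<rho>) ^ \<alpha> i - (y $ i / \<rho>) ^ \<alpha> i\<bar> \<le> real (\<alpha> i) * \<bar>x $ i / \<rho> - y $ i / \<rho>\<bar>"
      using norm_power_diff[of "x $ i / \<rho>" "y $ i / \<rho>" "\<alpha> i"] le1[OF assms(2), of i] le1[OF assms(3), of i]
      unfolding real_norm_def by blast
    also have "\<dots> \<le> real (\<alpha> i) * (norm (x - y) / \<rho>)"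
    proof (rule mult_left_mono)
      have "\<bar>x $ i / \<rho> - y $ i / \<rho>\<bar> = \<bar>(x - y) $ i\<bar> / \<rho>"
        using assms(1) by (simp flip: diff_divide_distrib)
      also have "\<dots> \<le> norm (x - y) / \<rho>"
        using component_le_norm_cart[of "x - y" i] assms(1) by (intro divide_right_mono) auto
      finally show "\<bar>x $ i / \<rho> - y $ i / \<rho>\<bar> \<le> norm (x - y) / \<rho>" .
    qed simp
    finally show "\<bar>(x $ i / \<rho>) ^ \<alpha> i - (y $ i / \<rho>) ^ \<alpha> i\<bar> \<le> real (\<alpha> i) * (norm (x - y) / \<rho>)" .
  qed
  also have "\<dots> = real (sum \<alpha> UNIV) * (norm (x - y) / \<rho>)"
    by (simp only: of_nat_sum sum_distrib_right)
  also have "\<dots> \<le> 2 ^ sum \<alpha> UNIV * (norm (x - y) / \<rho>)"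
    using of_nat_less_two_power[of "sum \<alpha> UNIV", where 'a = real] assms(1)
    by (intro mult_right_mono) auto
  finally have le: "\<bar>(\<Prod>i\<in>UNIV. (x $ i / \<rho>) ^ \<alpha> i) - (\<Prod>i\<in>UNIV. (y $ i / \<rho>) ^ \<alpha> i)\<bar> \<le>
     2 ^ sum \<alpha> UNIV * (norm (x - y) / \<rho>)" .
  have "\<bar>(\<Prod>i\<in>UNIV. x $ i ^ \<alpha> i) - (\<Prod>i\<in>UNIV. y $ i ^ \<alpha> i)\<bar> =
     \<bar>\<rho> ^ sum \<alpha> UNIV\<bar> * \<bar>(\<Prod>i\<in>UNIV. (x $ i / \<rho>) ^ \<alpha> i) - (\<Prod>i\<in>UNIV. (y $ i / \<rho>) ^ \<alpha> i)\<bar>"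
    unfolding scale[of x] scale[of y] right_diff_distrib[symmetric] abs_mult ..
  also have "\<dots> \<le> \<bar>\<rho> ^ sum \<alpha> UNIV\<bar> * (2 ^ sum \<alpha> UNIV * (norm (x - y) / \<rho>))"
    by (intro mult_left_mono le) simp
  also have "\<dots> = (2 * \<rho>) ^ sum \<alpha> UNIV * (norm (x - y) / \<rho>)"
    using assms(1) by (simp add: power_mult_distrib)
  finally show ?thesis .
qed

lemma finite_multi_indices: "finite {\<alpha> :: 'n::finite \<Rightarrow> nat. sum \<alpha> UNIV < N}"
proof (rule finite_subset)
  have "\<alpha> i < N" if "sum \<alpha> UNIV < N" for \<alpha> :: "'n \<Rightarrow> nat" and i
    using member_le_sum[of i UNIV \<alpha>] that by simp
  then show "{\<alpha> :: 'n \<Rightarrow> nat. sum \<alpha> UNIV < N} \<subseteq> PiE UNIV (\<lambda>_. {..<N})" by (auto simp: PiE_def)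
qed (auto intro: finite_PiE)

text \<open>The point with all coordinates at distance \<open>2 \<rho>\<close> from \<open>a\<close> lies in the domain of convergence,
  so the series of absolute values there has a finite sum.  It dominates, term by term, the
  differences of monomials and the tail of the series on the ball of radius \<open>\<rho>\<close>.\<close>

lemma power_series_estimates:
  fixes b :: "('n::finite \<Rightarrow> nat) \<Rightarrow> real" and g :: "real^'n \<Rightarrow> real"
  assumes \<epsilon>: "\<epsilon> > 0" and \<rho>: "\<rho> = \<epsilon> / (4 * real CARD('n))"
    and g: "\<And>y. y \<in> ball a \<epsilon> \<Longrightarrow> ((\<lambda>\<alpha>. (\<Prod>i\<in>UNIV. (y $ i - a $ i) ^ \<alpha> i) * b \<alpha>) has_sum g y) UNIV"
  shows "\<exists>L\<ge>0. \<forall>x\<in>cball a \<rho>. \<forall>y\<in>cball a \<rho>. \<bar>g x - g y\<bar> \<le> L * norm (x - y)"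
    and "\<exists>F C. real_polynomial_function F \<and> (\<forall>x\<in>cball a \<rho>. \<bar>g x - F x\<bar> \<le> C * norm (x - a) ^ N)"
proof -
  let ?m = "\<lambda>x \<alpha>. \<Prod>i\<in>UNIV. (x $ i - a $ i) ^ \<alpha> i"
  have \<rho>0: "\<rho> > 0" using \<epsilon> by (simp add: \<rho>)
  have "\<rho> \<le> \<epsilon> / 4"
    unfolding \<rho> using \<epsilon> by (intro divide_left_mono) (auto simp: Suc_leI)
  then have ball: "x \<in> ball a \<epsilon>" if "x \<in> cball a \<rho>" for x using that \<epsilon> by auto
  \<comment> \<open>The corner of the cube of half-width \<open>2 \<rho>\<close>; by the choice of \<open>\<rho>\<close> it is within \<open>\<epsilon> / 2\<close> of \<open>a\<close>.\<close>
  define y1 where "y1 = a + (\<chi> i. 2 * \<rho>)"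
  have "norm (\<chi> i::'n. 2 * \<rho>) \<le> (\<Sum>i\<in>(UNIV::'n set). \<bar>2 * \<rho>\<bar>)"
    using norm_le_l1_cart[of "\<chi> i::'n. 2 * \<rho>"] by simp
  also have "\<dots> < \<epsilon>" using \<epsilon> \<rho>0 by (simp add: \<rho>)
  finally have "y1 \<in> ball a \<epsilon>" by (simp add: y1_def dist_norm)
  from g[OF this] have "(\<lambda>\<alpha>. (2 * \<rho>) ^ sum \<alpha> UNIV * b \<alpha>) summable_on UNIV"
    by (auto simp: y1_def power_sum summable_on_def)
  then have "(\<lambda>\<alpha>. \<bar>(2 * \<rho>) ^ sum \<alpha> UNIV * b \<alpha>\<bar>) summable_on UNIV"
    using summable_on_iff_abs_summable_on_real by fastforce
  then obtain M where "((\<lambda>\<alpha>. \<bar>(2 * \<rho>) ^ sum \<alpha> UNIV * b \<alpha>\<bar>) has_sum M) UNIV"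
    unfolding summable_on_def by blast
  then have M: "((\<lambda>\<alpha>. (2 * \<rho>) ^ sum \<alpha> UNIV * \<bar>b \<alpha>\<bar>) has_sum M) UNIV"
    using \<rho>0 by (simp add: abs_mult)
  have M0: "M \<ge> 0" using M \<rho>0 by (intro has_sum_nonneg[OF M]) auto
  have bound: "\<bar>S\<bar> \<le> T * M"
    if "(f has_sum S) UNIV" "\<And>\<alpha>. \<bar>f \<alpha>\<bar> \<le> T * ((2 * \<rho>) ^ sum \<alpha> UNIV * \<bar>b \<alpha>\<bar>)" for f :: "_ \<Rightarrow> real" and S T
  proof -
    have TM: "((\<lambda>\<alpha>. T * ((2 * \<rho>) ^ sum \<alpha> UNIV * \<bar>b \<alpha>\<bar>)) has_sum T * M) UNIV"
      by (rule has_sum_cmult_right[OF M])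
    have "S \<le> T * M" using that by (intro has_sum_mono[OF that(1) TM]) (auto simp: abs_le_iff)
    moreover have "- S \<le> T * M" using that
      by (intro has_sum_mono[OF _ TM, of "\<lambda>\<alpha>. - f \<alpha>"]) (auto simp: abs_le_iff has_sum_uminus)
    ultimately show ?thesis by simp
  qed
  show "\<exists>L\<ge>0. \<forall>x\<in>cball a \<rho>. \<forall>y\<in>cball a \<rho>. \<bar>g x - g y\<bar> \<le> L * norm (x - y)"
  proof (intro exI[of _ "M / \<rho>"] conjI ballI)
    fix x y assume xy: "x \<in> cball a \<rho>" "y \<in> cball a \<rho>"
    have n: "norm (x - a) \<le> \<rho>" "norm (y - a) \<le> \<rho>"
      using xy by (simp_all add: dist_norm norm_minus_commute)
    have "\<bar>g x - g y\<bar> \<le> (norm (x - y) / \<rho>) * M"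
    proof (rule bound)
      show "((\<lambda>\<alpha>. ?m x \<alpha> * b \<alpha> - ?m y \<alpha> * b \<alpha>) has_sum g x - g y) UNIV"
        by (intro has_sum_diff g ball xy)
      fix \<alpha>
      have "\<bar>?m x \<alpha> - ?m y \<alpha>\<bar> \<le> (2 * \<rho>) ^ sum \<alpha> UNIV * (norm (x - y) / \<rho>)"
        using monomial_lipschitz[OF \<rho>0 n, of \<alpha>] by simp
      from mult_right_mono[OF this, of "\<bar>b \<alpha>\<bar>"]
      show "\<bar>?m x \<alpha> * b \<alpha> - ?m y \<alpha> * b \<alpha>\<bar> \<le> norm (x - y) / \<rho> * ((2 * \<rho>) ^ sum \<alpha> UNIV * \<bar>b \<alpha>\<bar>)"
        unfolding left_diff_distrib[symmetric] abs_mult by (simp only: ac_simps)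
    qed
    then show "\<bar>g x - g y\<bar> \<le> M / \<rho> * norm (x - y)" by (simp add: mult.commute)
  qed (use M0 \<rho>0 in auto)
  let ?S = "{\<alpha> :: 'n \<Rightarrow> nat. sum \<alpha> UNIV < N}"
  define F where "F x = (\<Sum>\<alpha>\<in>?S. ?m x \<alpha> * b \<alpha>)" for x
  have "real_polynomial_function (\<lambda>x::real^'n. x $ i - a $ i)" for i
    by (intro real_polynomial_function_diff real_polynomial_function.intros(1) bounded_linear_vec_nth
        real_polynomial_function.intros(2))
  then have "real_polynomial_function (\<lambda>x. F x)"
    unfolding F_def
    by (intro real_polynomial_function_sum finite_multi_indices real_polynomial_function.intros(4)
        real_polynomial_function_prod real_polynomial_function_power real_polynomial_function.intros(2)) auto
  moreover have "\<forall>x\<in>cball a \<rho>. \<bar>g x - F x\<bar> \<le> (M / (2 * \<rho>) ^ N) * norm (x - a) ^ N"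
  proof
    fix x assume x: "x \<in> cball a \<rho>"
    let ?n = "norm (x - a)"
    have n: "?n \<le> 2 * \<rho>" using x \<rho>0 by (simp add: dist_norm norm_minus_commute)
    have "((\<lambda>\<alpha>. ?m x \<alpha> * b \<alpha>) has_sum F x) ?S"
      unfolding F_def by (rule has_sum_finite[OF finite_multi_indices])
    then have FS: "((\<lambda>\<alpha>. if \<alpha> \<in> ?S then ?m x \<alpha> * b \<alpha> else 0) has_sum F x) UNIV"
      by (subst has_sum_cong_neutral[of ?S]) auto
    have "\<bar>g x - F x\<bar> \<le> (?n ^ N / (2 * \<rho>) ^ N) * M"
    proof (rule bound)
      show "((\<lambda>\<alpha>. ?m x \<alpha> * b \<alpha> - (if \<alpha> \<in> ?S then ?m x \<alpha> * b \<alpha> else 0)) has_sum g x - F x) UNIV"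
        by (intro has_sum_diff g ball x FS)
      fix \<alpha>
      show "\<bar>?m x \<alpha> * b \<alpha> - (if \<alpha> \<in> ?S then ?m x \<alpha> * b \<alpha> else 0)\<bar> \<le>
         ?n ^ N / (2 * \<rho>) ^ N * ((2 * \<rho>) ^ sum \<alpha> UNIV * \<bar>b \<alpha>\<bar>)"
      proof (cases "\<alpha> \<in> ?S")
        case True
        then show ?thesis using \<rho>0 by simp
      next
        case False
        then have e: "sum \<alpha> UNIV = N + (sum \<alpha> UNIV - N)" by simp
        have "\<bar>?m x \<alpha>\<bar> \<le> ?n ^ sum \<alpha> UNIV" using abs_monomial_le[of "x - a" ?n \<alpha>] by simp
        also have "\<dots> = ?n ^ N * ?n ^ (sum \<alpha> UNIV - N)" by (subst e) (rule power_add)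
        also have "\<dots> \<le> ?n ^ N * (2 * \<rho>) ^ (sum \<alpha> UNIV - N)"
          using n by (intro mult_left_mono power_mono) auto
        also have "\<dots> = ?n ^ N / (2 * \<rho>) ^ N * (2 * \<rho>) ^ sum \<alpha> UNIV"
          using \<rho>0 by (subst (2) e) (simp add: power_add)
        finally have "\<bar>?m x \<alpha>\<bar> * \<bar>b \<alpha>\<bar> \<le> ?n ^ N / (2 * \<rho>) ^ N * (2 * \<rho>) ^ sum \<alpha> UNIV * \<bar>b \<alpha>\<bar>"
          by (rule mult_right_mono) simp
        then show ?thesis using False by (simp add: abs_mult mult.assoc)
      qed
    qed
    then show "\<bar>g x - F x\<bar> \<le> (M / (2 * \<rho>) ^ N) * ?n ^ N" by (simp add: mult.commute)
  qed
  ultimately show "\<exists>F C. real_polynomial_function F \<and> (\<forall>x\<in>cball a \<rho>. \<bar>g x - F x\<bar> \<le> C * norm (x - a) ^ N)"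
    by (intro exI[of _ F] exI[of _ "M / (2 * \<rho>) ^ N"]) simp
qed

lemma real_analytic_local:
  fixes f :: "real^'n::finite \<Rightarrow> real^'l::finite"
  assumes "open \<Omega>" "real_analytic_on f \<Omega>" "a \<in> \<Omega>"
  shows "\<exists>\<rho>>0. cball a \<rho> \<subseteq> \<Omega> \<and>
    (\<exists>L\<ge>0. \<forall>x\<in>cball a \<rho>. \<forall>y\<in>cball a \<rho>. norm (f x - f y) \<le> L * norm (x - y)) \<and>
    (\<forall>N. \<exists>F C. (\<forall>i. real_polynomial_function (F i)) \<and>
       (\<forall>x\<in>cball a \<rho>. \<forall>i. \<bar>f x $ i - F i x\<bar> \<le> C * norm (x - a) ^ N))"
proof -
  obtain \<epsilon>1 and b :: "('n \<Rightarrow> nat) \<Rightarrow> real^'l" where e1: "\<epsilon>1 > 0"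
    and b: "\<And>y. y \<in> ball a \<epsilon>1 \<Longrightarrow> ((\<lambda>\<alpha>. (\<Prod>i\<in>UNIV. (y $ i - a $ i) ^ \<alpha> i) *\<^sub>R b \<alpha>) has_sum f y) UNIV"
    using assms(2,3) unfolding real_analytic_on_def by blast
  obtain \<epsilon>2 where e2: "\<epsilon>2 > 0" "ball a \<epsilon>2 \<subseteq> \<Omega>" using assms(1,3) openE by blast
  define \<epsilon> where "\<epsilon> = min \<epsilon>1 \<epsilon>2"
  define \<rho> where "\<rho> = \<epsilon> / (4 * real CARD('n))"
  have \<epsilon>: "\<epsilon> > 0" using e1 e2 by (simp add: \<epsilon>_def)
  have \<rho>0: "\<rho> > 0" using \<epsilon> by (simp add: \<rho>_def)
  have "\<rho> \<le> \<epsilon> / 4"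
    unfolding \<rho>_def using \<epsilon> by (intro divide_left_mono) (auto simp: Suc_leI)
  then have sub: "cball a \<rho> \<subseteq> \<Omega>" using e2 \<epsilon> unfolding \<epsilon>_def by (auto simp: subset_iff)
  have g: "((\<lambda>\<alpha>. (\<Prod>i\<in>UNIV. (y $ i - a $ i) ^ \<alpha> i) * b \<alpha> $ l) has_sum f y $ l) UNIV"
    if "y \<in> ball a \<epsilon>" for y l
    using has_sum_bounded_linear[OF bounded_linear_vec_nth b, of y l] that by (simp add: \<epsilon>_def o_def)
  have "\<exists>L\<ge>0. \<forall>x\<in>cball a \<rho>. \<forall>y\<in>cball a \<rho>. \<bar>f x $ l - f y $ l\<bar> \<le> L * norm (x - y)" for l
    by (rule power_series_estimates(1)[OF \<epsilon> \<rho>_def g])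
  then obtain L where L: "\<And>l. L l \<ge> 0"
    "\<And>l x y. x \<in> cball a \<rho> \<Longrightarrow> y \<in> cball a \<rho> \<Longrightarrow> \<bar>f x $ l - f y $ l\<bar> \<le> L l * norm (x - y)" by metis
  have "norm (f x - f y) \<le> (\<Sum>l\<in>UNIV. L l) * norm (x - y)" if "x \<in> cball a \<rho>" "y \<in> cball a \<rho>" for x y
  proof -
    have "norm (f x - f y) \<le> (\<Sum>l\<in>UNIV. \<bar>(f x - f y) $ l\<bar>)" by (rule norm_le_l1_cart)
    also have "\<dots> \<le> (\<Sum>l\<in>UNIV. L l * norm (x - y))" by (intro sum_mono) (simp add: L(2)[OF that])
    finally show ?thesis by (simp add: sum_distrib_right)
  qed
  then have "\<exists>L\<ge>0. \<forall>x\<in>cball a \<rho>. \<forall>y\<in>cball a \<rho>. norm (f x - f y) \<le> L * norm (x - y)"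
    using L(1) by (intro exI[of _ "\<Sum>l\<in>UNIV. L l"]) (auto intro: sum_nonneg)
  moreover have "\<exists>F C. (\<forall>i. real_polynomial_function (F i)) \<and>
       (\<forall>x\<in>cball a \<rho>. \<forall>i. \<bar>f x $ i - F i x\<bar> \<le> C * norm (x - a) ^ N)" for N
  proof -
    have "\<exists>F C. real_polynomial_function F \<and> (\<forall>x\<in>cball a \<rho>. \<bar>f x $ l - F x\<bar> \<le> C * norm (x - a) ^ N)" for l
      by (rule power_series_estimates(2)[OF \<epsilon> \<rho>_def g])
    then obtain F C where F: "\<And>l. real_polynomial_function (F l)"
      "\<And>l x. x \<in> cball a \<rho> \<Longrightarrow> \<bar>f x $ l - F l x\<bar> \<le> C l * norm (x - a) ^ N" by metis
    have "\<bar>f x $ l - F l x\<bar> \<le> (\<Sum>l\<in>UNIV. \<bar>C l\<bar>) * norm (x - a) ^ N" if "x \<in> cball a \<rho>" for x l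
    proof -
      have "C l \<le> (\<Sum>l\<in>UNIV. \<bar>C l\<bar>)"
        using member_le_sum[of l UNIV "\<lambda>l. \<bar>C l\<bar>"] by simp
      then have "C l * norm (x - a) ^ N \<le> (\<Sum>l\<in>UNIV. \<bar>C l\<bar>) * norm (x - a) ^ N" by (intro mult_right_mono) auto
      then show ?thesis using F(2)[OF that, of l] by linarith
    qed
    then show ?thesis using F(1) by (intro exI[of _ F] exI[of _ "\<Sum>l\<in>UNIV. \<bar>C l\<bar>"]) blast
  qed
  ultimately show ?thesis using \<rho>0 sub by (intro exI[of _ \<rho>]) blast
qed

section \<open>Local existence and uniqueness of the discrete solution\<close>

text \<open>The unknowns of the discrete problem are the values at the nodes, a family indexed by a set of
  reals.  Banach's iteration is therefore run on functions, with bounds uniform over \<open>S\<close> in place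
  of a norm.\<close>

lemma contraction_family_fixed_point:
  fixes T :: "('i \<Rightarrow> 'a::banach) \<Rightarrow> 'i \<Rightarrow> 'a"
  assumes X: "closed X" and init: "\<And>x. x \<in> S \<Longrightarrow> init x \<in> X"
    and maps: "\<And>g x. (\<And>x. x \<in> S \<Longrightarrow> g x \<in> X) \<Longrightarrow> x \<in> S \<Longrightarrow> T g x \<in> X"
    and contr: "\<And>g g' B x. (\<And>x. x \<in> S \<Longrightarrow> g x \<in> X) \<Longrightarrow> (\<And>x. x \<in> S \<Longrightarrow> g' x \<in> X) \<Longrightarrow>
       (\<And>x. x \<in> S \<Longrightarrow> norm (g x - g' x) \<le> B) \<Longrightarrow> x \<in> S \<Longrightarrow> norm (T g x - T g' x) \<le> B / 2"
    and start: "\<And>x. x \<in> S \<Longrightarrow> norm (T init x - init x) \<le> B"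
  shows "\<exists>g. \<forall>x\<in>S. g x \<in> X \<and> T g x = g x"
proof -
  define s where "s n = (T ^^ n) init" for n
  have s_Suc: "s (Suc n) = T (s n)" for n by (simp add: s_def)
  have sX: "s n x \<in> X" if "x \<in> S" for n x
    using that by (induction n arbitrary: x) (auto simp: s_Suc s_def init intro: maps)
  have step: "norm (s (Suc n) x - s n x) \<le> B / 2 ^ n" if "x \<in> S" for n x
    using that
  proof (induction n arbitrary: x)
    case 0
    then show ?case using start by (simp add: s_def)
  next
    case (Suc n)
    have "norm (T (s (Suc n)) x - T (s n) x) \<le> (B / 2 ^ n) / 2"
      by (rule contr[OF sX sX Suc.IH Suc.prems])
    then show ?case by (simp add: s_Suc mult.commute)
  qed
  have tail: "norm (s (n + m) x - s n x) \<le> 2 * B / 2 ^ n - 2 * B / 2 ^ (n + m)" if "x \<in> S" for n m x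
  proof (induction m)
    case (Suc m)
    have "norm (s (n + Suc m) x - s n x) \<le> norm (s (Suc (n + m)) x - s (n + m) x) + norm (s (n + m) x - s n x)"
      using norm_triangle_ineq[of "s (Suc (n + m)) x - s (n + m) x" "s (n + m) x - s n x"] by simp
    also have "\<dots> \<le> B / 2 ^ (n + m) + (2 * B / 2 ^ n - 2 * B / 2 ^ (n + m))"
      by (intro add_mono step Suc.IH that)
    also have "\<dots> = 2 * B / 2 ^ n - 2 * B / 2 ^ (n + Suc m)" by (simp add: field_simps)
    finally show ?case .
  qed simp
  have "convergent (\<lambda>n. s n x)" if x: "x \<in> S" for x
  proof -
    have "summable (\<lambda>n. B * (1 / 2) ^ n)" by (intro summable_mult summable_geometric) simp
    then have "summable (\<lambda>n. s (Suc n) x - s n x)"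
      by (rule summable_comparison_test'[where N = 0]) (use step[OF x] in \<open>simp add: power_divide\<close>)
    then have "(\<lambda>n. \<Sum>i<n. s (Suc i) x - s i x) \<longlonglongrightarrow> (\<Sum>i. s (Suc i) x - s i x)"
      by (rule summable_LIMSEQ)
    moreover have "(\<Sum>i<n. s (Suc i) x - s i x) = s n x - s 0 x" for n by (induction n) simp_all
    ultimately have "(\<lambda>n. s n x - s 0 x) \<longlonglongrightarrow> (\<Sum>i. s (Suc i) x - s i x)" by simp
    from tendsto_add[OF this tendsto_const[of "s 0 x"]] show ?thesis by (auto intro: convergentI)
  qed
  then obtain g where g: "(\<lambda>n. s n x) \<longlonglongrightarrow> g x" if "x \<in> S" for x unfolding convergent_def by metis
  have gX: "g x \<in> X" if "x \<in> S" for x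
    using closed_sequentially[OF X _ g[OF that]] sX[OF that] by blast
  have close: "norm (s n x - g x) \<le> 2 * B / 2 ^ n" if x: "x \<in> S" for n x
  proof -
    have B: "B \<ge> 0" using start[OF x] norm_ge_zero order_trans by blast
    have "(\<lambda>m. norm (s (m + n) x - s n x)) \<longlonglongrightarrow> norm (g x - s n x)"
      by (intro tendsto_norm tendsto_diff tendsto_const LIMSEQ_ignore_initial_segment g x)
    moreover have "norm (s (m + n) x - s n x) \<le> 2 * B / 2 ^ n" for m
    proof -
      have "2 * B / 2 ^ (n + m) \<ge> 0" using B by simp
      then show ?thesis using tail[OF x, of n m] by (simp add: add.commute)
    qed
    ultimately have "norm (g x - s n x) \<le> 2 * B / 2 ^ n"
      by (intro LIMSEQ_le_const2[where X = "\<lambda>m. norm (s (m + n) x - s n x)"]) auto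
    then show ?thesis by (simp add: norm_minus_commute)
  qed
  have "T g x = g x" if x: "x \<in> S" for x
  proof -
    have le: "norm (s (Suc n) x - T g x) \<le> B * (1 / 2) ^ n" for n
      using contr[OF sX[where n = n] gX close[where n = n] x] by (simp add: s_Suc power_divide)
    have "(\<lambda>n. B * (1 / 2) ^ n) \<longlonglongrightarrow> B * 0"
      by (intro tendsto_mult tendsto_const LIMSEQ_power_zero) simp
    then have "(\<lambda>n. s (Suc n) x - T g x) \<longlonglongrightarrow> 0"
      by (intro Lim_null_comparison[OF always_eventually[OF allI[OF le]]]) simp
    from tendsto_add[OF this tendsto_const[of "T g x"]] have "(\<lambda>n. s (Suc n) x) \<longlonglongrightarrow> T g x" by simp
    then show ?thesis using LIMSEQ_unique LIMSEQ_Suc[OF g[OF x]] by blast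
  qed
  then show ?thesis using gX by blast
qed

text \<open>The primitive of \<open>hbvm_field\<close> that vanishes at \<open>c = 0\<close>.\<close>

definition hbvm_integral :: "nat \<Rightarrow> nat \<Rightarrow> (real \<Rightarrow> 'a::real_vector) \<Rightarrow> real \<Rightarrow> 'a" where
  "hbvm_integral k r v c = (\<Sum>j<r. poly (poly_primitive (shifted_legendre j)) c *\<^sub>R
     (\<Sum>x\<in>gauss_nodes k. (gauss_weight k x * poly (shifted_legendre j) x) *\<^sub>R v x))"

lemma hbvm_integral_inner:
  "hbvm_integral k r v c \<bullet> b = poly (poly_primitive (gauss_projection k r (\<lambda>x. v x \<bullet> b))) c"
  by (simp add: hbvm_integral_def gauss_projection_def inner_sum_left poly_sum poly_primitive_sum
      poly_primitive_smult sum_distrib_left sum_distrib_right mult_ac)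

lemma hbvm_integral_0 [simp]: "hbvm_integral k r v 0 = 0"
  by (simp add: hbvm_integral_def)

lemma hbvm_integral_cong:
  "(\<And>x. x \<in> gauss_nodes k \<Longrightarrow> v x = w x) \<Longrightarrow> hbvm_integral k r v c = hbvm_integral k r w c"
  by (simp add: hbvm_integral_def)

lemma hbvm_integral_diff:
  "hbvm_integral k r (\<lambda>x. v x - w x) c = hbvm_integral k r v c - hbvm_integral k r w c"
  by (simp add: hbvm_integral_def scaleR_diff_right sum_subtractf)

lemma hbvm_integral_bound:
  "\<exists>K\<ge>0. \<forall>(v::real \<Rightarrow> 'a::real_normed_vector) B c. c \<in> {0..1} \<longrightarrow>
     (\<forall>x\<in>gauss_nodes k. norm (v x) \<le> B) \<longrightarrow> norm (hbvm_integral k r v c) \<le> K * B"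
proof -
  have "\<exists>a. \<forall>c\<in>{0..1}. \<bar>poly (poly_primitive (shifted_legendre j)) c\<bar> \<le> a" for j
  proof -
    have "compact ((\<lambda>c. poly (poly_primitive (shifted_legendre j)) c) ` {0..1})"
      by (intro compact_continuous_image continuous_intros) auto
    from compact_imp_bounded[OF this] show ?thesis by (simp add: bounded_iff)
  qed
  then obtain a where a: "\<And>j c. c \<in> {0..1} \<Longrightarrow> \<bar>poly (poly_primitive (shifted_legendre j)) c\<bar> \<le> a j"
    by metis
  have a0: "a j \<ge> 0" for j using a[of 0 j] by simp
  define b where "b j = (\<Sum>x\<in>gauss_nodes k. \<bar>gauss_weight k x * poly (shifted_legendre j) x\<bar>)" for j
  have bnd: "norm (hbvm_integral k r v c) \<le> (\<Sum>j<r. a j * b j) * B"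
    if c: "c \<in> {0..1}" and v: "\<forall>x\<in>gauss_nodes k. norm (v x) \<le> B" for v :: "real \<Rightarrow> 'a" and B c
  proof -
    have "norm (hbvm_integral k r v c) \<le> (\<Sum>j<r. a j * (b j * B))"
      unfolding hbvm_integral_def
    proof (rule sum_norm_le)
      fix j
      have "norm (\<Sum>x\<in>gauss_nodes k. (gauss_weight k x * poly (shifted_legendre j) x) *\<^sub>R v x) \<le>
         (\<Sum>x\<in>gauss_nodes k. \<bar>gauss_weight k x * poly (shifted_legendre j) x\<bar> * B)"
        by (rule sum_norm_le) (use v in \<open>auto intro: mult_left_mono\<close>)
      also have "\<dots> = b j * B" by (simp add: b_def sum_distrib_right)
      finally show "norm (poly (poly_primitive (shifted_legendre j)) c *\<^sub>R
         (\<Sum>x\<in>gauss_nodes k. (gauss_weight k x * poly (shifted_legendre j) x) *\<^sub>R v x)) \<le> a j * (b j * B)"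
        unfolding norm_scaleR by (intro mult_mono a c a0 norm_ge_zero)
    qed
    also have "\<dots> = (\<Sum>j<r. a j * b j) * B"
      unfolding sum_distrib_right by (intro sum.cong refl) (rule mult.assoc[symmetric])
    finally show ?thesis .
  qed
  have nn: "(\<Sum>j<r. a j * b j) \<ge> 0"
    by (intro sum_nonneg mult_nonneg_nonneg a0) (simp add: b_def sum_nonneg)
  show ?thesis
  proof (rule exI[of _ "\<Sum>j<r. a j * b j"], rule conjI[OF nn], intro allI impI)
    fix v :: "real \<Rightarrow> 'a" and B c :: real
    assume "c \<in> {0..1}" "\<forall>x\<in>gauss_nodes k. norm (v x) \<le> B"
    then show "norm (hbvm_integral k r v c) \<le> (\<Sum>j<r. a j * b j) * B" by (rule bnd)
  qed
qed

text \<open>The right-hand side involves \<open>u\<close> only through its values at the nodes, so these satisfy a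
  fixed point equation among themselves and determine \<open>u\<close>.\<close>

lemma hbvm_solution_iff_integral:
  fixes f :: "'a::euclidean_space \<Rightarrow> 'a"
  assumes h: "h > 0"
  shows "hbvm_solution k r f t0 y0 h u \<longleftrightarrow>
    (\<forall>c. u (t0 + c * h) = y0 + h *\<^sub>R hbvm_integral k r (\<lambda>x. f (u (t0 + x * h))) c)"
proof
  assume sol: "hbvm_solution k r f t0 y0 h u"
  show "\<forall>c. u (t0 + c * h) = y0 + h *\<^sub>R hbvm_integral k r (\<lambda>x. f (u (t0 + x * h))) c"
  proof (rule allI, rule euclidean_eqI)
    fix c and b :: 'a
    from hbvm_solution_coordinate[OF sol, of b] obtain p where
      "degree p \<le> r \<and> (\<forall>c. u (t0 + c * h) \<bullet> b = poly p c) \<and> poly p 0 = y0 \<bullet> b \<and>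
      pderiv p = smult h (gauss_projection k r (\<lambda>x. f (u (t0 + x * h)) \<bullet> b))" ..
    then have p: "\<And>c. u (t0 + c * h) \<bullet> b = poly p c" "poly p 0 = y0 \<bullet> b"
      "pderiv p = smult h (gauss_projection k r (\<lambda>x. f (u (t0 + x * h)) \<bullet> b))" by simp_all
    show "u (t0 + c * h) \<bullet> b = (y0 + h *\<^sub>R hbvm_integral k r (\<lambda>x. f (u (t0 + x * h))) c) \<bullet> b"
      unfolding p(1) by (subst poly_primitive_unique[OF p(3)])
        (simp add: p(2) inner_add_left hbvm_integral_inner poly_primitive_smult)
  qed
next
  assume fix_eq: "\<forall>c. u (t0 + c * h) = y0 + h *\<^sub>R hbvm_integral k r (\<lambda>x. f (u (t0 + x * h))) c"
  define v where "v x = f (u (t0 + x * h))" for x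
  define U where "U c = y0 + h *\<^sub>R hbvm_integral k r v c" for c
  have u: "u t = U ((t - t0) / h)" for t
    using fix_eq[rule_format, of "(t - t0) / h"] h by (simp add: U_def v_def[abs_def])
  have "degree (poly_primitive (shifted_legendre j)) \<le> r" if "j < r" for j
    using degree_poly_primitive_le[of "shifted_legendre j"] that by (simp add: degree_shifted_legendre)
  then have "poly_curve r U"
    unfolding U_def hbvm_integral_def
    by (intro poly_curve_add poly_curve_const poly_curve_linear_image[OF bounded_linear_scaleR_right]
        poly_curve_sum poly_curve_poly) auto
  then have "poly_curve r (\<lambda>t. U (- t0 / h + t * (1 / h)))" by (rule poly_curve_affine)
  moreover have "u = (\<lambda>t. U (- t0 / h + t * (1 / h)))" by (simp add: u fun_eq_iff diff_divide_distrib)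
  ultimately have "poly_curve r u" by simp
  moreover have "u t0 = y0" by (simp add: u U_def)
  moreover have "(u has_vector_derivative hbvm_field k r v c) (at (t0 + c * h))" for c
  proof -
    have P: "((\<lambda>c. poly (poly_primitive p) c *\<^sub>R a) has_vector_derivative poly p c *\<^sub>R a) (at c)"
      for p and a :: 'a
      using poly_DERIV[of "poly_primitive p" c]
      unfolding pderiv_poly_primitive has_real_derivative_iff_has_vector_derivative
      by (rule bounded_linear.has_vector_derivative[OF bounded_linear_scaleR_left])
    have "(hbvm_integral k r v has_vector_derivative hbvm_field k r v c) (at c)"
      unfolding hbvm_integral_def hbvm_field_def by (intro has_vector_derivative_sum P)
    from bounded_linear.has_vector_derivative[OF bounded_linear_scaleR_right[of h] this]
    have "((\<lambda>c. h *\<^sub>R hbvm_integral k r v c) has_vector_derivative h *\<^sub>R hbvm_field k r v c) (at c)" .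
    then have "(U has_vector_derivative h *\<^sub>R hbvm_field k r v c) (at c)"
      unfolding U_def using has_vector_derivative_add[OF has_vector_derivative_const[of y0 "at c"]] by fastforce
    then have U: "(U has_vector_derivative h *\<^sub>R hbvm_field k r v c) (at ((t0 + c * h - t0) / h))"
      using h by simp
    have "((\<lambda>t. (t - t0) / h) has_vector_derivative 1 / h) (at (t0 + c * h))"
      using h by (auto intro!: derivative_eq_intros simp flip: has_real_derivative_iff_has_vector_derivative)
    from vector_diff_chain_at[OF this U] show ?thesis using h by (simp add: o_def u[abs_def])
  qed
  ultimately show "hbvm_solution k r f t0 y0 h u" unfolding hbvm_solution_iff v_def by blast
qed

theorem hbvm_local_solution_exists_unique:
  fixes f :: "'a::euclidean_space \<Rightarrow> 'a"
  assumes k: "k \<ge> 1" and \<delta>: "\<delta> > 0" and L: "L \<ge> 0"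
    and lip: "\<And>x y. x \<in> cball y0 \<delta> \<Longrightarrow> y \<in> cball y0 \<delta> \<Longrightarrow> norm (f x - f y) \<le> L * norm (x - y)"
  shows "\<forall>\<^sub>F h in at_right 0. \<exists>!u. hbvm_local_solution k r f t0 y0 \<delta> h u"
proof -
  obtain K where K: "K \<ge> 0" "\<And>(v::real \<Rightarrow> 'a) B c. c \<in> {0..1} \<Longrightarrow>
     (\<And>x. x \<in> gauss_nodes k \<Longrightarrow> norm (v x) \<le> B) \<Longrightarrow> norm (hbvm_integral k r v c) \<le> K * B"
    using hbvm_integral_bound[where 'a = 'a, of k r] by metis
  define M where "M = norm (f y0) + L * \<delta>"
  have M0: "M \<ge> 0" using L \<delta> by (simp add: M_def)
  have y0: "y0 \<in> cball y0 \<delta>" using \<delta> by simp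
  have M: "norm (f x) \<le> M" if "x \<in> cball y0 \<delta>" for x
  proof -
    have "norm (f x - f y0) \<le> L * norm (x - y0)" by (rule lip[OF that y0])
    also have "\<dots> \<le> L * \<delta>" using that L by (intro mult_left_mono) (auto simp: dist_norm norm_minus_commute)
    finally show ?thesis unfolding M_def using norm_triangle_sub[of "f x" "f y0"] by linarith
  qed
  have nodes: "x \<in> {0..1}" if "x \<in> gauss_nodes k" for x using gauss_nodes_subset[of k] that by auto
  \<comment> \<open>The first bound on \<open>h\<close> gives the contraction factor \<open>1 / 2\<close>, the second keeps the ball invariant.\<close>
  have "\<forall>\<^sub>F h in at_right 0. h \<in> {0<..<1 / (2 * K * L + 1)}"
    by (rule eventually_small) (use K(1) L in \<open>simp add: add_nonneg_pos\<close>)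
  moreover have "\<forall>\<^sub>F h in at_right 0. h \<in> {0<..<\<delta> / (K * M + 1)}"
    by (rule eventually_small) (use K(1) M0 \<delta> in \<open>simp add: add_nonneg_pos\<close>)
  ultimately show ?thesis
  proof eventually_elim
    case (elim h)
    then have h: "h > 0" by simp
    have hKL: "h * (K * L) \<le> 1 / 2"
    proof -
      have "h * (2 * K * L + 1) < 1" using elim(1) K(1) L
        by (simp add: pos_less_divide_eq add_nonneg_pos)
      then show ?thesis using h by (simp add: algebra_simps)
    qed
    have hKM: "h * (K * M) \<le> \<delta>"
    proof -
      have "h * (K * M + 1) < \<delta>" using elim(2) K(1) M0
        by (simp add: pos_less_divide_eq add_nonneg_pos)
      then show ?thesis using h by (simp add: algebra_simps)
    qed
    let ?\<Phi> = "\<lambda>g c. y0 + h *\<^sub>R hbvm_integral k r (\<lambda>x. f (g x)) c"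
    have stay: "?\<Phi> g c \<in> cball y0 \<delta>"
      if "\<And>x. x \<in> gauss_nodes k \<Longrightarrow> g x \<in> cball y0 \<delta>" "c \<in> {0..1}" for g c
    proof -
      have "norm (hbvm_integral k r (\<lambda>x. f (g x)) c) \<le> K * M" by (intro K(2) that M)
      then have "h * norm (hbvm_integral k r (\<lambda>x. f (g x)) c) \<le> h * (K * M)" using h by (intro mult_left_mono) auto
      then have "h * norm (hbvm_integral k r (\<lambda>x. f (g x)) c) \<le> \<delta>" using hKM by linarith
      then show ?thesis using h by (simp add: dist_norm)
    qed
    have contr: "norm (?\<Phi> g c - ?\<Phi> g' c) \<le> B / 2"
      if g: "\<And>x. x \<in> gauss_nodes k \<Longrightarrow> g x \<in> cball y0 \<delta>" and g': "\<And>x. x \<in> gauss_nodes k \<Longrightarrow> g' x \<in> cball y0 \<delta>"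
        and B: "\<And>x. x \<in> gauss_nodes k \<Longrightarrow> norm (g x - g' x) \<le> B" and c: "c \<in> {0..1}" for g g' B c
    proof -
      have "gauss_nodes k \<noteq> {}" using card_gauss_nodes[of k] k by auto
      then have B0: "B \<ge> 0" using B norm_ge_zero order_trans by (metis ex_in_conv)
      have "norm (f (g x) - f (g' x)) \<le> L * B" if "x \<in> gauss_nodes k" for x
        using lip[OF g[OF that] g'[OF that]] mult_left_mono[OF B[OF that] L] by linarith
      then have "norm (hbvm_integral k r (\<lambda>x. f (g x) - f (g' x)) c) \<le> K * (L * B)" by (intro K(2) c)
      then have "h * norm (hbvm_integral k r (\<lambda>x. f (g x) - f (g' x)) c) \<le> h * (K * (L * B))"
        using h by (intro mult_left_mono) auto
      also have "\<dots> \<le> 1 / 2 * B" using mult_right_mono[OF hKL B0] by (simp add: mult.assoc)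
      finally show ?thesis using h by (simp add: hbvm_integral_diff flip: scaleR_diff_right)
    qed
    show "\<exists>!u. hbvm_local_solution k r f t0 y0 \<delta> h u"
    proof (rule ex_ex1I)
      have "\<exists>g. \<forall>x\<in>gauss_nodes k. g x \<in> cball y0 \<delta> \<and> ?\<Phi> g x = g x"
      proof (rule contraction_family_fixed_point[where init = "\<lambda>x. y0" and B = \<delta>])
        show "?\<Phi> g x \<in> cball y0 \<delta>" if "\<And>x. x \<in> gauss_nodes k \<Longrightarrow> g x \<in> cball y0 \<delta>" "x \<in> gauss_nodes k" for g x
          by (rule stay[of g x, OF that(1) nodes[OF that(2)]])
        show "norm (?\<Phi> (\<lambda>x. y0) x - y0) \<le> \<delta>" if "x \<in> gauss_nodes k" for x
          using stay[of "\<lambda>x. y0", OF _ nodes[OF that]] \<delta> by (simp add: dist_norm)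
        show "norm (?\<Phi> g x - ?\<Phi> g' x) \<le> B / 2"
          if "\<And>x. x \<in> gauss_nodes k \<Longrightarrow> g x \<in> cball y0 \<delta>" "\<And>x. x \<in> gauss_nodes k \<Longrightarrow> g' x \<in> cball y0 \<delta>"
            "\<And>x. x \<in> gauss_nodes k \<Longrightarrow> norm (g x - g' x) \<le> B" "x \<in> gauss_nodes k" for g g' B x
          by (rule contr[of g g' B x, OF that(1-3) nodes[OF that(4)]])
      qed (use \<delta> in auto)
      then obtain g where g: "\<And>x. x \<in> gauss_nodes k \<Longrightarrow> g x \<in> cball y0 \<delta>"
        "\<And>x. x \<in> gauss_nodes k \<Longrightarrow> ?\<Phi> g x = g x" by blast
      define u where "u t = ?\<Phi> g ((t - t0) / h)" for t
      have uc: "u (t0 + c * h) = ?\<Phi> g c" for c using h by (simp add: u_def)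
      have "hbvm_solution k r f t0 y0 h u"
        unfolding hbvm_solution_iff_integral[OF h] uc
        by (intro allI arg_cong2[of _ _ _ _ "(+)"] arg_cong2[of _ _ _ _ scaleR] refl hbvm_integral_cong)
           (simp add: g(2))
      moreover have "dist y0 (u t) \<le> \<delta>" if "t \<in> {t0..t0 + h}" for t
        using stay[of g "(t - t0) / h", OF g(1)] that h unfolding u_def by (simp add: divide_le_eq)
      ultimately show "\<exists>u. hbvm_local_solution k r f t0 y0 \<delta> h u" unfolding hbvm_local_solution_def by blast
    next
      fix u w
      assume uw: "hbvm_local_solution k r f t0 y0 \<delta> h u" "hbvm_local_solution k r f t0 y0 \<delta> h w"
      have ball: "v (t0 + x * h) \<in> cball y0 \<delta>" if "hbvm_local_solution k r f t0 y0 \<delta> h v" "x \<in> gauss_nodes k" for v x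
      proof -
        have "t0 + x * h \<in> {t0..t0 + h}" using nodes[OF that(2)] h by (simp add: mult_le_cancel_right1)
        then show ?thesis using that(1) unfolding hbvm_local_solution_def by simp
      qed
      have eq: "v (t0 + c * h) = ?\<Phi> (\<lambda>x. v (t0 + x * h)) c" if "hbvm_local_solution k r f t0 y0 \<delta> h v" for v c
        using that unfolding hbvm_local_solution_def hbvm_solution_iff_integral[OF h] by blast
      let ?d = "\<lambda>x. norm (u (t0 + x * h) - w (t0 + x * h))"
      have ne: "finite (?d ` gauss_nodes k)" "?d ` gauss_nodes k \<noteq> {}"
        using finite_gauss_nodes card_gauss_nodes[of k] k by auto
      then obtain x0 where x0: "x0 \<in> gauss_nodes k" "?d x0 = Max (?d ` gauss_nodes k)"
        using Max_in by (metis (no_types, lifting) imageE)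
      have max: "?d x \<le> ?d x0" if "x \<in> gauss_nodes k" for x
        unfolding x0(2) using ne that by (intro Max_ge) auto
      have "?d x0 \<le> ?d x0 / 2"
        using contr[of "\<lambda>x. u (t0 + x * h)" "\<lambda>x. w (t0 + x * h)" "?d x0" x0,
            OF ball[OF uw(1)] ball[OF uw(2)] max nodes[OF x0(1)]]
        unfolding eq[OF uw(1), symmetric] eq[OF uw(2), symmetric] by simp
      then have "?d x0 = 0" using norm_ge_zero[of "u (t0 + x0 * h) - w (t0 + x0 * h)"] by linarith
      then have same: "u (t0 + x * h) = w (t0 + x * h)" if "x \<in> gauss_nodes k" for x using max[OF that] by simp
      have "u (t0 + c * h) = w (t0 + c * h)" for c
        unfolding eq[OF uw(1), of c] eq[OF uw(2), of c]
        by (intro arg_cong2[of _ _ _ _ "(+)"] arg_cong2[of _ _ _ _ scaleR] refl hbvm_integral_cong)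
           (simp add: same)
      then have "u t = w t" for t
        using h by (metis add.commute diff_add_cancel nonzero_divide_eq_eq less_numeral_extra(3))
      then show "u = w" by blast
    qed
  qed
qed

section \<open>Order of the method\<close>

lemma unif_O_dominated:
  assumes "\<forall>\<^sub>F h in at_right 0. \<forall>c\<in>{0..1}. norm (f h c) \<le> C * norm (g h c)" "unif_O n g"
  shows "unif_O n f"
proof -
  obtain D where D: "D \<ge> 0" "\<forall>\<^sub>F h in at_right 0. \<forall>c\<in>{0..1}. norm (g h c) \<le> D * h ^ n"
    using assms(2) by (rule unif_OE)
  have "\<forall>\<^sub>F h in at_right 0. \<forall>c\<in>{0..1}. norm (f h c) \<le> (\<bar>C\<bar> * D) * h ^ n"
    using assms(1) D(2)
  proof eventually_elim
    case (elim h)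
    have "norm (f h c) \<le> (\<bar>C\<bar> * D) * h ^ n" if c: "c \<in> {0..1}" for c
    proof -
      have "norm (f h c) \<le> C * norm (g h c)" using elim(1) c by blast
      also have "\<dots> \<le> \<bar>C\<bar> * norm (g h c)" by (intro mult_right_mono) auto
      also have "\<dots> \<le> \<bar>C\<bar> * (D * h ^ n)" using elim(2) c by (intro mult_left_mono) auto
      finally show ?thesis by (simp add: mult.assoc)
    qed
    then show ?case by blast
  qed
  then show ?thesis unfolding unif_O_def by blast
qed

lemma unif_O_cong:
  assumes "\<forall>\<^sub>F h in at_right 0. \<forall>c\<in>{0..1}. f h c = g h c" "unif_O n g"
  shows "unif_O n f"
  by (rule unif_O_dominated[where C = 1, OF _ assms(2)]) (use assms(1) in \<open>auto elim: eventually_mono\<close>)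

lemma unif_O_diff:
  assumes "unif_O n f" "unif_O n g"
  shows "unif_O n (\<lambda>h c. f h c - g h c)"
proof -
  have "unif_O n (\<lambda>h c. - g h c)" by (rule unif_O_dominated[where C = 1, OF _ assms(2)]) simp
  from unif_O_add[OF assms(1) this] show ?thesis by simp
qed

lemma unif_O_norm: "unif_O n g \<Longrightarrow> unif_O n (\<lambda>h c. norm (g h c))"
  by (simp add: unif_O_def)

lemma unif_O_power:
  fixes g :: "real \<Rightarrow> real \<Rightarrow> real"
  assumes "unif_O m g"
  shows "unif_O (m * n) (\<lambda>h c. g h c ^ n)"
proof (induction n)
  case 0
  show ?case unfolding unif_O_def by (intro exI[of _ 1]) simp
next
  case (Suc n)
  from unif_O_mult[OF assms Suc] show ?case by simp
qed

lemma unif_O_vector: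
  fixes g :: "real \<Rightarrow> real \<Rightarrow> real^'n::finite"
  assumes "\<And>i. unif_O n (\<lambda>h c. g h c $ i)"
  shows "unif_O n g"
proof -
  have "unif_O n (\<lambda>h c. \<Sum>i\<in>UNIV. norm (g h c $ i))" by (intro unif_O_sum unif_O_norm assms)
  then show ?thesis
  proof (rule unif_O_dominated[where C = 1, rotated], intro always_eventually allI ballI)
    fix h c :: real
    show "norm (g h c) \<le> 1 * norm (\<Sum>i\<in>UNIV. norm (g h c $ i))"
      using norm_le_l1_cart[of "g h c"] by (simp add: sum_nonneg)
  qed
qed

lemma coeffs_O_gauss_projection:
  assumes "unif_O n g"
  shows "coeffs_O n (\<lambda>h. gauss_projection k r (g h))"
proof -
  have "(\<lambda>h. \<Sum>x\<in>gauss_nodes k. gauss_weight k x * poly (shifted_legendre j) x * g h x) \<in> O_pow n" for j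
  proof (intro big_sum_in_bigo O_pow_cmult unif_O_imp_O_pow[OF assms])
    show "x \<in> {0..1}" if "x \<in> gauss_nodes k" for x using gauss_nodes_subset[of k] that by auto
  qed
  then have "coeffs_O n (\<lambda>h. [:\<Sum>x\<in>gauss_nodes k. gauss_weight k x * poly (shifted_legendre j) x * g h x:])" for j
    by (rule coeffs_O_constant)
  moreover have "coeffs_O 0 (\<lambda>h. p)" for p unfolding coeffs_O_def by auto
  ultimately have "coeffs_O (n + 0) (\<lambda>h. [:\<Sum>x\<in>gauss_nodes k. gauss_weight k x * poly (shifted_legendre j) x * g h x:] *
      shifted_legendre j)" for j by (rule coeffs_O_mult)
  then have "coeffs_O n (\<lambda>h. \<Sum>j<r. [:\<Sum>x\<in>gauss_nodes k. gauss_weight k x * poly (shifted_legendre j) x * g h x:] *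
      shifted_legendre j)" by (intro coeffs_O_sum) simp
  then show ?thesis by (simp add: gauss_projection_def)
qed

text \<open>At a point of \<open>[0,1]\<close> where the total error is largest, the mean value bound contains that same
  maximum with a factor proportional to \<open>h\<close>, which is absorbed for small \<open>h\<close>.\<close>

lemma error_bound_from_derivative:
  fixes e e' :: "'n::finite \<Rightarrow> real \<Rightarrow> real \<Rightarrow> real"
  assumes der: "\<forall>\<^sub>F h in at_right 0. \<forall>c\<in>{0..1}. \<forall>i.
      (e i h has_real_derivative h * e' i h c) (at c within {0..1})"
    and e0: "\<forall>\<^sub>F h in at_right 0. \<forall>i. e i h 0 = 0" and L: "L \<ge> 0"
    and e': "\<forall>\<^sub>F h in at_right 0. \<forall>c\<in>{0..1}. \<forall>i. \<bar>e' i h c\<bar> \<le> L * (\<Sum>j\<in>UNIV. \<bar>e j h c\<bar>) + D * h ^ n"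
  shows "unif_O (Suc n) (e i)"
proof -
  let ?N = "real CARD('n)"
  let ?E = "\<lambda>h c. \<Sum>j\<in>UNIV. \<bar>e j h c\<bar>"
  have "\<forall>\<^sub>F h in at_right 0. h \<in> {0<..<1 / (2 * ?N * L + 1)}"
    by (rule eventually_small) (use L in \<open>simp add: add_nonneg_pos\<close>)
  then have "\<forall>\<^sub>F h in at_right 0. \<forall>c\<in>{0..1}. norm (e i h c) \<le> (2 * ?N * D) * h ^ Suc n"
    using der e0 e'
  proof eventually_elim
    case (elim h)
    have h: "h > 0" using elim(1) by simp
    have hL: "?N * (h * L) \<le> 1 / 2"
    proof -
      have "h * (2 * ?N * L + 1) < 1" using elim(1) L by (simp add: pos_less_divide_eq add_nonneg_pos)
      then show ?thesis using h by (simp add: algebra_simps)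
    qed
    have "continuous_on {0..1} (e j h)" for j
      using elim(2) by (intro DERIV_continuous_on) blast
    then have "continuous_on {0..1} (?E h)" by (intro continuous_on_sum continuous_on_rabs)
    then obtain m where m: "m \<in> {0..1}" "\<And>c. c \<in> {0..1} \<Longrightarrow> ?E h c \<le> ?E h m"
      using continuous_attains_sup[of "{0..1}" "?E h"] by (auto simp: compact_Icc)
    define B where "B = h * (L * ?E h m + D * h ^ n)"
    have "\<bar>e j h m\<bar> \<le> B" for j
    proof -
      have "norm (h * e' j h c) \<le> B" if c: "c \<in> {0..1}" for c
      proof -
        have "\<bar>e' j h c\<bar> \<le> L * ?E h c + D * h ^ n" using elim(4) c by blast
        also have "\<dots> \<le> L * ?E h m + D * h ^ n" using m(2)[OF c] L by (intro add_right_mono mult_left_mono)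
        finally show ?thesis unfolding B_def using h by (simp add: abs_mult)
      qed
      then have "norm (e j h m - e j h 0) \<le> B * norm (m - 0)"
        using elim(2) m(1) by (intro field_differentiable_bound[of "{0..1}" _ "\<lambda>c. h * e' j h c"]) auto
      moreover have "B \<ge> 0"
        using \<open>\<And>c. c \<in> {0..1} \<Longrightarrow> norm (h * e' j h c) \<le> B\<close>[of 0] norm_ge_zero order_trans by fastforce
      then have "B * norm (m - 0) \<le> B * 1" using m(1) by (intro mult_left_mono) auto
      ultimately show ?thesis using elim(3) by simp
    qed
    then have "?E h m \<le> (\<Sum>j\<in>(UNIV::'n set). B)" by (intro sum_mono)
    also have "\<dots> = ?N * (h * L) * ?E h m + ?N * (D * h ^ Suc n)" by (simp add: B_def algebra_simps)
    also have "?N * (h * L) * ?E h m \<le> 1 / 2 * ?E h m"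
      by (intro mult_right_mono hL sum_nonneg) simp
    finally have E: "?E h m \<le> 2 * ?N * D * h ^ Suc n" by (simp add: mult.assoc)
    show ?case
    proof
      fix c :: real assume c: "c \<in> {0..1}"
      have "\<bar>e i h c\<bar> \<le> ?E h c" by (rule member_le_sum[of i UNIV "\<lambda>j. \<bar>e j h c\<bar>"]) auto
      also have "\<dots> \<le> 2 * ?N * D * h ^ Suc n" using m(2)[OF c] E by linarith
      finally show "norm (e i h c) \<le> (2 * ?N * D) * h ^ Suc n" by simp
    qed
  qed
  then show ?thesis unfolding unif_O_def by blast
qed

text \<open>By continuity the exact solution stays, for a short time, in the ball on which the field is
  bounded by \<open>M\<close>, and there it moves at speed at most \<open>M\<close>.\<close>

lemma ode_solution_local:
  fixes f :: "real^'n::finite \<Rightarrow> real^'n"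
  assumes sol: "ode_solution f \<Omega> t0 y0 T y" and T: "T > 0" and \<rho>: "\<rho> > 0"
    and M: "\<And>x. x \<in> cball y0 \<rho> \<Longrightarrow> norm (f x) \<le> M"
  shows "\<forall>\<^sub>F h in at_right 0. \<forall>c\<in>{0..1}. y (t0 + c * h) \<in> cball y0 \<rho> \<and>
     ((\<lambda>c. y (t0 + c * h)) has_vector_derivative h *\<^sub>R f (y (t0 + c * h))) (at c within {0..1})"
    and "unif_O 1 (\<lambda>h c. y (t0 + c * h) - y0)"
proof -
  have y0: "y t0 = y0" and der: "\<And>t. t \<in> {t0..t0 + T} \<Longrightarrow>
      (y has_vector_derivative f (y t)) (at t within {t0..t0 + T})"
    using sol unfolding ode_solution_def by auto
  have "continuous (at t0 within {t0..t0 + T}) y"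
    using der[of t0] T by (intro has_vector_derivative_continuous) auto
  then obtain \<eta> where \<eta>: "\<eta> > 0" "\<And>t. t \<in> {t0..t0 + T} \<Longrightarrow> dist t t0 < \<eta> \<Longrightarrow> dist (y t) (y t0) < \<rho>"
    using \<rho> unfolding continuous_within_eps_delta by blast
  have local: "y (t0 + c * h) \<in> cball y0 \<rho> \<and>
     ((\<lambda>c. y (t0 + c * h)) has_vector_derivative h *\<^sub>R f (y (t0 + c * h))) (at c within {0..1})"
    if h: "h \<in> {0<..<min T \<eta>}" and c: "c \<in> {0..1}" for h c
  proof
    have le: "0 \<le> s * h" "s * h \<le> h" if "s \<in> {0..1}" for s
      using that h by (auto simp: mult_le_cancel_right1)
    have img: "(\<lambda>s. t0 + s * h) ` {0..1} \<subseteq> {t0..t0 + T}"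
    proof (intro image_subsetI)
      fix s :: real assume s: "s \<in> {0..1}"
      have "h \<le> T" using h by simp
      then have "s * h \<le> T" using le(2)[OF s] by linarith
      then show "t0 + s * h \<in> {t0..t0 + T}" using le(1)[OF s] by simp
    qed
    have "dist (y (t0 + c * h)) (y t0) < \<rho>"
    proof (rule \<eta>(2))
      have "h < T" "h < \<eta>" using h by auto
      then have "c * h \<le> T" "c * h < \<eta>" using le(2)[OF c] by linarith+
      then show "t0 + c * h \<in> {t0..t0 + T}" "dist (t0 + c * h) t0 < \<eta>"
        using le(1)[OF c] by (simp_all add: dist_real_def)
    qed
    then show "y (t0 + c * h) \<in> cball y0 \<rho>" using y0 by (simp add: dist_commute)
    have "((\<lambda>s. t0 + s * h) has_vector_derivative h) (at c within {0..1})"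
      by (auto intro!: derivative_eq_intros simp flip: has_real_derivative_iff_has_vector_derivative)
    moreover have "(y has_vector_derivative f (y (t0 + c * h))) (at (t0 + c * h) within (\<lambda>s. t0 + s * h) ` {0..1})"
    proof (rule has_vector_derivative_within_subset[OF der img])
      show "t0 + c * h \<in> {t0..t0 + T}" using img c by blast
    qed
    ultimately show "((\<lambda>c. y (t0 + c * h)) has_vector_derivative h *\<^sub>R f (y (t0 + c * h))) (at c within {0..1})"
      using vector_diff_chain_within[of "\<lambda>s. t0 + s * h" h c "{0..1}" y] by (simp add: o_def)
  qed
  have small: "\<forall>\<^sub>F h in at_right 0. h \<in> {0<..<min T \<eta>}" using T \<eta>(1) by (intro eventually_small) simp
  then show ev: "\<forall>\<^sub>F h in at_right 0. \<forall>c\<in>{0..1}. y (t0 + c * h) \<in> cball y0 \<rho> \<and>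
     ((\<lambda>c. y (t0 + c * h)) has_vector_derivative h *\<^sub>R f (y (t0 + c * h))) (at c within {0..1})"
    by eventually_elim (use local in blast)
  show "unif_O 1 (\<lambda>h c. y (t0 + c * h) - y0)"
  proof (rule unif_O_vector)
    fix i
    have "\<forall>\<^sub>F h in at_right 0. \<forall>c\<in>{0..1}. norm ((y (t0 + c * h) - y0) $ i) \<le> M * h ^ 1"
      using small
    proof eventually_elim
      case (elim h)
      have hM: "h * M \<ge> 0" using elim M[of y0] \<rho> norm_ge_zero[of "f y0"] by (auto intro!: mult_nonneg_nonneg simp del: norm_ge_zero)
      show ?case
      proof
        fix c :: real assume c: "c \<in> {0..1}"
        have "norm (y (t0 + c * h) $ i - y (t0 + 0 * h) $ i) \<le> (h * M) * norm (c - 0)"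
        proof (rule field_differentiable_bound[of "{0..1}"])
          fix s :: real assume s: "s \<in> {0..1}"
          from local[OF elim s]
          have "((\<lambda>c. y (t0 + c * h) $ i) has_vector_derivative (h *\<^sub>R f (y (t0 + s * h))) $ i) (at s within {0..1})"
            using bounded_linear.has_vector_derivative[OF bounded_linear_vec_nth] by blast
          then show "((\<lambda>c. y (t0 + c * h) $ i) has_real_derivative h * f (y (t0 + s * h)) $ i) (at s within {0..1})"
            by (simp add: has_real_derivative_iff_has_vector_derivative)
          have "\<bar>f (y (t0 + s * h)) $ i\<bar> \<le> M"
            using order_trans[OF component_le_norm_cart M] local[OF elim s] by blast
          then show "norm (h * f (y (t0 + s * h)) $ i) \<le> h * M"
            using elim by (simp add: abs_mult)
        qed (use c in auto)
        also have "\<dots> \<le> (h * M) * 1" using c hM by (intro mult_left_mono) auto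
        finally show "norm ((y (t0 + c * h) - y0) $ i) \<le> M * h ^ 1" using y0 by (simp add: mult.commute)
      qed
    qed
    then show "unif_O 1 (\<lambda>h c. (y (t0 + c * h) - y0) $ i)" unfolding unif_O_def by blast
  qed
qed

lemma taylor_remainder_unif_O:
  fixes f :: "real^'n::finite \<Rightarrow> real^'n" and F :: "'n \<Rightarrow> real^'n \<Rightarrow> real"
  assumes "\<And>x i. x \<in> cball y0 \<rho> \<Longrightarrow> \<bar>f x $ i - F i x\<bar> \<le> C * norm (x - y0) ^ N"
    and "\<forall>\<^sub>F h in at_right 0. \<forall>c\<in>{0..1}. v h c \<in> cball y0 \<rho>" and "unif_O 1 (\<lambda>h c. v h c - y0)"
  shows "unif_O N (\<lambda>h c. f (v h c) $ i - F i (v h c))"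
proof (rule unif_O_dominated)
  show "unif_O N (\<lambda>h c. norm (v h c - y0) ^ N)"
    using unif_O_power[OF unif_O_norm[OF assms(3)], of N] by simp
  show "\<forall>\<^sub>F h in at_right 0. \<forall>c\<in>{0..1}. norm (f (v h c) $ i - F i (v h c)) \<le> C * norm (norm (v h c - y0) ^ N)"
    using assms(2) by eventually_elim (use assms(1) in simp)
qed

text \<open>The Taylor polynomial \<open>F\<close> of the field makes all objects on the discrete side graded
  polynomials: the coordinates \<open>P\<close> of the solution, the field \<open>q\<close> along it, the Jacobian \<open>A\<close>
  along it and the defect \<open>d\<close>.  What remains in the error equation, collected in \<open>s\<close>, consists of
  Taylor remainders and of the quadratic term in the error, which is \<open>O(h ^ (2 r + 2))\<close> because
  the error is already known to be \<open>O(h ^ (r + 1))\<close>.\<close>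

theorem hbvm_error_order:
  fixes f :: "real^'n::finite \<Rightarrow> real^'n"
  assumes r: "1 \<le> r" "r \<le> k" and \<rho>: "\<rho> > 0" and L: "L \<ge> 0"
    and lip: "\<And>x z. x \<in> cball y0 \<rho> \<Longrightarrow> z \<in> cball y0 \<rho> \<Longrightarrow> norm (f x - f z) \<le> L * norm (x - z)"
    and F: "\<And>i. real_polynomial_function (F i)"
      "\<And>x i. x \<in> cball y0 \<rho> \<Longrightarrow> \<bar>f x $ i - F i x\<bar> \<le> C * norm (x - y0) ^ (2 * r)"
    and u: "\<forall>\<^sub>F h in at_right 0. hbvm_local_solution k r f t0 y0 \<delta> h (u h)" and \<delta>: "\<delta> \<le> \<rho>"
    and ode: "ode_solution f \<Omega> t0 y0 T y" and T: "T > 0"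
  shows "(\<lambda>h. norm (y (t0 + h) - u h (t0 + h))) \<in> O_pow (2 * r + 1)"
proof -
  let ?Q = "gauss_projection k r"
  define M where "M = norm (f y0) + L * \<rho>"
  have M: "norm (f x) \<le> M" if "x \<in> cball y0 \<rho>" for x
  proof -
    have "norm (f x - f y0) \<le> L * norm (x - y0)" using \<rho> by (intro lip that) simp
    also have "\<dots> \<le> L * \<rho>" using that L by (intro mult_left_mono) (auto simp: dist_norm norm_minus_commute)
    finally show ?thesis unfolding M_def using norm_triangle_sub[of "f x" "f y0"] by linarith
  qed
  define v where "v h c = u h (t0 + c * h)" for h c
  define w where "w h c = y (t0 + c * h)" for h c
  define Qf where "Qf i h = ?Q (\<lambda>x. f (v h x) $ i)" for i h
  define P where "P i h = [:y0 $ i:] + smult h (poly_primitive (Qf i h))" for i h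
  have small: "\<forall>\<^sub>F h in at_right (0::real). h \<in> {0<..<1}" by (rule eventually_small) simp
  have v_ball: "\<forall>\<^sub>F h in at_right 0. \<forall>c\<in>{0..1}. v h c \<in> cball y0 \<rho>"
    using u small
  proof eventually_elim
    case (elim h)
    show ?case
    proof
      fix c :: real assume c: "c \<in> {0..1}"
      have "t0 + c * h \<in> {t0..t0 + h}" using c elim(2) by (auto simp: mult_le_cancel_right1)
      then have "dist y0 (v h c) \<le> \<delta>" using elim(1) unfolding hbvm_local_solution_def v_def by blast
      then show "v h c \<in> cball y0 \<rho>" using \<delta> by simp
    qed
  qed
  have v_P: "\<forall>\<^sub>F h in at_right 0. \<forall>c i. v h c $ i = poly (P i h) c"
    using u small
  proof eventually_elim
    case (elim h)
    show ?case
    proof (intro allI)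
      fix c i
      have "h > 0" using elim(2) by simp
      moreover have "hbvm_solution k r f t0 y0 h (u h)"
        using elim(1) unfolding hbvm_local_solution_def by blast
      ultimately have "\<forall>c. u h (t0 + c * h) = y0 + h *\<^sub>R hbvm_integral k r (\<lambda>x. f (u h (t0 + x * h))) c"
        by (rule iffD1[OF hbvm_solution_iff_integral])
      from spec[OF this, of c] have "v h c = y0 + h *\<^sub>R hbvm_integral k r (\<lambda>x. f (v h x)) c"
        unfolding v_def .
      then show "v h c $ i = poly (P i h) c"
        using hbvm_integral_inner[of k r "\<lambda>x. f (v h x)" c "axis i 1"]
        by (simp add: P_def Qf_def inner_axis)
    qed
  qed
  have v_vec: "\<forall>\<^sub>F h in at_right 0. \<forall>c. v h c = (\<chi> j. poly (P j h) c)"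
    using v_P by eventually_elim (simp add: vec_eq_iff)
  have fv: "unif_O 0 (\<lambda>h c. f (v h c) $ i)" for i
  proof -
    have "\<forall>\<^sub>F h in at_right 0. \<forall>c\<in>{0..1}. norm (f (v h c) $ i) \<le> M * h ^ 0"
      using v_ball by eventually_elim (simp add: order_trans[OF component_le_norm_cart M])
    then show ?thesis unfolding unif_O_def by blast
  qed
  have Qf0: "coeffs_O 0 (Qf i)" for i
    unfolding Qf_def[abs_def] by (rule coeffs_O_gauss_projection[OF fv])
  have v_dev: "unif_O 1 (\<lambda>h c. v h c - y0)"
  proof (rule unif_O_vector)
    fix i
    have "coeffs_O (Suc 0) (\<lambda>h. smult h (poly_primitive (Qf i h)))"
      by (intro coeffs_O_stepsize coeffs_O_poly_primitive Qf0)
    from unif_O_poly[OF this] have "unif_O 1 (\<lambda>h c. poly (smult h (poly_primitive (Qf i h))) c)" by simp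
    then show "unif_O 1 (\<lambda>h c. (v h c - y0) $ i)"
      by (rule unif_O_cong[rotated]) (use v_P in \<open>auto elim!: eventually_mono simp: P_def\<close>)
  qed
  define s1 where "s1 i h c = f (v h c) $ i - F i (v h c)" for i h c
  have s1: "unif_O (2 * r) (s1 i)" for i
    unfolding s1_def[abs_def] by (rule taylor_remainder_unif_O[OF F(2) v_ball v_dev])
  have Qs1: "coeffs_O (2 * r) (\<lambda>h. ?Q (s1 i h))" for i by (rule coeffs_O_gauss_projection[OF s1])
  have Qf_split: "\<forall>\<^sub>F h in at_right 0. Qf i h = ?Q (poly (q h)) + ?Q (s1 i h)"
    if "\<forall>h c. poly (q h) c = F i (\<chi> j. poly (P j h) c)" for q i
    using v_vec
  proof eventually_elim
    case (elim h)
    have "Qf i h = ?Q (\<lambda>x. poly (q h) x + s1 i h x)"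
      unfolding Qf_def by (intro gauss_projection_cong) (simp add: s1_def that flip: elim[rule_format])
    then show ?case by (simp only: gauss_projection_add)
  qed
  \<comment> \<open>Each application of the discrete equation improves the grading of the solution by one.\<close>
  have P_step: "graded (Suc n) (P i)" if "graded n (Qf i)" for n i
    unfolding P_def[abs_def] by (intro graded_add graded_const graded_integrate that)
  have P_graded: "\<forall>i. graded n (P i)" if "n \<le> 2 * r" for n
    using that
  proof (induction n)
    case 0
    have "graded (Suc 0) (P i)" for i by (rule P_step[OF coeffs_O_imp_graded[OF Qf0]])
    then show ?case using graded_mono by blast
  next
    case (Suc n)
    have "graded (Suc n) (P i)" for i
    proof (rule P_step)
      obtain q where q: "graded n q" "\<forall>h c. poly (q h) c = F i (\<chi> j. poly (P j h) c)"
        using graded_polynomial_function[OF F(1), of n P i] Suc by auto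
      have "graded n (\<lambda>h. ?Q (s1 i h))"
        by (rule graded_mono[OF coeffs_O_imp_graded[OF Qs1]]) (use Suc.prems in simp)
      then have "graded n (\<lambda>h. ?Q (poly (q h)) + ?Q (s1 i h))"
        by (intro graded_add graded_gauss_projection r q)
      then show "graded n (Qf i)" by (rule graded_cong[OF Qf_split[OF q(2)]])
    qed
    then show ?case by blast
  qed
  then have Pg: "graded (2 * r) (P i)" for i by blast
  have "\<exists>q. graded (2 * r) q \<and> (\<forall>h c. poly (q h) c = F i (\<chi> j. poly (P j h) c))" for i
    by (rule graded_polynomial_function[OF F(1) Pg])
  then obtain q where q: "\<And>i. graded (2 * r) (q i)" "\<And>i. \<forall>h c. poly (q i h) c = F i (\<chi> j. poly (P j h) c)"
    by metis
  define B where "B = norm y0 + \<rho>"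
  have B: "x \<in> cball 0 B" if "x \<in> cball y0 \<rho>" for x
    using that norm_triangle_sub[of x y0] by (simp add: B_def dist_norm norm_minus_commute)
  have "\<forall>i. \<exists>F'. (\<forall>j. real_polynomial_function (F' j)) \<and> (\<exists>C. \<forall>x\<in>cball 0 B. \<forall>z\<in>cball 0 B.
     \<bar>F i z - F i x - (\<Sum>j\<in>UNIV. F' j x * (z - x) $ j)\<bar> \<le> C * (norm (z - x))\<^sup>2)"
    by (rule allI) (rule polynomial_function_taylor2[OF F(1)])
  from choice[OF this] obtain F' where "\<forall>i. (\<forall>j. real_polynomial_function (F' i j)) \<and>
     (\<exists>C. \<forall>x\<in>cball 0 B. \<forall>z\<in>cball 0 B.
     \<bar>F i z - F i x - (\<Sum>j\<in>UNIV. F' i j x * (z - x) $ j)\<bar> \<le> C * (norm (z - x))\<^sup>2)" ..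
  note F'_all = spec[OF this]
  have F'_poly: "real_polynomial_function (F' i j)" for i j
    by (rule spec[OF conjunct1[OF F'_all]])
  have "\<exists>a. graded (2 * r) a \<and> (\<forall>h c. poly (a h) c = F' i j (\<chi> j. poly (P j h) c))" for i j
    by (rule graded_polynomial_function[OF F'_poly Pg])
  then obtain A where A: "\<And>i j. graded (2 * r) (A i j)"
    "\<And>i j. \<forall>h c. poly (A i j h) c = F' i j (\<chi> j. poly (P j h) c)" by metis
  have qv: "\<forall>\<^sub>F h in at_right 0. \<forall>c. poly (q i h) c = F i (v h c)" for i
    using v_vec by eventually_elim (simp add: q(2))
  have Av: "\<forall>\<^sub>F h in at_right 0. \<forall>c. poly (A i j h) c = F' i j (v h c)" for i j
    using v_vec by eventually_elim (simp add: A(2))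
  define d where "d i h = q i h - ?Q (poly (q i h))" for i h
  have d: "coeffs_O r (d i)" for i
    unfolding d_def[abs_def] by (rule coeffs_O_projection_defect[OF r q(1)]) simp
  have w: "\<forall>\<^sub>F h in at_right 0. \<forall>c\<in>{0..1}. w h c \<in> cball y0 \<rho> \<and>
      (w h has_vector_derivative h *\<^sub>R f (w h c)) (at c within {0..1})"
    unfolding w_def[abs_def] by (rule ode_solution_local(1)[OF ode T \<rho> M])
  have w_ball: "\<forall>\<^sub>F h in at_right 0. \<forall>c\<in>{0..1}. w h c \<in> cball y0 \<rho>"
    using w by eventually_elim blast
  have w_dev: "unif_O 1 (\<lambda>h c. w h c - y0)"
    unfolding w_def by (rule ode_solution_local(2)[OF ode T \<rho> M])
  define e where "e i h c = w h c $ i - v h c $ i" for i h c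
  define e' where "e' i h c = f (w h c) $ i - poly (Qf i h) c" for i h c
  have der: "\<forall>\<^sub>F h in at_right 0. \<forall>c\<in>{0..1}. \<forall>i.
      (e i h has_real_derivative h * e' i h c) (at c within {0..1})"
    using w v_P
  proof eventually_elim
    case (elim h)
    show ?case
    proof (intro ballI allI)
      fix c :: real and i assume c: "c \<in> {0..1}"
      have "((\<lambda>c. w h c $ i) has_vector_derivative (h *\<^sub>R f (w h c)) $ i) (at c within {0..1})"
        using elim(1) c bounded_linear.has_vector_derivative[OF bounded_linear_vec_nth] by blast
      then have W: "((\<lambda>c. w h c $ i) has_real_derivative h * f (w h c) $ i) (at c within {0..1})"
        by (simp add: has_real_derivative_iff_has_vector_derivative)
      have pd: "pderiv (P i h) = smult h (Qf i h)"
        by (simp add: P_def pderiv_add pderiv_smult pderiv_pCons)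
      have "(poly (P i h) has_real_derivative poly (pderiv (P i h)) c) (at c within {0..1})"
        by (rule has_field_derivative_at_within[OF poly_DERIV])
      then have V: "((\<lambda>c. poly (P i h) c) has_real_derivative h * poly (Qf i h) c) (at c within {0..1})"
        unfolding pd by simp
      have "e i h = (\<lambda>c. w h c $ i - poly (P i h) c)" using elim(2) by (simp add: e_def fun_eq_iff)
      then show "(e i h has_real_derivative h * e' i h c) (at c within {0..1})"
        using DERIV_diff[OF W V] by (simp add: e'_def right_diff_distrib)
    qed
  qed
  have e0: "\<forall>\<^sub>F h in at_right 0. \<forall>i. e i h 0 = 0"
    using u
  proof eventually_elim
    case (elim h)
    have "y t0 = y0" using ode unfolding ode_solution_def by blast
    moreover have "u h t0 = y0" using elim unfolding hbvm_local_solution_def hbvm_solution_def by blast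
    ultimately show ?case by (simp add: e_def w_def v_def)
  qed
  define D where "D i h c = s1 i h c + poly (d i h) c - poly (?Q (s1 i h)) c" for i h c
  have D: "unif_O r (D i)" for i
    unfolding D_def[abs_def]
    by (intro unif_O_diff unif_O_add unif_O_poly d unif_O_mono[OF s1] unif_O_mono[OF unif_O_poly[OF Qs1]]) auto
  have e'_eq: "\<forall>\<^sub>F h in at_right 0. \<forall>c. e' i h c = (f (w h c) $ i - f (v h c) $ i) + D i h c" for i
    using Qf_split[OF q(2), of i] qv[of i]
  proof eventually_elim
    case (elim h)
    show ?case
    proof
      fix c
      have "poly (Qf i h) c = poly (?Q (poly (q i h))) c + poly (?Q (s1 i h)) c"
        by (simp only: elim(1) poly_add)
      moreover have "poly (d i h) c = F i (v h c) - poly (?Q (poly (q i h))) c"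
        using elim(2) by (simp only: d_def poly_diff)
      ultimately show "e' i h c = (f (w h c) $ i - f (v h c) $ i) + D i h c"
        unfolding e'_def D_def by (simp add: s1_def)
    qed
  qed
  have "\<forall>i. \<exists>K. \<forall>\<^sub>F h in at_right 0. \<forall>c\<in>{0..1}. norm (D i h c) \<le> K * h ^ r"
    using D unfolding unif_O_def ..
  from choice[OF this] obtain K
    where K: "\<forall>i. \<forall>\<^sub>F h in at_right 0. \<forall>c\<in>{0..1}. norm (D i h c) \<le> K i * h ^ r" ..
  have "\<forall>\<^sub>F h in at_right 0. \<forall>i. \<forall>c\<in>{0..1}. norm (D i h c) \<le> K i * h ^ r"
    by (rule eventually_all_finite) (rule spec[OF K])
  moreover have "\<forall>\<^sub>F h in at_right 0. \<forall>i. \<forall>c. e' i h c = (f (w h c) $ i - f (v h c) $ i) + D i h c"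
    using e'_eq by (intro eventually_all_finite)
  ultimately have e'_bound: "\<forall>\<^sub>F h in at_right 0. \<forall>c\<in>{0..1}. \<forall>i.
      \<bar>e' i h c\<bar> \<le> L * (\<Sum>j\<in>UNIV. \<bar>e j h c\<bar>) + (\<Sum>j\<in>UNIV. \<bar>K j\<bar>) * h ^ r"
    using v_ball w_ball small
  proof eventually_elim
    case (elim h)
    show ?case
    proof (intro ballI allI)
      fix c :: real and i assume c: "c \<in> {0..1}"
      have "\<bar>f (w h c) $ i - f (v h c) $ i\<bar> \<le> norm (f (w h c) - f (v h c))"
        using component_le_norm_cart[of "f (w h c) - f (v h c)" i] by simp
      also have "\<dots> \<le> L * norm (w h c - v h c)" using elim(3,4) c by (intro lip) auto
      also have "norm (w h c - v h c) \<le> (\<Sum>j\<in>UNIV. \<bar>e j h c\<bar>)"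
        using norm_le_l1_cart[of "w h c - v h c"] by (simp add: e_def)
      finally have 1: "\<bar>f (w h c) $ i - f (v h c) $ i\<bar> \<le> L * (\<Sum>j\<in>UNIV. \<bar>e j h c\<bar>)"
        using L by (simp add: mult_left_mono)
      have "norm (D i h c) \<le> K i * h ^ r" using elim(1) c by blast
      also have "K i \<le> (\<Sum>j\<in>UNIV. \<bar>K j\<bar>)"
        using member_le_sum[of i UNIV "\<lambda>j. \<bar>K j\<bar>"] by simp
      finally have 2: "\<bar>D i h c\<bar> \<le> (\<Sum>j\<in>UNIV. \<bar>K j\<bar>) * h ^ r"
        using elim(5) by (simp add: mult_right_mono)
      have "e' i h c = (f (w h c) $ i - f (v h c) $ i) + D i h c" using elim(2) by blast
      then show "\<bar>e' i h c\<bar> \<le> L * (\<Sum>j\<in>UNIV. \<bar>e j h c\<bar>) + (\<Sum>j\<in>UNIV. \<bar>K j\<bar>) * h ^ r"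
        using 1 2 by linarith
    qed
  qed
  have e: "unif_O (Suc r) (e i)" for i
    by (rule error_bound_from_derivative[OF der e0 L e'_bound])
  have e_vec: "unif_O (Suc r) (\<lambda>h c. w h c - v h c)"
    using e by (intro unif_O_vector) (simp add: e_def[abs_def])
  define s where "s i h c = e' i h c - (\<Sum>j\<in>UNIV. poly (A i j h) c * e j h c) - poly (d i h) c" for i h c
  have s: "unif_O (2 * r) (s i)" for i
  proof -
    from conjunct2[OF F'_all[of i]] obtain C' where C': "\<forall>x\<in>cball 0 B. \<forall>z\<in>cball 0 B.
       \<bar>F i z - F i x - (\<Sum>j\<in>UNIV. F' i j x * (z - x) $ j)\<bar> \<le> C' * (norm (z - x))\<^sup>2" ..
    have 1: "unif_O (2 * r) (\<lambda>h c. f (w h c) $ i - F i (w h c))"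
      by (rule taylor_remainder_unif_O[OF F(2) w_ball w_dev])
    have "unif_O (Suc r * 2) (\<lambda>h c. norm (w h c - v h c) ^ 2)"
      by (rule unif_O_power[OF unif_O_norm[OF e_vec]])
    then have sq: "unif_O (2 * r) (\<lambda>h c. norm (w h c - v h c) ^ 2)" by (rule unif_O_mono) simp
    have 2: "unif_O (2 * r) (\<lambda>h c. F i (w h c) - F i (v h c) - (\<Sum>j\<in>UNIV. F' i j (v h c) * (w h c - v h c) $ j))"
    proof (rule unif_O_dominated[OF _ sq])
      show "\<forall>\<^sub>F h in at_right 0. \<forall>c\<in>{0..1}. norm (F i (w h c) - F i (v h c) -
          (\<Sum>j\<in>UNIV. F' i j (v h c) * (w h c - v h c) $ j)) \<le> C' * norm (norm (w h c - v h c) ^ 2)"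
        using v_ball w_ball
      proof eventually_elim
        case (elim h)
        show ?case
        proof
          fix c :: real assume "c \<in> {0..1}"
          then show "norm (F i (w h c) - F i (v h c) -
            (\<Sum>j\<in>UNIV. F' i j (v h c) * (w h c - v h c) $ j)) \<le> C' * norm (norm (w h c - v h c) ^ 2)"
            using bspec[OF bspec[OF C' B] B, of "v h c" "w h c"] elim by simp
        qed
      qed
    qed
    have "unif_O (2 * r) (\<lambda>h c. (f (w h c) $ i - F i (w h c)) +
       (F i (w h c) - F i (v h c) - (\<Sum>j\<in>UNIV. F' i j (v h c) * (w h c - v h c) $ j)) - poly (?Q (s1 i h)) c)"
      by (intro unif_O_diff unif_O_add 1 2 unif_O_poly Qs1)
    moreover have "\<forall>\<^sub>F h in at_right 0. \<forall>j c. poly (A i j h) c = F' i j (v h c)"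
      using Av by (intro eventually_all_finite)
    then have "\<forall>\<^sub>F h in at_right 0. \<forall>c\<in>{0..1}. s i h c = (f (w h c) $ i - F i (w h c)) +
       (F i (w h c) - F i (v h c) - (\<Sum>j\<in>UNIV. F' i j (v h c) * (w h c - v h c) $ j)) - poly (?Q (s1 i h)) c"
      using e'_eq[of i]
    proof eventually_elim
      case (elim h)
      have "(\<Sum>j\<in>UNIV. poly (A i j h) c * e j h c) = (\<Sum>j\<in>UNIV. F' i j (v h c) * (w h c - v h c) $ j)" for c
        using elim(1) by (simp add: e_def)
      then show ?case using elim(2) by (simp add: s_def D_def s1_def)
    qed
    ultimately show ?thesis by (rule unif_O_cong[rotated])
  qed
  have "(\<lambda>h. e l h 1) \<in> O_pow (2 * r + 1)" for l
  proof (rule superconvergence[OF r A(1) q(1) _ e0 e s])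
    show "\<forall>\<^sub>F h in at_right 0. \<forall>c\<in>{0..1}. \<forall>i. (e i h has_real_derivative
        h * ((\<Sum>j\<in>UNIV. poly (A i j h) c * e j h c) + poly (q i h - ?Q (poly (q i h))) c + s i h c))
        (at c within {0..1})"
      using der by (simp add: s_def d_def)
  qed
  then have sum: "(\<lambda>h. \<Sum>l\<in>UNIV. norm (e l h 1)) \<in> O_pow (2 * r + 1)"
    by (intro big_sum_in_bigo) simp
  have le: "norm (norm (y (t0 + h) - u h (t0 + h))) \<le> 1 * norm (\<Sum>l\<in>UNIV. norm (e l h 1))" for h
    using norm_le_l1_cart[of "w h 1 - v h 1"] by (simp add: e_def w_def v_def sum_nonneg)
  show ?thesis
    by (rule landau_o.big_trans[OF bigoI[OF always_eventually[OF allI[OF le]]] sum])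
qed

theorem hbvm_order:
  assumes r: "1 \<le> r" "r \<le> k"
  shows "hbvm_has_order TYPE('n::finite) k r (2 * r)"
  unfolding hbvm_has_order_def
proof (intro allI ballI impI)
  fix f :: "real^'n \<Rightarrow> real^'n" and \<Omega> and t0 :: real and y0
  assume y0: "y0 \<in> \<Omega>" and "open \<Omega>" "real_analytic_on f \<Omega>"
  from real_analytic_local[OF this(2,3,1)] obtain \<rho> L where \<rho>: "\<rho> > 0" "cball y0 \<rho> \<subseteq> \<Omega>" and L: "L \<ge> 0"
    "\<And>x z. x \<in> cball y0 \<rho> \<Longrightarrow> z \<in> cball y0 \<rho> \<Longrightarrow> norm (f x - f z) \<le> L * norm (x - z)"
    and taylor: "\<And>N. \<exists>F C. (\<forall>i. real_polynomial_function (F i)) \<and>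
       (\<forall>x\<in>cball y0 \<rho>. \<forall>i. \<bar>f x $ i - F i x\<bar> \<le> C * norm (x - y0) ^ N)" by blast
  obtain F C where F: "\<And>i. real_polynomial_function (F i)"
    "\<And>x i. x \<in> cball y0 \<rho> \<Longrightarrow> \<bar>f x $ i - F i x\<bar> \<le> C * norm (x - y0) ^ (2 * r)"
    using taylor[of "2 * r"] by blast
  show "\<exists>\<delta>0>0. cball y0 \<delta>0 \<subseteq> \<Omega> \<and> (\<forall>\<delta>. 0 < \<delta> \<and> \<delta> \<le> \<delta>0 \<longrightarrow>
           (\<forall>\<^sub>F h in at_right 0. \<exists>!u. hbvm_local_solution k r f t0 y0 \<delta> h u) \<and>
           (\<forall>T>0. \<forall>y. ode_solution f \<Omega> t0 y0 T y \<longrightarrow>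
              (\<lambda>h. norm (y (t0 + h) - (THE u. hbvm_local_solution k r f t0 y0 \<delta> h u) (t0 + h)))
                \<in> O[at_right 0](\<lambda>h. h ^ (2 * r + 1))))"
  proof (intro exI[of _ \<rho>] conjI \<rho> allI impI)
    fix \<delta> assume \<delta>: "0 < \<delta> \<and> \<delta> \<le> \<rho>"
    then have sub: "x \<in> cball y0 \<rho>" if "x \<in> cball y0 \<delta>" for x using that by auto
    show ex1: "\<forall>\<^sub>F h in at_right 0. \<exists>!u. hbvm_local_solution k r f t0 y0 \<delta> h u"
      using r \<delta> by (intro hbvm_local_solution_exists_unique[OF _ _ L(1) L(2)] sub) auto
    fix T :: real and y assume T: "T > 0" and ode: "ode_solution f \<Omega> t0 y0 T y"
    have "\<forall>\<^sub>F h in at_right 0. hbvm_local_solution k r f t0 y0 \<delta> h (THE u. hbvm_local_solution k r f t0 y0 \<delta> h u)"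
      using ex1
    proof eventually_elim
      case (elim h)
      then show ?case by (rule theI')
    qed
    from hbvm_error_order[OF r \<rho>(1) L F this _ ode T] \<delta>
    show "(\<lambda>h. norm (y (t0 + h) - (THE u. hbvm_local_solution k r f t0 y0 \<delta> h u) (t0 + h)))
                \<in> O[at_right 0](\<lambda>h. h ^ (2 * r + 1))" by blast
  qed
qed

theorem corollary4:
  fixes k r :: nat
  assumes "1 \<le> r" and "r \<le> k"
  shows "hbvm_perfectly_A_stable k r \<and>
         hbvm_has_order TYPE('n::finite) k r (2 * r) \<and>
         (\<forall>(H :: real^('m::finite + 'm) \<Rightarrow> real) \<nu> t0 y0 h u.
            poly_fun_of_degree_le \<nu> H \<longrightarrow> real \<nu> \<le> 2 * real k / real r \<longrightarrow> h > 0 \<longrightarrow>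
            hbvm_solution k r (hamiltonian_field H) t0 y0 h u \<longrightarrow>
            H (u (t0 + h)) = H y0)"
proof (intro conjI allI impI)
  show "hbvm_perfectly_A_stable k r" by (rule hbvm_perfectly_A_stable[OF assms])
  show "hbvm_has_order TYPE('n) k r (2 * r)" by (rule hbvm_order[OF assms])
next
  fix H :: "real^('m + 'm) \<Rightarrow> real" and \<nu> t0 y0 h u
  assume "poly_fun_of_degree_le \<nu> H" "real \<nu> \<le> 2 * real k / real r"
    "hbvm_solution k r (hamiltonian_field H) t0 y0 h u"
  then show "H (u (t0 + h)) = H y0" by (rule hbvm_energy_conservation[OF assms])
qed

end
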